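(* Let $\mathcal N$ be a semifinite von Neumann algebra on a separable Hilbert space with a faithful normal semifinite trace $\tau$. Let $1\le p<\infty$, $T\in\mathcal Z_p$, $T\ge0$. Let $\omega$ be a DPM state on $L_\infty(\mathbb R_+^* )$ and let $\tilde\omega$ be the state on $L_\infty(\mathbb R)$ with $\tilde\omega\circ L^{-1}=\omega$. Then, for every $q>0$, with $\zeta(s)=\tau(T^s)$, $$\omega\text{-}\lim_{\lambda\to\infty}\frac1\lambda\tau\bigl(e^{-T^{-q}\lambda^{-q/p}}\bigr)=\frac1q\Gamma(p/q)\;\tilde\omega\text{-}\lim_{r\to\infty}\frac1r\zeta\Bigl(p+\frac1r\Bigr)=\frac pq\,\Gamma(p/q)\,\tau_\omega(T^p).$$
   Context: For $A\in\mathcal N$ and $t\ge0$, $\mu_t(A)=\inf\{s\ge 0:\tau(E^{|A|}(s,\infty))\le t\}$, where $E^{|A|}$ is the spectral measure of $|A|$. $\mathcal Z_p$ is the set of positive $T\in\mathcal N$ with $\limsup_{s\downarrow p}\bigl((s-p)\tau(T^s)\bigr)^{1/s}<\infty$. For such $T$ one has $\sup_{u>1}\frac1{\log(1+u)}\int_0^u\mu_t(T^p)\,dt<\infty$. For $T\ge 0$ and $t>0$, $e^{-tT^{-q}}$ is the operator that is zero on $\ker T$ and is defined on $(\ker T)^\perp$ by the functional calculus; for $0\le T\in\mathcal Z_p$ it has finite trace for all $t>0$. $\mathbb R_+^*=(0,\infty)$. For functions on $\mathbb R_+^*$: $(D_af)(x)=f(x/a)$, $(P^af)(x)=f(x^a)$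 for $a>0$, and $(Mg)(t)=\frac1{\log t}\int_1^tg(s)\frac{ds}s$. $L:L_\infty(\mathbb R)\to L_\infty(\mathbb R_+^* )$ is the isomorphism $L(f)=f\circ\log$. A DPM state is a state $\omega$ on $L_\infty(\mathbb R_+^* )$ such that: (1) $\omega$ vanishes on continuous functions on $\mathbb R_+^*$ vanishing at $0$ and at $\infty$; (2) $\operatorname{ess\,liminf}_{t\to\infty}f(t)\le\omega(f)\le\operatorname{ess\,limsup}_{t\to\infty}f(t)$ for real-valued $f$; (3) $\omega(f)=0$ if $f$ has compact essential support; (4) $\omega=\omega\circ D_c=\omega\circ P^a=\omega\circ M$ for all $a,c>0$. We write $\omega\text{-}\lim_{t\to\infty}f(t)$ for $\omega(f)$, and similarly for $\tilde\omega$; by (2) these depend only on values at large arguments, and the notation is used also for functions specified only for large arguments. $\tau_\omega(T^p)=\omega\text{-}\lim_{t\to\infty}\frac1{\log(1+t)}\int_0^t\mu_s(T^p)\,ds$.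
   Formalization: The heat function (1/λ)τ(e^{-T^{-q}λ^{-q/p}}) need not be essentially bounded near infinity for T in Z_p; in that case its ω-limit, otherwise undefined, is read as ω applied to its logarithmic mean M; when it is bounded the ω-limit is the literal one. *)

theory Defs
  imports "HOL-Probability.Essential_Supremum"
begin

text \<open>The complex inner product is conjugate-linear in the first and linear in the second argument.
  The underlying real Hilbert space is that of the real part, so that norm, topology and
  completeness are inherited from \<^class>\<open>real_inner\<close> and \<^class>\<open>banach\<close>.\<close>

class complex_hilbert = real_inner + banach +
  fixes scaleC :: "complex \<Rightarrow> 'a \<Rightarrow> 'a" (infixr "*\<^sub>C" 75)
    and cinner :: "'a \<Rightarrow> 'a \<Rightarrow> complex"
  assumes scaleC_add_right: "c *\<^sub>C (x + y) = c *\<^sub>C x + c *\<^sub>C y"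
    and scaleC_add_left: "(c + d) *\<^sub>C x = c *\<^sub>C x + d *\<^sub>C x"
    and scaleC_scaleC: "c *\<^sub>C d *\<^sub>C x = (c * d) *\<^sub>C x"
    and scaleR_scaleC: "r *\<^sub>R x = complex_of_real r *\<^sub>C x"
    and cinner_commute: "cinner x y = cnj (cinner y x)"
    and cinner_add_right: "cinner x (y + z) = cinner x y + cinner x z"
    and cinner_scaleC_right: "cinner x (c *\<^sub>C y) = c * cinner x y"
    and inner_eq_Re_cinner: "inner x y = Re (cinner x y)"

instantiation complex :: complex_hilbert
begin

definition scaleC_complex :: "complex \<Rightarrow> complex \<Rightarrow> complex"
  where "scaleC_complex c x = c * x"

definition cinner_complex :: "complex \<Rightarrow> complex \<Rightarrow> complex"
  where "cinner_complex x y = cnj x * y"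

instance
  by standard
    (simp_all add: scaleC_complex_def cinner_complex_def algebra_simps scaleR_conv_of_real
      inner_complex_def)

end

text \<open>Bounded operators on the Hilbert space are the complex-linear elements of the type of
  bounded real-linear maps.\<close>

definition bounded_ops :: "('a::complex_hilbert \<Rightarrow>\<^sub>L 'a) set"
  where "bounded_ops = {A. \<forall>c x. blinfun_apply A (c *\<^sub>C x) = c *\<^sub>C blinfun_apply A x}"

definition op_adjoint :: "('a::complex_hilbert \<Rightarrow>\<^sub>L 'a) \<Rightarrow> ('a \<Rightarrow>\<^sub>L 'a)"
  where "op_adjoint A =
    (THE B. \<forall>x y. cinner (blinfun_apply B x) y = cinner x (blinfun_apply A y))"

definition op_pos :: "('a::complex_hilbert \<Rightarrow>\<^sub>L 'a) \<Rightarrow> bool"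
  where "op_pos A \<longleftrightarrow> A \<in> bounded_ops \<and> (\<forall>x. cinner x (blinfun_apply A x) \<in> \<real>\<^sub>\<ge>\<^sub>0)"

definition op_le :: "('a::complex_hilbert \<Rightarrow>\<^sub>L 'a) \<Rightarrow> ('a \<Rightarrow>\<^sub>L 'a) \<Rightarrow> bool"
  where "op_le A B \<longleftrightarrow> op_pos (B - A)"

definition op_abs :: "('a::complex_hilbert \<Rightarrow>\<^sub>L 'a) \<Rightarrow> ('a \<Rightarrow>\<^sub>L 'a)"
  where "op_abs A = (THE B. op_pos B \<and> B o\<^sub>L B = op_adjoint A o\<^sub>L A)"

definition is_projection :: "('a::complex_hilbert \<Rightarrow>\<^sub>L 'a) \<Rightarrow> bool"
  where "is_projection P \<longleftrightarrow> P \<in> bounded_ops \<and> P o\<^sub>L P = P \<and>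
    (\<forall>x y. cinner (blinfun_apply P x) y = cinner x (blinfun_apply P y))"

text \<open>The value on non-Borel sets is normalised to \<open>0\<close> so that a projection-valued measure is
  determined by its values on Borel sets.\<close>

definition projection_valued_measure :: "(real set \<Rightarrow> ('a::complex_hilbert \<Rightarrow>\<^sub>L 'a)) \<Rightarrow> bool"
  where "projection_valued_measure E \<longleftrightarrow>
    (\<forall>B\<in>sets borel. is_projection (E B)) \<and>
    (\<forall>B. B \<notin> sets borel \<longrightarrow> E B = 0) \<and>
    E UNIV = id_blinfun \<and>
    (\<forall>B\<in>sets borel. \<forall>C\<in>sets borel. E (B \<inter> C) = E B o\<^sub>L E C) \<and>
    (\<forall>F :: nat \<Rightarrow> real set. range F \<subseteq> sets borel \<longrightarrow> disjoint_family F \<longrightarrow>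
      (\<forall>x. (\<lambda>i. blinfun_apply (E (F i)) x) sums blinfun_apply (E (\<Union>i. F i)) x))"

definition vector_measure :: "(real set \<Rightarrow> ('a::complex_hilbert \<Rightarrow>\<^sub>L 'a)) \<Rightarrow> 'a \<Rightarrow> real measure"
  where "vector_measure E x =
    measure_of UNIV (sets borel) (\<lambda>B. ennreal (Re (cinner x (blinfun_apply (E B) x))))"

definition is_spectral_integral ::
    "(real set \<Rightarrow> ('a::complex_hilbert \<Rightarrow>\<^sub>L 'a)) \<Rightarrow> (real \<Rightarrow> real) \<Rightarrow> ('a \<Rightarrow>\<^sub>L 'a) \<Rightarrow> bool"
  where "is_spectral_integral E f B \<longleftrightarrow> B \<in> bounded_ops \<and>
    (\<forall>x. integrable (vector_measure E x) f \<and>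
      cinner x (blinfun_apply B x) = complex_of_real (integral\<^sup>L (vector_measure E x) f))"

text \<open>For self-adjoint \<open>A\<close>, integrability of the identity against all vector measures forces
  bounded support, which makes \<open>E\<close> unique.\<close>

definition spectral_measure :: "('a::complex_hilbert \<Rightarrow>\<^sub>L 'a) \<Rightarrow> real set \<Rightarrow> ('a \<Rightarrow>\<^sub>L 'a)"
  where "spectral_measure A =
    (THE E. projection_valued_measure E \<and> is_spectral_integral E (\<lambda>x. x) A)"

definition functional_calculus ::
    "(real \<Rightarrow> real) \<Rightarrow> ('a::complex_hilbert \<Rightarrow>\<^sub>L 'a) \<Rightarrow> ('a \<Rightarrow>\<^sub>L 'a)"
  where "functional_calculus f A = (THE B. is_spectral_integral (spectral_measure A) f B)"

text \<open>Only used for \<open>T \<ge> 0\<close> and \<open>s > 0\<close>; note \<open>0 powr s = 0\<close>.\<close>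

definition op_powr :: "('a::complex_hilbert \<Rightarrow>\<^sub>L 'a) \<Rightarrow> real \<Rightarrow> ('a \<Rightarrow>\<^sub>L 'a)"
  where "op_powr T s = functional_calculus (\<lambda>x. x powr s) T"

text \<open>The operator \<open>exp (- t T\<^sup>-\<^sup>q)\<close> for \<open>T \<ge> 0\<close>. Since \<open>E{0}\<close> is the projection onto
  the kernel of \<open>T\<close>, the value \<open>0\<close> of the symbol at \<open>0\<close> makes the operator vanish on the kernel, and on
  the orthogonal complement it is \<open>\<integral> exp (- t \<lambda>\<^sup>-\<^sup>q) dE(\<lambda>)\<close> over \<open>\<lambda> > 0\<close>.\<close>

definition heat_op :: "('a::complex_hilbert \<Rightarrow>\<^sub>L 'a) \<Rightarrow> real \<Rightarrow> real \<Rightarrow> ('a \<Rightarrow>\<^sub>L 'a)"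
  where "heat_op T q t =
    functional_calculus (\<lambda>x. if x > 0 then exp (- t * x powr (- q)) else 0) T"

definition commutant :: "('a::complex_hilbert \<Rightarrow>\<^sub>L 'a) set \<Rightarrow> ('a \<Rightarrow>\<^sub>L 'a) set"
  where "commutant S = {B \<in> bounded_ops. \<forall>A\<in>S. A o\<^sub>L B = B o\<^sub>L A}"

definition von_neumann_algebra :: "('a::complex_hilbert \<Rightarrow>\<^sub>L 'a) set \<Rightarrow> bool"
  where "von_neumann_algebra N \<longleftrightarrow>
    N \<subseteq> bounded_ops \<and> (\<forall>A\<in>N. op_adjoint A \<in> N) \<and> commutant (commutant N) = N"

definition pos_part :: "('a::complex_hilbert \<Rightarrow>\<^sub>L 'a) set \<Rightarrow> ('a \<Rightarrow>\<^sub>L 'a) set"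
  where "pos_part N = {A \<in> N. op_pos A}"

text \<open>Traces are \<open>[0,\<infinity>]\<close>-valued; only the values on the positive part of \<open>N\<close> are relevant.\<close>

definition is_trace ::
    "('a::complex_hilbert \<Rightarrow>\<^sub>L 'a) set \<Rightarrow> (('a \<Rightarrow>\<^sub>L 'a) \<Rightarrow> ennreal) \<Rightarrow> bool"
  where "is_trace N \<tau> \<longleftrightarrow>
    (\<forall>A\<in>pos_part N. \<forall>B\<in>pos_part N. \<tau> (A + B) = \<tau> A + \<tau> B) \<and>
    (\<forall>A\<in>pos_part N. \<forall>c\<ge>0. \<tau> (c *\<^sub>R A) = ennreal c * \<tau> A) \<and>
    (\<forall>A\<in>N. \<tau> (op_adjoint A o\<^sub>L A) = \<tau> (A o\<^sub>L op_adjoint A))"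

definition faithful_trace ::
    "('a::complex_hilbert \<Rightarrow>\<^sub>L 'a) set \<Rightarrow> (('a \<Rightarrow>\<^sub>L 'a) \<Rightarrow> ennreal) \<Rightarrow> bool"
  where "faithful_trace N \<tau> \<longleftrightarrow> (\<forall>A\<in>pos_part N. \<tau> A = 0 \<longrightarrow> A = 0)"

definition normal_trace ::
    "('a::complex_hilbert \<Rightarrow>\<^sub>L 'a) set \<Rightarrow> (('a \<Rightarrow>\<^sub>L 'a) \<Rightarrow> ennreal) \<Rightarrow> bool"
  where "normal_trace N \<tau> \<longleftrightarrow>
    (\<forall>D A. D \<noteq> {} \<and> D \<subseteq> pos_part N \<and>
       (\<forall>B\<in>D. \<forall>C\<in>D. \<exists>F\<in>D. op_le B F \<and> op_le C F) \<and>
       A \<in> pos_part N \<and> (\<forall>B\<in>D. op_le B A) \<and>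
       (\<forall>C\<in>pos_part N. (\<forall>B\<in>D. op_le B C) \<longrightarrow> op_le A C)
     \<longrightarrow> \<tau> A = (SUP B\<in>D. \<tau> B))"

definition semifinite_trace ::
    "('a::complex_hilbert \<Rightarrow>\<^sub>L 'a) set \<Rightarrow> (('a \<Rightarrow>\<^sub>L 'a) \<Rightarrow> ennreal) \<Rightarrow> bool"
  where "semifinite_trace N \<tau> \<longleftrightarrow>
    (\<forall>A\<in>pos_part N. A \<noteq> 0 \<longrightarrow> (\<exists>B\<in>pos_part N. B \<noteq> 0 \<and> op_le B A \<and> \<tau> B < \<infinity>))"

definition singular_number ::
    "(('a::complex_hilbert \<Rightarrow>\<^sub>L 'a) \<Rightarrow> ennreal) \<Rightarrow> ('a \<Rightarrow>\<^sub>L 'a) \<Rightarrow> real \<Rightarrow> real"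
  where "singular_number \<tau> A t =
    Inf {s. 0 \<le> s \<and> \<tau> (spectral_measure (op_abs A) {s<..}) \<le> ennreal t}"

definition ennreal_powr :: "ennreal \<Rightarrow> real \<Rightarrow> ennreal"
  where "ennreal_powr x a = (if x = \<infinity> then \<infinity> else ennreal (enn2real x powr a))"

definition Z_class ::
    "('a::complex_hilbert \<Rightarrow>\<^sub>L 'a) set \<Rightarrow> (('a \<Rightarrow>\<^sub>L 'a) \<Rightarrow> ennreal) \<Rightarrow> real \<Rightarrow> ('a \<Rightarrow>\<^sub>L 'a) set"
  where "Z_class N \<tau> p = {T \<in> pos_part N.
    Limsup (at_right p) (\<lambda>s. ennreal_powr (ennreal (s - p) * \<tau> (op_powr T s)) (1 / s)) < \<infinity>}"

definition zeta_fun ::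
    "(('a::complex_hilbert \<Rightarrow>\<^sub>L 'a) \<Rightarrow> ennreal) \<Rightarrow> ('a \<Rightarrow>\<^sub>L 'a) \<Rightarrow> real \<Rightarrow> real"
  where "zeta_fun \<tau> T s = enn2real (\<tau> (op_powr T s))"

text \<open>\<open>L\<^sub>\<infinity>(S)\<close> is represented by its Borel measurable representatives; functionals on the
  quotient are functionals on representatives that respect equality almost everywhere. Values of
  representatives outside \<open>S\<close> are irrelevant.\<close>

definition Linf :: "real set \<Rightarrow> (real \<Rightarrow> complex) set"
  where "Linf S = {f \<in> borel_measurable (restrict_space lborel S).
    \<exists>C. AE x in restrict_space lborel S. norm (f x) \<le> C}"

definition Linf_state :: "real set \<Rightarrow> ((real \<Rightarrow> complex) \<Rightarrow> complex) \<Rightarrow> bool"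
  where "Linf_state S \<phi> \<longleftrightarrow>
    (\<forall>f\<in>Linf S. \<forall>g\<in>Linf S. (AE x in restrict_space lborel S. f x = g x) \<longrightarrow> \<phi> f = \<phi> g) \<and>
    (\<forall>f\<in>Linf S. \<forall>g\<in>Linf S. \<phi> (\<lambda>x. f x + g x) = \<phi> f + \<phi> g) \<and>
    (\<forall>f\<in>Linf S. \<forall>c. \<phi> (\<lambda>x. c * f x) = c * \<phi> f) \<and>
    (\<forall>f\<in>Linf S. (AE x in restrict_space lborel S. f x \<in> \<real>\<^sub>\<ge>\<^sub>0) \<longrightarrow> \<phi> f \<in> \<real>\<^sub>\<ge>\<^sub>0) \<and>
    \<phi> (\<lambda>_. 1) = 1"

definition ess_limsup_at_top :: "(real \<Rightarrow> real) \<Rightarrow> ereal"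
  where "ess_limsup_at_top f =
    (INF a\<in>{0<..}. esssup (restrict_space lborel {a<..}) (\<lambda>t. ereal (f t)))"

definition ess_liminf_at_top :: "(real \<Rightarrow> real) \<Rightarrow> ereal"
  where "ess_liminf_at_top f = - ess_limsup_at_top (\<lambda>t. - f t)"

definition dilation :: "real \<Rightarrow> (real \<Rightarrow> complex) \<Rightarrow> real \<Rightarrow> complex"
  where "dilation a f = (\<lambda>x. f (x / a))"

definition power_subst :: "real \<Rightarrow> (real \<Rightarrow> complex) \<Rightarrow> real \<Rightarrow> complex"
  where "power_subst a f = (\<lambda>x. f (x powr a))"

text \<open>The integral is oriented: for \<open>t < 1\<close> both the integral and the logarithm change sign.\<close>

definition log_mean :: "(real \<Rightarrow> complex) \<Rightarrow> real \<Rightarrow> complex"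
  where "log_mean g = (\<lambda>t. (1 / ln t) *\<^sub>R (LBINT s=ereal 1..ereal t. (1 / s) *\<^sub>R g s))"

definition log_iso :: "(real \<Rightarrow> complex) \<Rightarrow> real \<Rightarrow> complex"
  where "log_iso f = (\<lambda>t. f (ln t))"

definition log_iso_inv :: "(real \<Rightarrow> complex) \<Rightarrow> real \<Rightarrow> complex"
  where "log_iso_inv g = (\<lambda>x. g (exp x))"

lemma log_iso_inv_log_iso: "log_iso_inv (log_iso f) = f"
  by (simp add: log_iso_def log_iso_inv_def)

lemma log_iso_log_iso_inv: "0 < t \<Longrightarrow> log_iso (log_iso_inv g) t = g t"
  by (simp add: log_iso_def log_iso_inv_def)

definition DPM_state :: "((real \<Rightarrow> complex) \<Rightarrow> complex) \<Rightarrow> bool"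
  where "DPM_state \<omega> \<longleftrightarrow> Linf_state {0<..} \<omega> \<and>
    (\<forall>f\<in>Linf {0<..}. continuous_on {0<..} f \<and> (f \<longlongrightarrow> 0) (at_right 0) \<and> (f \<longlongrightarrow> 0) at_top
      \<longrightarrow> \<omega> f = 0) \<and>
    (\<forall>f :: real \<Rightarrow> real. (\<lambda>t. complex_of_real (f t)) \<in> Linf {0<..} \<longrightarrow>
      (\<exists>l. \<omega> (\<lambda>t. complex_of_real (f t)) = complex_of_real l \<and>
        ess_liminf_at_top f \<le> ereal l \<and> ereal l \<le> ess_limsup_at_top f)) \<and>
    (\<forall>f\<in>Linf {0<..}. (\<exists>K. compact K \<and> K \<subseteq> {0<..} \<and>
        (AE x in restrict_space lborel {0<..}. x \<notin> K \<longrightarrow> f x = 0)) \<longrightarrow> \<omega> f = 0) \<and>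
    (\<forall>f\<in>Linf {0<..}. \<forall>a>0. \<forall>c>0.
      \<omega> f = \<omega> (dilation c f) \<and> \<omega> f = \<omega> (power_subst a f) \<and> \<omega> f = \<omega> (log_mean f))"

definition tail_fun :: "real \<Rightarrow> (real \<Rightarrow> complex) \<Rightarrow> real \<Rightarrow> complex"
  where "tail_fun a f = (\<lambda>x. if a \<le> x then f x else 0)"

text \<open>The value of \<open>\<phi>\<close> at a function specified only for large arguments: the common value of
  \<open>\<phi>\<close> at all sufficiently late truncations.\<close>

definition state_lim ::
    "real set \<Rightarrow> ((real \<Rightarrow> complex) \<Rightarrow> complex) \<Rightarrow> (real \<Rightarrow> complex) \<Rightarrow> complex"
  where "state_lim S \<phi> f =
    (THE l. \<forall>\<^sub>F a in at_top. tail_fun a f \<in> Linf S \<and> \<phi> (tail_fun a f) = l)"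

text \<open>For \<open>f\<close> essentially bounded near \<open>\<infinity>\<close> this is the value of \<open>\<omega>\<close> itself. The heat function
  \<open>\<lambda> \<mapsto> \<tau> (exp (- T\<^sup>-\<^sup>q \<lambda>\<^sup>-\<^sup>q\<^sup>/\<^sup>p)) / \<lambda>\<close> need not be bounded near \<open>\<infinity>\<close> for \<open>T\<close> in the class
  \<open>Z\<^sub>p\<close>; only its logarithmic mean is. For such functions \<open>\<omega>\<close> is extended in
  the only way compatible with \<open>\<omega> = \<omega> \<circ> M\<close>, by \<open>\<omega>(f) = \<omega>(M f)\<close>.\<close>

definition omega_lim :: "((real \<Rightarrow> complex) \<Rightarrow> complex) \<Rightarrow> (real \<Rightarrow> complex) \<Rightarrow> complex"
  where "omega_lim \<omega> f =
    (if \<exists>a>0. tail_fun a f \<in> Linf {0<..} then state_lim {0<..} \<omega> f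
     else state_lim {0<..} \<omega> (log_mean f))"

definition dixmier_value ::
    "(('a::complex_hilbert \<Rightarrow>\<^sub>L 'a) \<Rightarrow> ennreal) \<Rightarrow> ((real \<Rightarrow> complex) \<Rightarrow> complex) \<Rightarrow>
      ('a \<Rightarrow>\<^sub>L 'a) \<Rightarrow> complex"
  where "dixmier_value \<tau> \<omega> A =
    omega_lim \<omega> (\<lambda>t. complex_of_real
      (1 / ln (1 + t) * (LINT s:{0..t}|lborel. singular_number \<tau> A s)))"

lemma tail_fun_Linf:
  assumes "f \<in> Linf S"
  shows "tail_fun a f \<in> Linf S"
proof -
  obtain C where f: "f \<in> borel_measurable (restrict_space lborel S)"
    and C: "AE x in restrict_space lborel S. norm (f x) \<le> C"
    using assms by (auto simp: Linf_def)
  have "{x. a \<le> x} = {a..}" by auto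
  hence "{x \<in> space (restrict_space lborel S). a \<le> x} = S \<inter> {a..}"
    by (auto simp: space_restrict_space)
  moreover have "S \<inter> {a..} \<in> sets (restrict_space lborel S)"
    unfolding sets_restrict_space by auto
  ultimately have "tail_fun a f \<in> borel_measurable (restrict_space lborel S)"
    unfolding tail_fun_def using f by (intro measurable_If) auto
  moreover have "AE x in restrict_space lborel S. norm (tail_fun a f x) \<le> max C 0"
    using C by eventually_elim (auto simp: tail_fun_def)
  ultimately show ?thesis by (auto simp: Linf_def)
qed

lemma Linf_scale:
  assumes "f \<in> Linf S"
  shows "(\<lambda>x. c * f x) \<in> Linf S"
proof -
  obtain C where f: "f \<in> borel_measurable (restrict_space lborel S)"
    and C: "AE x in restrict_space lborel S. norm (f x) \<le> C"
    using assms by (auto simp: Linf_def)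
  have "AE x in restrict_space lborel S. norm (c * f x) \<le> norm c * C"
    using C by eventually_elim (auto simp: norm_mult intro!: mult_left_mono)
  then show ?thesis using f by (auto simp: Linf_def)
qed

lemma Linf_add:
  assumes "f \<in> Linf S" "g \<in> Linf S"
  shows "(\<lambda>x. f x + g x) \<in> Linf S"
proof -
  obtain C D where f: "f \<in> borel_measurable (restrict_space lborel S)"
    "g \<in> borel_measurable (restrict_space lborel S)"
    and C: "AE x in restrict_space lborel S. norm (f x) \<le> C"
    and D: "AE x in restrict_space lborel S. norm (g x) \<le> D"
    using assms by (auto simp: Linf_def)
  have "AE x in restrict_space lborel S. norm (f x + g x) \<le> C + D"
    using C D by eventually_elim (rule norm_triangle_mono)
  then show ?thesis using f by (auto simp: Linf_def)
qed

lemma Linf_Re_Im: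
  assumes "f \<in> Linf S"
  shows "(\<lambda>x. complex_of_real (Re (f x))) \<in> Linf S"
    and "(\<lambda>x. complex_of_real (Im (f x))) \<in> Linf S"
proof -
  obtain C where f: "f \<in> borel_measurable (restrict_space lborel S)"
    and C: "AE x in restrict_space lborel S. norm (f x) \<le> C"
    using assms by (auto simp: Linf_def)
  have "AE x in restrict_space lborel S. norm (complex_of_real (Re (f x))) \<le> C"
    using C by eventually_elim (use abs_Re_le_cmod order_trans in auto)
  moreover have "AE x in restrict_space lborel S. norm (complex_of_real (Im (f x))) \<le> C"
    using C by eventually_elim (use abs_Im_le_cmod order_trans in auto)
  moreover have "(\<lambda>x. Re (f x)) \<in> borel_measurable (restrict_space lborel S)"
    "(\<lambda>x. Im (f x)) \<in> borel_measurable (restrict_space lborel S)"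
    using f by (auto intro: borel_measurable_Re borel_measurable_Im)
  ultimately show "(\<lambda>x. complex_of_real (Re (f x))) \<in> Linf S"
    and "(\<lambda>x. complex_of_real (Im (f x))) \<in> Linf S"
    by (auto simp: Linf_def)
qed

lemma ess_limsup_at_top_le_0:
  assumes "0 < a" "\<And>x. a \<le> x \<Longrightarrow> f x = 0"
  shows "ess_limsup_at_top f \<le> 0"
proof -
  have "esssup (restrict_space lborel {a<..}) (\<lambda>t. ereal (f t)) \<le> 0"
  proof (rule esssup_I)
    have "(\<lambda>t. ereal (f t)) \<in> borel_measurable (restrict_space lborel {a<..})
      \<longleftrightarrow> (\<lambda>t. 0::ereal) \<in> borel_measurable (restrict_space lborel {a<..})"
      using assms(2) by (intro measurable_cong) (auto simp: space_restrict_space)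
    then show "(\<lambda>t. ereal (f t)) \<in> borel_measurable (restrict_space lborel {a<..})" by simp
    show "AE t in restrict_space lborel {a<..}. ereal (f t) \<le> 0"
      by (rule AE_I2) (use assms(2) in \<open>auto simp: space_restrict_space\<close>)
  qed
  then show ?thesis
    unfolding ess_limsup_at_top_def by (rule INF_lower2[rotated]) (use assms(1) in auto)
qed

lemma Linf_state_add:
  assumes "Linf_state S \<phi>" "f \<in> Linf S" "g \<in> Linf S"
  shows "\<phi> (\<lambda>x. f x + g x) = \<phi> f + \<phi> g"
  by (rule assms(1)[unfolded Linf_state_def, THEN conjunct2, THEN conjunct1,
        THEN bspec, OF assms(2), THEN bspec, OF assms(3)])

lemma Linf_state_scale:
  assumes "Linf_state S \<phi>" "f \<in> Linf S"
  shows "\<phi> (\<lambda>x. c * f x) = c * \<phi> f"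
  by (rule assms(1)[unfolded Linf_state_def, THEN conjunct2, THEN conjunct2, THEN conjunct1,
        THEN bspec, OF assms(2), THEN spec])

lemma DPM_state_vanishing_tail:
  assumes \<omega>: "DPM_state \<omega>" and d: "d \<in> Linf {0<..}" and a: "0 < a" "\<And>x. a \<le> x \<Longrightarrow> d x = 0"
  shows "\<omega> d = 0"
proof -
  have real: "\<omega> (\<lambda>x. complex_of_real (g x)) = 0"
    if g: "(\<lambda>x. complex_of_real (g x)) \<in> Linf {0<..}" and z: "\<And>x. a \<le> x \<Longrightarrow> g x = 0" for g
  proof -
    have "\<exists>l. \<omega> (\<lambda>t. complex_of_real (g t)) = complex_of_real l \<and>
        ess_liminf_at_top g \<le> ereal l \<and> ereal l \<le> ess_limsup_at_top g"
      using \<omega>[unfolded DPM_state_def, THEN conjunct2, THEN conjunct2, THEN conjunct1,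
        THEN spec[of _ g], THEN mp, OF g] .
    then obtain l where l: "\<omega> (\<lambda>t. complex_of_real (g t)) = complex_of_real l"
      "ess_liminf_at_top g \<le> ereal l" "ereal l \<le> ess_limsup_at_top g"
      by (elim exE conjE)
    have U: "ess_limsup_at_top g \<le> 0" "ess_limsup_at_top (\<lambda>t. - g t) \<le> 0"
      using ess_limsup_at_top_le_0[OF a(1)] z by auto
    have "0 \<le> ess_liminf_at_top g"
      using U(2) by (simp add: ess_liminf_at_top_def ereal_0_le_uminus_iff)
    with l(2) have "0 \<le> ereal l" by (rule order_trans[rotated])
    moreover have "ereal l \<le> 0" using l(3) U(1) by (rule order_trans)
    ultimately have "l = 0" by simp
    then show ?thesis using l(1) by simp
  qed
  have st: "Linf_state {0<..} \<omega>" using \<omega> by (simp add: DPM_state_def)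
  note RI = Linf_Re_Im[OF d]
  have "\<omega> d = \<omega> (\<lambda>x. complex_of_real (Re (d x)) + \<i> * complex_of_real (Im (d x)))"
    by (intro arg_cong[of _ _ \<omega>] ext) (rule complex_eq)
  also have "\<dots> = \<omega> (\<lambda>x. complex_of_real (Re (d x))) + \<i> * \<omega> (\<lambda>x. complex_of_real (Im (d x)))"
    using Linf_state_add[OF st RI(1) Linf_scale[OF RI(2), of \<i>]]
      Linf_state_scale[OF st RI(2), of \<i>] by metis
  also have "\<dots> = 0" using real[OF RI(1)] real[OF RI(2)] a(2) by simp
  finally show ?thesis .
qed

lemma state_lim_eq_DPM_state:
  assumes \<omega>: "DPM_state \<omega>" and f: "f \<in> Linf {0<..}"
  shows "state_lim {0<..} \<omega> f = \<omega> f"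
proof -
  have st: "Linf_state {0<..} \<omega>" using \<omega> by (simp add: DPM_state_def)
  have eq: "\<omega> (tail_fun a f) = \<omega> f" if "0 < a" for a
  proof -
    let ?d = "\<lambda>x. f x + (-1) * tail_fun a f x"
    note t = tail_fun_Linf[OF f, of a] Linf_scale[OF tail_fun_Linf[OF f, of a], of "-1"]
    have "\<omega> ?d = 0"
      by (rule DPM_state_vanishing_tail[OF \<omega> Linf_add[OF f t(2)] that]) (simp add: tail_fun_def)
    moreover have "\<omega> ?d = \<omega> f + (-1) * \<omega> (tail_fun a f)"
      using Linf_state_add[OF st f t(2)] Linf_state_scale[OF st t(1), of "-1"] by metis
    ultimately show ?thesis by simp
  qed
  have ev: "\<forall>\<^sub>F a in at_top. tail_fun a f \<in> Linf {0<..} \<and> \<omega> (tail_fun a f) = \<omega> f"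
    using eventually_gt_at_top[of 0] by eventually_elim (use eq tail_fun_Linf[OF f] in auto)
  show ?thesis unfolding state_lim_def
  proof (rule the_equality)
    show "\<forall>\<^sub>F a in at_top. tail_fun a f \<in> Linf {0<..} \<and> \<omega> (tail_fun a f) = \<omega> f"
      by (rule ev)
  next
    fix l assume "\<forall>\<^sub>F a in at_top. tail_fun a f \<in> Linf {0<..} \<and> \<omega> (tail_fun a f) = l"
    with ev have "\<forall>\<^sub>F a in at_top :: real filter. l = \<omega> f"
      by eventually_elim auto
    then show "l = \<omega> f" by simp
  qed
qed

lemma omega_lim_eq_DPM_state:
  assumes "DPM_state \<omega>" "f \<in> Linf {0<..}"
  shows "omega_lim \<omega> f = \<omega> f" and "\<omega> f = \<omega> (log_mean f)"
proof -
  have "\<exists>a>0. tail_fun a f \<in> Linf {0<..}"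
    using tail_fun_Linf[OF assms(2)] zero_less_one by blast
  then show "omega_lim \<omega> f = \<omega> f"
    using state_lim_eq_DPM_state[OF assms] by (simp add: omega_lim_def)
  show "\<omega> f = \<omega> (log_mean f)"
    using assms zero_less_one unfolding DPM_state_def by blast
qed

end

(*
  Spectral theory reduces everything to the law m of T^p under the trace on (0,oo): the trace of
  f(T) is the integral of f against the measure B |-> tau (E_T B), by normality. With
  A(t) = integral of y over {y > 1/t} with respect to m, the condition defining Z_p gives
  A(t) = O(log t), and all three functionals are compared with A(t) / log t. Up to errors that
  disappear after division by log t,
    - the integral of mu over (0,t) lies between A(t^(1-eps)) and 1 + A(t);
    - log t times the logarithmic mean of the heat function lies between
      (G - eps) A(t^(1-eps)) and G A(t^(1+eps)), where G = Gamma(1 + p/q);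
    - zeta is an integral of y exp(- x), x = log(1/y) / log t, against m, and bounding exp(- x) by
      step functions bounds it by combinations of the functions A(t^c).
  Since omega is invariant under t |-> t^c, the value of omega on A(t^c) / log t is c times that on
  A(t) / log t, and letting eps and the mesh of the step functions tend to 0 identifies the limits.

  The spectral theorem for a positive operator T is obtained from Hausdorff's moment problem for
  the sequences <x, T^j x>; indicators of half lines are increasing limits of polynomials, hence
  their quadratic forms come from operators, and Dynkin's lemma passes to all Borel sets.
*)

theory Submission
  imports Defs "HOL-Probability.Helly_Selection" "HOL-Real_Asymp.Real_Asymp"
begin

text \<open>\<open>spectral_measure\<close>, \<open>functional_calculus\<close> and
  \<open>op_abs\<close> are definite descriptions, so a construction is not enough: each needs
  uniqueness. The constructed resolution commutes with everything that commutes with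
  \<open>T\<close>, in particular with any other resolution of \<open>T\<close>, and two commuting
  resolutions of the same operator agree. The trace of spectral projections may grow without bound
  near 0, so m is only sigma-finite and the integral of y against it may diverge; hence the cut-off
  A(t). Its O(log t) bound is the choice 1 + 1 / log t of the exponent in the zeta function of m,
  because y > 1/t makes y to the power 1 / log t at least 1/e. Exchanging integrals in the
  logarithmic mean of the heat function leaves y times the integral of exp(- v^(-a)) / v^2 over
  [y, t y], with a = q/p. Over (0,oo) this integral is Gamma(1 + p/q) = (p/q) Gamma(p/q), the
  constant of the theorem. The factor p that separates zeta from the Dixmier value arises because
  T^(p + 1/r) is the power 1 + 1/(p r) of T^p.\<close>

section \<open>Symmetric operators\<close>

text \<open>Symmetry is taken for the real inner product. The resolution of a positive operator is
  constructed on a real Hilbert space, and complex linearity is recovered at the end from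
  commutation with multiplication by \<i>.\<close>

definition symmetric_op :: "('a::real_inner \<Rightarrow>\<^sub>L 'a) \<Rightarrow> bool"
  where "symmetric_op A \<longleftrightarrow> (\<forall>x y. x \<bullet> A y = A x \<bullet> y)"

definition positive_op :: "('a::real_inner \<Rightarrow>\<^sub>L 'a) \<Rightarrow> bool"
  where "positive_op A \<longleftrightarrow> symmetric_op A \<and> (\<forall>x. 0 \<le> x \<bullet> A x)"

lemma symmetric_opD: "symmetric_op A \<Longrightarrow> x \<bullet> A y = A x \<bullet> y"
  by (simp add: symmetric_op_def)

lemma symmetric_op_simps [intro, simp]:
  "symmetric_op 0" "symmetric_op id_blinfun"
  by (simp_all add: symmetric_op_def)

lemma symmetric_op_add [intro]: "symmetric_op A \<Longrightarrow> symmetric_op B \<Longrightarrow> symmetric_op (A + B)"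
  by (simp add: symmetric_op_def blinfun.add_left inner_add_left inner_add_right)

lemma symmetric_op_diff [intro]: "symmetric_op A \<Longrightarrow> symmetric_op B \<Longrightarrow> symmetric_op (A - B)"
  by (simp add: symmetric_op_def blinfun.diff_left inner_diff_left inner_diff_right)

lemma symmetric_op_scaleR [intro]: "symmetric_op A \<Longrightarrow> symmetric_op (c *\<^sub>R A)"
  by (simp add: symmetric_op_def blinfun.scaleR_left)

lemma symmetric_op_sum [intro]:
  "(\<And>i. i \<in> I \<Longrightarrow> symmetric_op (A i)) \<Longrightarrow> symmetric_op (\<Sum>i\<in>I. A i)"
  by (induction I rule: infinite_finite_induct) auto

lemma symmetric_op_compose:
  "symmetric_op A \<Longrightarrow> symmetric_op B \<Longrightarrow> A o\<^sub>L B = B o\<^sub>L A \<Longrightarrow> symmetric_op (A o\<^sub>L B)"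
  unfolding symmetric_op_def by (metis blinfun_apply_blinfun_compose)

text \<open>On a real Hilbert space the quadratic form sees only the symmetric part of an operator.
  For symmetric operators the cross terms coincide, so the form determines everything; equalities
  and weak limits below rest on this.\<close>

lemma symmetric_op_polarization:
  assumes "symmetric_op A"
  shows "4 * (x \<bullet> A y) = (x + y) \<bullet> A (x + y) - (x - y) \<bullet> A (x - y)"
  using symmetric_opD[OF assms, of y x]
  by (simp add: blinfun.add_right blinfun.diff_right algebra_simps inner_commute)

lemma blinfun_eq_innerI:
  fixes A B :: "'a::real_inner \<Rightarrow>\<^sub>L 'a"
  assumes "\<And>x y. x \<bullet> A y = x \<bullet> B y"
  shows "A = B"
proof (rule blinfun_eqI)
  fix y
  have "(A y - B y) \<bullet> (A y - B y) = 0"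
    using assms by (simp add: inner_diff_right)
  then show "A y = B y" by simp
qed

lemma symmetric_op_eqI:
  assumes "symmetric_op A" "symmetric_op B" "\<And>x. x \<bullet> A x = x \<bullet> B x"
  shows "A = B"
proof (rule blinfun_eq_innerI)
  fix x y
  have "4 * (x \<bullet> A y) = 4 * (x \<bullet> B y)"
    unfolding symmetric_op_polarization[OF assms(1)] symmetric_op_polarization[OF assms(2)]
    using assms(3) by simp
  then show "x \<bullet> A y = x \<bullet> B y" by simp
qed

lemma inner_blinfun_le_norm:
  fixes A :: "'a::real_inner \<Rightarrow>\<^sub>L 'a"
  shows "\<bar>x \<bullet> A x\<bar> \<le> norm A * (norm x)\<^sup>2"
proof -
  have "\<bar>x \<bullet> A x\<bar> \<le> norm x * norm (A x)" by (rule Cauchy_Schwarz_ineq2)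
  also have "\<dots> \<le> norm x * (norm A * norm x)"
    by (intro mult_left_mono norm_blinfun) auto
  finally show ?thesis by (simp add: power2_eq_square mult_ac)
qed

text \<open>The form at \<open>t *\<^sub>R y + x\<close> is a nonnegative quadratic polynomial in
  \<open>t\<close>; evaluating it at its minimum \<open>- b / a\<close> gives the discriminant
  inequality.\<close>

lemma positive_op_Cauchy_Schwarz:
  assumes "positive_op A"
  shows "(y \<bullet> A x)\<^sup>2 \<le> (y \<bullet> A y) * (x \<bullet> A x)"
proof -
  define a b c where "a = y \<bullet> A y" and "b = y \<bullet> A x" and "c = x \<bullet> A x"
  have sym: "x \<bullet> A y = b"
    using assms by (metis b_def inner_commute positive_op_def symmetric_opD)
  have nn: "0 \<le> a * t\<^sup>2 + 2 * b * t + c" for t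
  proof -
    have "0 \<le> (t *\<^sub>R y + x) \<bullet> A (t *\<^sub>R y + x)"
      using assms by (simp add: positive_op_def)
    also have "\<dots> = a * t\<^sup>2 + 2 * b * t + c"
      using sym by (simp add: a_def b_def c_def blinfun.add_right blinfun.scaleR_right
          inner_add_left inner_add_right power2_eq_square algebra_simps)
    finally show ?thesis .
  qed
  have "0 \<le> a" "0 \<le> c" using assms by (auto simp: a_def c_def positive_op_def)
  have "b\<^sup>2 \<le> a * c"
  proof (cases "a = 0")
    case True
    have "b = 0"
    proof (rule ccontr)
      assume "b \<noteq> 0"
      \<comment> \<open>With \<open>a = 0\<close> the polynomial is affine, and at this point its
        value is -1.\<close>
      have "0 \<le> 2 * b * (- (c + 1) / (2 * b)) + c"
        using nn[of "- (c + 1) / (2 * b)"] True by simp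
      also have "2 * b * (- (c + 1) / (2 * b)) = - (c + 1)" using \<open>b \<noteq> 0\<close> by (simp add: field_simps)
      finally show False by simp
    qed
    then show ?thesis using True by simp
  next
    case False
    then have "a > 0" using \<open>0 \<le> a\<close> by simp
    have "0 \<le> a * (- b / a)\<^sup>2 + 2 * b * (- b / a) + c" by (rule nn)
    also have "\<dots> = c - b\<^sup>2 / a"
      using False by (simp add: power2_eq_square field_simps)
    finally show ?thesis using \<open>a > 0\<close> by (simp add: field_simps)
  qed
  then show ?thesis by (simp add: a_def b_def c_def)
qed

text \<open>Cauchy-Schwarz for the form of \<open>A\<close> with \<open>y = A x\<close>, followed by
  cancelling the square of \<open>norm (A x)\<close>. It converts bounds on quadratic forms into
  norm estimates.\<close>

lemma positive_op_norm_apply_le: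
  assumes "positive_op A" "\<And>x. x \<bullet> A x \<le> c * (norm x)\<^sup>2"
  shows "(norm (A x))\<^sup>2 \<le> c * (x \<bullet> A x)"
proof (cases "A x = 0")
  case True
  have "0 \<le> x \<bullet> A x" using assms(1) by (simp add: positive_op_def)
  then show ?thesis using True by simp
next
  case False
  have nn: "0 \<le> x \<bullet> A x" using assms(1) by (simp add: positive_op_def)
  have "((norm (A x))\<^sup>2)\<^sup>2 = (A x \<bullet> A x)\<^sup>2" by (simp add: power2_norm_eq_inner)
  also have "\<dots> \<le> (A x \<bullet> A (A x)) * (x \<bullet> A x)"
    by (rule positive_op_Cauchy_Schwarz[OF assms(1)])
  also have "\<dots> \<le> (c * (norm (A x))\<^sup>2) * (x \<bullet> A x)"
    by (intro mult_right_mono assms(2) nn)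
  finally have "(norm (A x))\<^sup>2 * (norm (A x))\<^sup>2 \<le> (norm (A x))\<^sup>2 * (c * (x \<bullet> A x))"
    by (simp add: power2_eq_square mult_ac)
  moreover have "0 < (norm (A x))\<^sup>2" using False by simp
  ultimately show ?thesis by (simp only: mult_le_cancel_left_pos)
qed

text \<open>A difference of two members is a positive operator with bounded form, so
  \<open>positive_op_norm_apply_le\<close> bounds the square of \<open>norm (P m x - P n x)\<close>
  by a constant times the increment of the bounded monotone sequence
  \<open>x \<bullet> P n x\<close>. Hence \<open>P n x\<close> is Cauchy for every
  \<open>x\<close>.\<close>

lemma monotone_symmetric_ops_converge:
  fixes P :: "nat \<Rightarrow> ('a::{real_inner,banach} \<Rightarrow>\<^sub>L 'a)"
  assumes sym: "\<And>n. symmetric_op (P n)"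
    and mono: "\<And>n x. x \<bullet> P n x \<le> x \<bullet> P (Suc n) x"
    and bdd: "\<And>n x. x \<bullet> P n x \<le> C * (norm x)\<^sup>2"
  obtains Q where "symmetric_op Q" "\<And>x. (\<lambda>n. P n x) \<longlonglongrightarrow> Q x"
proof -
  \<comment> \<open>All forms lie between that of \<open>P 0\<close> and \<open>C\<close>, and the
    form of \<open>P 0\<close> is bounded below by \<open>- norm (P 0)\<close>, so this constant
    bounds the forms of all differences.\<close>
  define c where "c = C + norm (P 0)"
  have inc: "incseq (\<lambda>n. x \<bullet> P n x)" for x
    by (rule incseq_SucI) (rule mono)
  have key: "(norm (P m x - P n x))\<^sup>2 \<le> c * (x \<bullet> P m x - x \<bullet> P n x)" if "n \<le> m" for m n x
  proof -
    have "x \<bullet> (P m - P n) x \<le> c * (norm x)\<^sup>2" for x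
    proof -
      have "x \<bullet> P 0 x \<le> x \<bullet> P n x" using incseqD[OF inc, of 0 n x] by simp
      moreover have "- (norm (P 0) * (norm x)\<^sup>2) \<le> x \<bullet> P 0 x"
        using inner_blinfun_le_norm[of x "P 0"] by linarith
      moreover have "x \<bullet> P m x \<le> C * (norm x)\<^sup>2" by (rule bdd)
      ultimately show ?thesis
        by (simp add: blinfun.diff_left inner_diff_right c_def algebra_simps)
    qed
    moreover have "positive_op (P m - P n)"
      using incseqD[OF inc that] sym
      by (auto simp: positive_op_def blinfun.diff_left inner_diff_right)
    ultimately have "(norm ((P m - P n) x))\<^sup>2 \<le> c * (x \<bullet> (P m - P n) x)"
      by (intro positive_op_norm_apply_le)
    then show ?thesis by (simp add: blinfun.diff_left inner_diff_right)
  qed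
  have conv: "convergent (\<lambda>n. P n x)" for x
  proof -
    have "convergent (\<lambda>n. x \<bullet> P n x)"
    proof (rule Bseq_monoseq_convergent)
      show "Bseq (\<lambda>n. x \<bullet> P n x)"
      proof (rule BseqI')
        fix n
        have "x \<bullet> P 0 x \<le> x \<bullet> P n x" using incseqD[OF inc, of 0 n x] by simp
        with bdd[of x n] show "norm (x \<bullet> P n x) \<le> \<bar>x \<bullet> P 0 x\<bar> + \<bar>C * (norm x)\<^sup>2\<bar>"
          by (simp only: real_norm_def)
      qed
      show "monoseq (\<lambda>n. x \<bullet> P n x)" by (rule incseq_imp_monoseq[OF inc])
    qed
    then have ca: "Cauchy (\<lambda>n. x \<bullet> P n x)" by (rule convergent_Cauchy)
    have "Cauchy (\<lambda>n. P n x)"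
    proof (rule CauchyI')
      fix e :: real assume "0 < e"
      then have "0 < e\<^sup>2 / (\<bar>c\<bar> + 1)" by simp
      from CauchyD[OF ca this] obtain M where
        M: "\<And>m n. m \<ge> M \<Longrightarrow> n \<ge> M \<Longrightarrow> norm (x \<bullet> P m x - x \<bullet> P n x) < e\<^sup>2 / (\<bar>c\<bar> + 1)" by blast
      have "dist (P m x) (P n x) < e" if "M \<le> m" "m < n" for m n
      proof -
        have "(norm (P n x - P m x))\<^sup>2 \<le> c * (x \<bullet> P n x - x \<bullet> P m x)"
          by (rule key) (use that in auto)
        also have "\<dots> \<le> \<bar>c\<bar> * \<bar>x \<bullet> P n x - x \<bullet> P m x\<bar>"
          by (metis abs_ge_self abs_mult)
        also have "\<dots> \<le> \<bar>c\<bar> * (e\<^sup>2 / (\<bar>c\<bar> + 1))"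
          using M[of n m] that by (intro mult_left_mono) auto
        also have "\<dots> < e\<^sup>2" using \<open>0 < e\<close> by (simp add: field_simps add_pos_nonneg)
        finally show ?thesis
          using \<open>0 < e\<close> by (simp add: dist_norm norm_minus_commute power_less_imp_less_base)
      qed
      then show "\<exists>M. \<forall>m\<ge>M. \<forall>n>m. dist (P m x) (P n x) < e" by blast
    qed
    then show ?thesis by (rule Cauchy_convergent)
  qed
  define L where "L x = lim (\<lambda>n. P n x)" for x
  have L: "(\<lambda>n. P n x) \<longlonglongrightarrow> L x" for x
    unfolding L_def using conv by (simp add: convergent_LIMSEQ_iff)
  \<comment> \<open>The same estimate, taken against \<open>P 0\<close>, bounds the operators
    uniformly, which makes the pointwise limit a bounded operator.\<close>
  have bnd: "norm (P n x) \<le> (\<bar>c\<bar> + norm (P 0)) * norm x" for n x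
  proof -
    have "(norm (P n x - P 0 x))\<^sup>2 \<le> c * (x \<bullet> P n x - x \<bullet> P 0 x)" by (rule key) simp
    also have "\<dots> \<le> \<bar>c\<bar> * \<bar>x \<bullet> P n x - x \<bullet> P 0 x\<bar>" by (metis abs_ge_self abs_mult)
    also have "\<dots> \<le> \<bar>c\<bar> * (\<bar>c\<bar> * (norm x)\<^sup>2)"
    proof (intro mult_left_mono)
      have "x \<bullet> P 0 x \<le> x \<bullet> P n x" using incseqD[OF inc, of 0 n x] by simp
      moreover have "- (norm (P 0) * (norm x)\<^sup>2) \<le> x \<bullet> P 0 x"
        using inner_blinfun_le_norm[of x "P 0"] by linarith
      moreover have "x \<bullet> P n x \<le> C * (norm x)\<^sup>2" by (rule bdd)
      moreover have "c * (norm x)\<^sup>2 \<le> \<bar>c\<bar> * (norm x)\<^sup>2" by (intro mult_right_mono) auto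
      ultimately show "\<bar>x \<bullet> P n x - x \<bullet> P 0 x\<bar> \<le> \<bar>c\<bar> * (norm x)\<^sup>2"
        unfolding c_def by (simp add: algebra_simps)
    qed simp
    also have "\<dots> = (\<bar>c\<bar> * norm x)\<^sup>2" by (simp add: power2_eq_square)
    finally have "norm (P n x - P 0 x) \<le> \<bar>c\<bar> * norm x"
      by (rule power2_le_imp_le) simp
    moreover have "norm (P 0 x) \<le> norm (P 0) * norm x" by (rule norm_blinfun)
    moreover have "norm (P n x) \<le> norm (P n x - P 0 x) + norm (P 0 x)"
      using norm_triangle_ineq[of "P n x - P 0 x" "P 0 x"] by simp
    ultimately show ?thesis by (simp add: algebra_simps)
  qed
  have bl: "bounded_linear L"
  proof (rule bounded_linear_intro)
    fix x y
    have "(\<lambda>n. P n (x + y)) \<longlonglongrightarrow> L x + L y"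
      using tendsto_add[OF L L] by (simp add: blinfun.add_right)
    then show "L (x + y) = L x + L y" using L LIMSEQ_unique by blast
  next
    fix r :: real and x
    have "(\<lambda>n. P n (r *\<^sub>R x)) \<longlonglongrightarrow> r *\<^sub>R L x"
      using tendsto_scaleR[OF tendsto_const L] by (simp add: blinfun.scaleR_right)
    then show "L (r *\<^sub>R x) = r *\<^sub>R L x" using L LIMSEQ_unique by blast
  next
    fix x
    show "norm (L x) \<le> norm x * (\<bar>c\<bar> + norm (P 0))"
      by (rule LIMSEQ_le_const2[OF tendsto_norm[OF L]]) (use bnd in \<open>auto simp: mult.commute\<close>)
  qed
  show thesis
  proof
    show lim: "(\<lambda>n. P n x) \<longlonglongrightarrow> Blinfun L x" for x
      using L bl by (simp add: bounded_linear_Blinfun_apply)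
    have "x \<bullet> Blinfun L y = Blinfun L x \<bullet> y" for x y
    proof -
      have "(\<lambda>n. x \<bullet> P n y) \<longlonglongrightarrow> x \<bullet> Blinfun L y" "(\<lambda>n. P n x \<bullet> y) \<longlonglongrightarrow> Blinfun L x \<bullet> y"
        by (intro tendsto_intros lim)+
      then show ?thesis unfolding symmetric_opD[OF sym] by (rule LIMSEQ_unique)
    qed
    then show "symmetric_op (Blinfun L)" by (simp add: symmetric_op_def)
  qed
qed

section \<open>Hausdorff's moment problem\<close>

text \<open>If \<open>D k m\<close> is the integral of \<open>x ^ k * (1 - x) ^ m\<close>, the
  recursion is \<open>x + (1 - x) = 1\<close> and the identity is the binomial expansion of
  \<open>(x + (1 - x)) ^ n\<close>. Here only the recursion is at hand, so Pascal's rule is applied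
  directly.\<close>

lemma completely_monotone_moment_identity:
  fixes D :: "nat \<Rightarrow> nat \<Rightarrow> real"
  assumes rec: "\<And>k m. D k m = D (Suc k) m + D k (Suc m)"
  shows "(\<Sum>k\<le>n. real (n choose k) * D (j + k) (m + (n - k))) = D j m"
proof (induction n arbitrary: j m)
  case 0
  then show ?case by simp
next
  case (Suc n)
  have "(\<Sum>k\<le>Suc n. real (Suc n choose k) * D (j + k) (m + (Suc n - k)))
      = D j (m + Suc n) + (\<Sum>k\<le>n. real (Suc n choose Suc k) * D (j + Suc k) (m + (n - k)))"
    by (subst sum.atMost_Suc_shift) simp
  also have "(\<Sum>k\<le>n. real (Suc n choose Suc k) * D (j + Suc k) (m + (n - k)))
     = (\<Sum>k\<le>n. real (n choose k) * D (Suc j + k) (m + (n - k)))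
     + (\<Sum>k\<le>n. real (n choose Suc k) * D (j + Suc k) (m + (n - k)))"
    by (simp add: sum.distrib[symmetric] algebra_simps)
  also have "(\<Sum>k\<le>n. real (n choose Suc k) * D (j + Suc k) (m + (n - k)))
     = (\<Sum>k<n. real (n choose Suc k) * D (j + Suc k) (m + (n - k)))"
    by (simp add: lessThan_Suc_atMost[symmetric])
  also have "\<dots> = (\<Sum>k<n. real (n choose Suc k) * D (j + Suc k) (Suc m + (n - Suc k)))"
    by (intro sum.cong) (auto simp: Suc_diff_Suc)
  also have "D j (m + Suc n) + ((\<Sum>k\<le>n. real (n choose k) * D (Suc j + k) (m + (n - k))) + \<dots>)
     = (\<Sum>k\<le>n. real (n choose k) * D (Suc j + k) (m + (n - k))) +
       (\<Sum>k\<le>n. real (n choose k) * D (j + k) (Suc m + (n - k)))"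
    by (simp add: lessThan_Suc_atMost[symmetric] sum.lessThan_Suc_shift del: sum.lessThan_Suc)
  also have "\<dots> = D (Suc j) m + D j (Suc m)" by (simp only: Suc.IH)
  also have "\<dots> = D j m" by (rule rec[symmetric])
  finally show ?case .
qed

text \<open>The factorial moments of the Bernstein-type weights \<open>(n choose k) * D k (n - k)\<close> are exactly
  the given moments, and the normalised falling factorial differs from \<open>(k / n) ^ j\<close> by \<open>O(1 / n)\<close>.\<close>

definition falling_ratio :: "nat \<Rightarrow> nat \<Rightarrow> nat \<Rightarrow> real"
  where "falling_ratio n k j = (\<Prod>i<j. (real k - real i) / (real n - real i))"

text \<open>The absorption identity \<open>k * (n choose k) = n * ((n - 1) choose (k - 1))\<close>,
  applied \<open>j\<close> times. It turns weighted sums with \<open>falling_ratio\<close> into the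
  moment identity.\<close>

lemma choose_falling_ratio:
  assumes "j \<le> n" "k \<le> n - j"
  shows "real (n choose (j + k)) * falling_ratio n (j + k) j = real ((n - j) choose k)"
  using assms
proof (induction j arbitrary: n k)
  case 0
  then show ?case by (simp add: falling_ratio_def)
next
  case (Suc j)
  have "j \<le> n" "Suc k \<le> n - j" using Suc.prems by auto
  from Suc.IH[OF this] have IH: "real (n choose (Suc j + k)) * falling_ratio n (Suc j + k) j
     = real ((n - j) choose Suc k)" by simp
  have "falling_ratio n (Suc j + k) (Suc j)
      = falling_ratio n (Suc j + k) j * ((real (Suc k)) / (real (n - j)))"
    using Suc.prems by (simp add: falling_ratio_def of_nat_diff)
  moreover have *: "real (Suc k) * real ((n - j) choose Suc k) = real (n - j) * real ((n - Suc j) choose k)"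
  proof -
    have "n - j = Suc (n - Suc j)" using Suc.prems by simp
    then show ?thesis
      by (metis Suc_times_binomial_eq mult.commute of_nat_mult)
  qed
  moreover have nz: "real (n - j) \<noteq> 0" using Suc.prems by simp
  ultimately have "real (n choose (Suc j + k)) * falling_ratio n (Suc j + k) (Suc j)
      = (real (n choose (Suc j + k)) * falling_ratio n (Suc j + k) j) * real (Suc k) / real (n - j)"
    by simp
  also have "\<dots> = real (Suc k) * real ((n - j) choose Suc k) / real (n - j)"
    unfolding IH by (simp only: mult.commute)
  also have "\<dots> = real ((n - Suc j) choose k)"
    by (simp only: *) (use nz in simp)
  finally show ?case .
qed

lemma falling_ratio_eq_0: "k < j \<Longrightarrow> falling_ratio n k j = 0"
  by (auto simp: falling_ratio_def intro!: bexI[of _ k])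

lemma falling_ratio_bounds:
  assumes "j \<le> k" "k \<le> n"
  shows "0 \<le> falling_ratio n k j" "falling_ratio n k j \<le> 1"
proof -
  have "0 \<le> (real k - real i) / (real n - real i) \<and> (real k - real i) / (real n - real i) \<le> 1"
    if "i < j" for i
    using that assms by (auto intro!: divide_nonneg_nonneg simp: divide_le_eq_1)
  then show "0 \<le> falling_ratio n k j" "falling_ratio n k j \<le> 1"
    unfolding falling_ratio_def by (auto intro!: prod_nonneg prod_le_1)
qed

text \<open>Each factor differs from \<open>k / n\<close> by at most \<open>j / (n - j)\<close>, and
  as long as all quantities lie in [0,1] the errors simply add up over the \<open>j\<close>
  factors.\<close>

lemma falling_ratio_approx:
  assumes "k \<le> n" "j < n"
  shows "\<bar>falling_ratio n k j - (real k / real n) ^ j\<bar> \<le> real j * (real j / (real n - real j))"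
  using assms(2)
proof (induction j)
  case 0
  then show ?case by (simp add: falling_ratio_def)
next
  case (Suc j)
  define a where "a = falling_ratio n k j"
  define b where "b = (real k - real j) / (real n - real j)"
  define c where "c = real k / real n"
  have IH: "\<bar>a - c ^ j\<bar> \<le> real j * (real j / (real n - real j))"
    unfolding a_def c_def using Suc by simp
  have c01: "0 \<le> c" "c \<le> 1" using assms Suc.prems by (auto simp: c_def)
  have bc: "\<bar>b - c\<bar> \<le> real j / (real n - real j)"
  proof -
    have nj: "0 < real n - real j" using Suc.prems by simp
    have "b - c = - (real j * (real n - real k)) / (real n * (real n - real j))"
      using nj Suc.prems by (simp add: b_def c_def field_simps)
    then have "\<bar>b - c\<bar> = (real j / (real n - real j)) * ((real n - real k) / real n)"
      using nj assms(1) by (simp add: abs_mult)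
    also have "\<dots> \<le> (real j / (real n - real j)) * 1"
      using nj assms(1) Suc.prems by (intro mult_left_mono) (auto simp: divide_le_eq_1)
    finally show ?thesis by simp
  qed
  have "\<bar>a * b - c ^ j * c\<bar> \<le> real (Suc j) * (real j / (real n - real j))"
  proof (cases "j \<le> k")
    case True
    have a01: "0 \<le> a" "a \<le> 1" using falling_ratio_bounds[OF True assms(1)] by (auto simp: a_def)
    have "a * b - c ^ j * c = a * (b - c) + (a - c ^ j) * c" by (simp add: algebra_simps)
    then have "\<bar>a * b - c ^ j * c\<bar> \<le> a * \<bar>b - c\<bar> + \<bar>a - c ^ j\<bar> * c"
      using a01 c01 by (metis abs_mult abs_of_nonneg abs_triangle_ineq)
    also have "\<dots> \<le> 1 * \<bar>b - c\<bar> + \<bar>a - c ^ j\<bar> * 1"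
      using a01 c01 by (intro add_mono mult_mono) auto
    also have "\<dots> \<le> real j / (real n - real j) + real j * (real j / (real n - real j))"
      using IH bc by (simp only: mult_1 mult_1_right add_mono)
    also have "\<dots> = real (Suc j) * (real j / (real n - real j))"
      by (simp only: of_nat_Suc distrib_right mult_1)
    finally show ?thesis .
  next
    case False
    \<comment> \<open>A factor with \<open>i = k\<close> has already made the product vanish, so a
      negative \<open>b\<close> does no harm and only the inductive error remains.\<close>
    then have "a = 0" by (simp add: a_def falling_ratio_eq_0)
    then have "\<bar>a * b - c ^ j * c\<bar> = \<bar>a - c ^ j\<bar> * c" using c01 by (simp add: abs_mult)
    also have "\<dots> \<le> \<bar>a - c ^ j\<bar> * 1" using c01 by (intro mult_left_mono) auto
    also have "\<dots> \<le> real (Suc j) * (real j / (real n - real j))"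
    proof (simp only: mult_1_right, rule order_trans[OF IH])
      show "real j * (real j / (real n - real j)) \<le> real (Suc j) * (real j / (real n - real j))"
        using Suc.prems by (intro mult_right_mono) auto
    qed
    finally show ?thesis .
  qed
  also have "\<dots> \<le> real (Suc j) * (real (Suc j) / (real n - real (Suc j)))"
    using Suc.prems by (intro mult_left_mono frac_le) auto
  finally show ?case
    by (simp add: a_def b_def c_def falling_ratio_def mult.commute)
qed

text \<open>Place mass \<open>(n choose k) * D k (n - k)\<close> at \<open>k / n\<close>. The total
  mass is 1, the supports lie in [0,1], and the factorial moments are exactly \<open>D j 0\<close>.
  Helly selection gives a weak limit, whose ordinary moments are the limits of the factorial
  ones.\<close>

lemma hausdorff_moment_prob:
  fixes D :: "nat \<Rightarrow> nat \<Rightarrow> real"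
  assumes nonneg: "\<And>k m. 0 \<le> D k m"
    and rec: "\<And>k m. D k m = D (Suc k) m + D k (Suc m)"
    and norm: "D 0 0 = 1"
  obtains M where "real_distribution M" "AE x in M. 0 \<le> x \<and> x \<le> 1"
    "\<And>j. (\<integral>x. x ^ j \<partial>M) = D j 0"
proof -
  define w where "w n k = real (n choose k) * D k (n - k)" for n k
  \<comment> \<open>Starting at \<open>Suc n\<close> keeps the atoms \<open>k / n\<close> away from
    division by zero.\<close>
  define \<mu> where "\<mu> n = distr (point_measure {..Suc n} (\<lambda>k. ennreal (w (Suc n) k))) borel
      (\<lambda>k. real k / real (Suc n))" for n
  have w0: "0 \<le> w n k" for n k by (simp add: w_def nonneg)
  have wsum: "(\<Sum>k\<le>n. w n k) = 1" for n
    using completely_monotone_moment_identity[of D n 0 0, OF rec] norm by (simp add: w_def)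
  have emm: "emeasure (\<mu> n) B = (\<Sum>k\<in>{k\<in>{..Suc n}. real k / real (Suc n) \<in> B}. ennreal (w (Suc n) k))"
    if "B \<in> sets borel" for n B
  proof -
    have "emeasure (\<mu> n) B = emeasure (point_measure {..Suc n} (\<lambda>k. ennreal (w (Suc n) k)))
       ((\<lambda>k. real k / real (Suc n)) -` B \<inter> {..Suc n})"
      unfolding \<mu>_def using that
      by (subst emeasure_distr) (auto simp: space_point_measure)
    also have "\<dots> = (\<Sum>k\<in>(\<lambda>k. real k / real (Suc n)) -` B \<inter> {..Suc n}. ennreal (w (Suc n) k))"
      by (rule emeasure_point_measure_finite) auto
    finally show ?thesis by (simp add: vimage_def Int_def conj_commute)
  qed
  have full: "emeasure (\<mu> n) B = 1" if "B \<in> sets borel" "{0..1} \<subseteq> B" for n B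
  proof -
    have "{k\<in>{..Suc n}. real k / real (Suc n) \<in> B} = {..Suc n}"
      using that(2) by (auto simp: divide_le_eq_1)
    then have "emeasure (\<mu> n) B = (\<Sum>k\<in>{..Suc n}. ennreal (w (Suc n) k))" using emm that by simp
    also have "\<dots> = ennreal (\<Sum>k\<in>{..Suc n}. w (Suc n) k)" by (rule sum_ennreal) (simp add: w0)
    also have "\<dots> = 1" by (simp only: wsum) simp
    finally show ?thesis .
  qed
  have rd: "real_distribution (\<mu> n)" for n
  proof -
    have "prob_space (\<mu> n)"
    proof (rule prob_spaceI)
      have "space (\<mu> n) = UNIV" by (simp add: \<mu>_def)
      then show "emeasure (\<mu> n) (space (\<mu> n)) = 1" using full[of UNIV n] by simp
    qed
    then show ?thesis by (auto simp: real_distribution_def real_distribution_axioms_def \<mu>_def)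
  qed
  have int: "(\<integral>x. f x \<partial>\<mu> n) = (\<Sum>k\<le>Suc n. w (Suc n) k * f (real k / real (Suc n)))"
    if [measurable]: "f \<in> borel_measurable borel" for n and f :: "real \<Rightarrow> real"
  proof -
    have "(\<integral>x. f x \<partial>\<mu> n) = (\<integral>k. f (real k / real (Suc n)) \<partial>point_measure {..Suc n} (\<lambda>k. ennreal (w (Suc n) k)))"
      unfolding \<mu>_def by (subst integral_distr) auto
    also have "\<dots> = (\<Sum>k\<le>Suc n. w (Suc n) k * f (real k / real (Suc n)))"
      by (subst lebesgue_integral_point_measure_finite) (auto simp: w0)
    finally show ?thesis .
  qed
  have "tight \<mu>"
    unfolding tight_def
  proof (intro conjI allI impI rd)
    fix \<epsilon> :: real assume "\<epsilon> > 0"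
    \<comment> \<open>The interval is open on the left, so its left end must lie strictly below
      0.\<close>
    have "measure (\<mu> n) {-1<..1} = 1" for n
      using full[of "{-1<..1}" n] by (simp add: measure_def subset_iff)
    then show "\<exists>a b. a < b \<and> (\<forall>n. measure (\<mu> n) {a<..b} > 1 - \<epsilon>)"
      using \<open>\<epsilon> > 0\<close> by (intro exI[of _ "-1"] exI[of _ 1]) auto
  qed
  from tight_imp_convergent_subsubsequence[OF this strict_mono_id]
  obtain r M where r: "strict_mono (r :: nat \<Rightarrow> nat)" and M: "real_distribution M"
    and wc: "weak_conv_m (\<mu> \<circ> id \<circ> r) M" by blast
  have lim: "(\<lambda>n. integral\<^sup>L (\<mu> (r n)) f) \<longlonglongrightarrow> integral\<^sup>L M f"
    if "continuous_on UNIV f" "\<And>x. norm (f x) \<le> B" for f :: "real \<Rightarrow> real" and B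
  proof (rule weak_conv_imp_integral_bdd_continuous_conv)
    show "weak_conv_m (\<lambda>n. \<mu> (r n)) M" using wc by (simp add: comp_def)
    show "isCont f x" for x using that(1) by (simp add: continuous_on_eq_continuous_at)
  qed (use rd M that in auto)
  interpret M: real_distribution M by fact
  have ae: "AE x in M. 0 \<le> x \<and> x \<le> 1"
  proof -
    \<comment> \<open>A bounded continuous function vanishing exactly on [0,1]: weak convergence
      carries its zero integral over to \<open>M\<close>, and this locates the support.\<close>
    define f where "f x = min 1 (max 0 (- x) + max 0 (x - 1))" for x :: real
    have fc: "continuous_on UNIV f" unfolding f_def by (intro continuous_intros)
    have f01: "0 \<le> f x" "f x \<le> 1" for x by (auto simp: f_def)
    have [measurable]: "f \<in> borel_measurable borel" by (rule borel_measurable_continuous_onI) fact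
    have "(\<lambda>n. integral\<^sup>L (\<mu> (r n)) f) \<longlonglongrightarrow> integral\<^sup>L M f"
      by (rule lim[of _ 1]) (use fc f01 in auto)
    moreover have "integral\<^sup>L (\<mu> n) f = 0" for n
    proof -
      have "f (real k / real (Suc n)) = 0" if "k \<le> Suc n" for k
        using that unfolding f_def by (subst max_absorb1, simp)+ simp
      then show ?thesis by (simp add: int del: sum.atMost_Suc)
    qed
    ultimately have "(\<lambda>n. 0) \<longlonglongrightarrow> integral\<^sup>L M f" by simp
    then have "integral\<^sup>L M f = 0" by (simp add: LIMSEQ_const_iff)
    moreover have "integrable M f"
      by (rule M.integrable_const_bound[of _ 1]) (use f01 in auto)
    ultimately have "AE x in M. f x = 0"
      using integral_nonneg_eq_0_iff_AE[of M f] f01 by auto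
    then show ?thesis
      by eventually_elim (auto simp: f_def min_def max_def split: if_splits)
  qed
  have mom: "(\<integral>x. x ^ j \<partial>M) = D j 0" for j
  proof -
    \<comment> \<open>\<open>x ^ j\<close> is not bounded on the line; clamping to [0,1] changes
      nothing on the supports.\<close>
    define g where "g x = (max 0 (min 1 x)) ^ j" for x :: real
    have gc: "continuous_on UNIV g" unfolding g_def by (intro continuous_intros)
    have [measurable]: "g \<in> borel_measurable borel" by (rule borel_measurable_continuous_onI) fact
    have g01: "0 \<le> g x" "g x \<le> 1" for x by (auto simp: g_def intro!: power_le_one)
    have "(\<lambda>n. integral\<^sup>L (\<mu> (r n)) g) \<longlonglongrightarrow> integral\<^sup>L M g"
      by (rule lim[of _ 1]) (use gc g01 in auto)
    moreover have "(\<lambda>n. integral\<^sup>L (\<mu> (r n)) g) \<longlonglongrightarrow> D j 0"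
    proof -
      have "\<bar>integral\<^sup>L (\<mu> n) g - D j 0\<bar> \<le> real j * (real j / (real (Suc n) - real j))"
        if "j \<le> n" for n
      proof -
        let ?n = "Suc n"
        have "D j 0 = (\<Sum>k\<le>?n - j. real ((?n - j) choose k) * D (j + k) (?n - j - k))"
          using completely_monotone_moment_identity[of D "?n - j" j 0, OF rec] by simp
        also have "\<dots> = (\<Sum>k\<le>?n - j. w ?n (j + k) * falling_ratio ?n (j + k) j)"
        proof (rule sum.cong[OF refl])
          fix k assume "k \<in> {..?n - j}"
          then show "real ((?n - j) choose k) * D (j + k) (?n - j - k) = w ?n (j + k) * falling_ratio ?n (j + k) j"
            using choose_falling_ratio[of j ?n k] that by (simp add: w_def mult_ac)
        qed
        also have "\<dots> = (\<Sum>k\<in>{j..?n}. w ?n k * falling_ratio ?n k j)"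
          by (rule sum.reindex_bij_witness[of _ "\<lambda>k. k - j" "\<lambda>k. j + k"]) (use that in auto)
        also have "\<dots> = (\<Sum>k\<le>?n. w ?n k * falling_ratio ?n k j)"
          by (rule sum.mono_neutral_left) (auto simp: falling_ratio_eq_0)
        finally have D: "D j 0 = (\<Sum>k\<le>?n. w ?n k * falling_ratio ?n k j)" .
        have g: "integral\<^sup>L (\<mu> n) g = (\<Sum>k\<le>?n. w ?n k * (real k / real ?n) ^ j)"
        proof -
          have "g (real k / real ?n) = (real k / real ?n) ^ j" if "k \<le> ?n" for k
          proof -
            have "real k / real ?n \<le> 1" "0 \<le> real k / real ?n" using that by simp_all
            then show ?thesis unfolding g_def by (simp only: min_absorb2 max_absorb2)
          qed
          then show ?thesis by (simp add: int del: sum.atMost_Suc)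
        qed
        have "\<bar>integral\<^sup>L (\<mu> n) g - D j 0\<bar> = \<bar>\<Sum>k\<le>?n. w ?n k * ((real k / real ?n) ^ j - falling_ratio ?n k j)\<bar>"
          unfolding D g by (simp only: sum_subtractf[symmetric] right_diff_distrib)
        also have "\<dots> \<le> (\<Sum>k\<le>?n. \<bar>w ?n k * ((real k / real ?n) ^ j - falling_ratio ?n k j)\<bar>)"
          by (rule sum_abs)
        also have "\<dots> \<le> (\<Sum>k\<le>?n. w ?n k * (real j * (real j / (real ?n - real j))))"
        proof (rule sum_mono)
          fix k assume "k \<in> {..?n}"
          then have "\<bar>falling_ratio ?n k j - (real k / real ?n) ^ j\<bar> \<le> real j * (real j / (real ?n - real j))"
            using that by (intro falling_ratio_approx) auto
          then show "\<bar>w ?n k * ((real k / real ?n) ^ j - falling_ratio ?n k j)\<bar> \<le> w ?n k * (real j * (real j / (real ?n - real j)))"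
            using w0 by (simp only: abs_mult abs_of_nonneg abs_minus_commute mult_left_mono)
        qed
        also have "\<dots> = real j * (real j / (real ?n - real j))"
          by (simp only: sum_distrib_right[symmetric] wsum mult_1)
        finally show ?thesis .
      qed
      then have "\<forall>\<^sub>F n in sequentially. norm (integral\<^sup>L (\<mu> n) g - D j 0) \<le> real j * (real j / (real (Suc n) - real j))"
        by (auto simp: eventually_sequentially)
      moreover have "(\<lambda>n. real j * (real j / (real (Suc n) - real j))) \<longlonglongrightarrow> 0"
        by real_asymp
      ultimately have "(\<lambda>n. integral\<^sup>L (\<mu> n) g - D j 0) \<longlonglongrightarrow> 0"
        by (rule Lim_null_comparison)
      then have "(\<lambda>n. integral\<^sup>L (\<mu> n) g) \<longlonglongrightarrow> D j 0" by (simp add: LIM_zero_iff)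
      from LIMSEQ_subseq_LIMSEQ[OF this r] show ?thesis by (simp add: comp_def)
    qed
    ultimately have "integral\<^sup>L M g = D j 0" by (rule LIMSEQ_unique)
    moreover have "integral\<^sup>L M g = (\<integral>x. x ^ j \<partial>M)"
    proof (rule integral_cong_AE)
      show "AE x in M. g x = x ^ j" using ae by eventually_elim (simp add: g_def)
    qed simp_all
    ultimately show ?thesis by simp
  qed
  show thesis by (rule that[OF M ae mom])
qed

text \<open>Division by the total mass \<open>D 0 0\<close> reduces to the probability case. If the
  total mass is 0, positivity and the recursion force all moments to vanish.\<close>

lemma hausdorff_moment:
  fixes D :: "nat \<Rightarrow> nat \<Rightarrow> real"
  assumes nonneg: "\<And>k m. 0 \<le> D k m"
    and rec: "\<And>k m. D k m = D (Suc k) m + D k (Suc m)"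
  obtains M where "finite_measure M" "sets M = sets borel" "AE x in M. 0 \<le> x \<and> x \<le> 1"
    "\<And>j. (\<integral>x. x ^ j \<partial>M) = D j 0"
proof (cases "D 0 0 = 0")
  case True
  have "D j 0 = 0" for j
  proof (induction j)
    case (Suc j)
    then show ?case using rec[of j 0] nonneg[of "Suc j" 0] nonneg[of j 1] by simp
  qed (rule True)
  moreover have "finite_measure (null_measure (borel :: real measure))"
    by (rule finite_measureI) simp
  moreover have "AE x in null_measure (borel :: real measure). 0 \<le> x \<and> x \<le> 1"
    by (rule AE_I[of _ _ UNIV]) auto
  moreover have "(\<integral>x. x ^ j \<partial>null_measure (borel :: real measure)) = 0" for j
    by (rule integral_eq_zero_AE) (rule AE_I[of _ _ UNIV], auto)
  ultimately show ?thesis by (intro that[of "null_measure borel"]) auto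
next
  case False
  define c where "c = D 0 0"
  have c: "c > 0" using False nonneg[of 0 0] by (simp add: c_def)
  obtain M where M: "real_distribution M" "AE x in M. 0 \<le> x \<and> x \<le> 1"
    "\<And>j. (\<integral>x. x ^ j \<partial>M) = D j 0 / c"
  proof (rule hausdorff_moment_prob[of "\<lambda>k m. D k m / c"])
    show "D k m / c = D (Suc k) m / c + D k (Suc m) / c" for k m
      using rec[of k m] by (simp add: add_divide_distrib[symmetric])
  qed (use nonneg c in \<open>auto simp: c_def\<close>)
  interpret M: real_distribution M by fact
  show ?thesis
  proof (rule that[of "density M (\<lambda>_. ennreal c)"])
    show "finite_measure (density M (\<lambda>_. ennreal c))"
      by (rule finite_measureI) (simp add: emeasure_density M.emeasure_space_1[simplified] ennreal_mult_eq_top_iff)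
    show "AE x in density M (\<lambda>_. ennreal c). 0 \<le> x \<and> x \<le> 1"
      using M(2) by (simp add: AE_density)
    show "(\<integral>x. x ^ j \<partial>density M (\<lambda>_. ennreal c)) = D j 0" for j
      using c M(3)[of j] by (subst integral_density) auto
  qed simp
qed

section \<open>The spectral theorem for positive operators\<close>

primrec op_power :: "('a::real_normed_vector \<Rightarrow>\<^sub>L 'a) \<Rightarrow> nat \<Rightarrow> ('a \<Rightarrow>\<^sub>L 'a)"
  where "op_power T 0 = id_blinfun"
  | "op_power T (Suc n) = T o\<^sub>L op_power T n"

lemma op_power_commute:
  fixes C T :: "'a::real_normed_vector \<Rightarrow>\<^sub>L 'a"
  assumes "\<And>x. C (T x) = T (C x)"
  shows "C (op_power T n x) = op_power T n (C x)"
  using assms by (induction n) auto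

lemma op_power_Suc_apply: "op_power T (Suc n) x = op_power T n (T x)"
  using op_power_commute[of T T n x] by simp

lemma op_power_add: "op_power T (m + n) x = op_power T m (op_power T n x)"
  by (induction m) auto

lemma symmetric_op_power: "symmetric_op T \<Longrightarrow> symmetric_op (op_power T n)"
proof (induction n)
  case (Suc n)
  then show ?case
    by (auto intro!: symmetric_op_compose blinfun_eqI simp: op_power_commute)
qed simp

text \<open>Since \<open>S\<close> and \<open>R\<close> are symmetric and commute, a pair of equal
  factors can be split between the two sides of the inner product, which lowers an exponent by 2.
  The only mixed remainder is \<open>S R\<close>, whose form is \<open>x \<bullet> S x\<close> minus
  the square of \<open>norm (S x)\<close>. Square roots, which only the spectral theorem will
  provide, are avoided in this way.\<close>

lemma contraction_monomial_nonneg: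
  assumes S: "positive_op S" "\<And>x. x \<bullet> S x \<le> (norm x)\<^sup>2"
  defines "R \<equiv> id_blinfun - S"
  shows "0 \<le> x \<bullet> op_power S k (op_power R m x)"
proof -
  have symS: "symmetric_op S" using S(1) by (simp add: positive_op_def)
  have symR: "symmetric_op R" unfolding R_def using symS by auto
  have SR: "S (R x) = R (S x)" for x by (simp add: R_def blinfun.diff_left blinfun.diff_right)
  have cSR: "S (op_power R m x) = op_power R m (S x)" for m x by (rule op_power_commute[OF SR])
  have cRS: "R (op_power S m x) = op_power S m (R x)" for m x by (rule op_power_commute) (simp add: SR)
  have R0: "0 \<le> x \<bullet> R x" for x
    using S(2)[of x] by (simp add: R_def blinfun.diff_left inner_diff_right power2_norm_eq_inner)
  have S0: "0 \<le> x \<bullet> S x" for x using S(1) by (simp add: positive_op_def)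
  have SR0: "0 \<le> x \<bullet> S (R x)" for x
  proof -
    have "(norm (S x))\<^sup>2 \<le> 1 * (x \<bullet> S x)"
      by (rule positive_op_norm_apply_le) (use S in auto)
    then show ?thesis
      using symmetric_opD[OF symS, of x "S x"]
      by (simp add: R_def blinfun.diff_left blinfun.diff_right inner_diff_right power2_norm_eq_inner)
  qed
  have Rm: "0 \<le> x \<bullet> op_power S k (op_power R m x)" if "k < 2" for x k m
    using that
  proof (induction m arbitrary: x rule: less_induct)
    case (less m)
    show ?case
    proof (cases "m < 2")
      case True
      with less.prems S0 R0 SR0 show ?thesis
        by (cases k; cases m) (auto simp: less_Suc_eq numeral_2_eq_2)
    next
      case False
      then obtain m' where m: "m = Suc (Suc m')" by (metis add_2_eq_Suc le_Suc_ex not_less)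
      have "x \<bullet> op_power S k (op_power R m x) = R x \<bullet> op_power S k (op_power R m' (R x))"
        using symmetric_opD[OF symR, of x "op_power S k (op_power R m' (R x))"]
        by (simp add: m cRS op_power_Suc_apply[symmetric])
      then show ?thesis using less.IH[of m' "R x"] less.prems m by simp
    qed
  qed
  show ?thesis
  proof (induction k arbitrary: x rule: less_induct)
    case (less k)
    show ?case
    proof (cases "k < 2")
      case True
      then show ?thesis by (rule Rm)
    next
      case False
      then obtain k' where k: "k = Suc (Suc k')" by (metis add_2_eq_Suc le_Suc_ex not_less)
      have "x \<bullet> op_power S k (op_power R m x) = S x \<bullet> op_power S k' (op_power R m (S x))"
        using symmetric_opD[OF symS, of x "op_power S k' (op_power R m (S x))"]
          op_power_commute[of S S k' "op_power R m x"]
        by (simp add: k cSR)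
      then show ?thesis using less.IH[of k' "S x"] k by simp
    qed
  qed
qed

text \<open>Division by \<open>K\<close> makes \<open>T\<close> a contraction, to which Hausdorff's
  criterion applies with the forms of \<open>S^k (1 - S)^m\<close>; the measure is then stretched
  back to [0,K].\<close>

lemma positive_op_moment_measure:
  assumes T: "positive_op T" "\<And>x. x \<bullet> T x \<le> K * (norm x)\<^sup>2" and K: "0 < K"
  obtains M where "finite_measure M" "sets M = sets borel" "AE t in M. 0 \<le> t \<and> t \<le> K"
    "\<And>j. (\<integral>t. t ^ j \<partial>M) = x \<bullet> op_power T j x"
proof -
  define S where "S = (1 / K) *\<^sub>R T"
  define R where "R = id_blinfun - S"
  define D where "D k m = x \<bullet> op_power S k (op_power R m x)" for k m
  have S: "positive_op S" "x \<bullet> S x \<le> (norm x)\<^sup>2" for x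
    using T K by (auto simp: positive_op_def S_def blinfun.scaleR_left field_simps)
  have powS: "op_power S j x = (1 / K) ^ j *\<^sub>R op_power T j x" for j x
    by (induction j) (auto simp: S_def blinfun.scaleR_left blinfun.scaleR_right mult_ac)
  obtain M where M: "finite_measure M" "sets M = sets borel" "AE t in M. 0 \<le> t \<and> t \<le> 1"
    "\<And>j. (\<integral>t. t ^ j \<partial>M) = D j 0"
  proof (rule hausdorff_moment[of D])
    show "0 \<le> D k m" for k m
      unfolding D_def R_def by (rule contraction_monomial_nonneg[OF S])
    show "D k m = D (Suc k) m + D k (Suc m)" for k m
    proof -
      have "D (Suc k) m + D k (Suc m)
          = x \<bullet> op_power S k (S (op_power R m x) + R (op_power R m x))"
        by (simp only: D_def op_power_Suc_apply[of S] blinfun.add_right inner_add_right) simp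
      also have "S (op_power R m x) + R (op_power R m x) = op_power R m x"
        by (simp add: R_def blinfun.diff_left)
      finally show ?thesis by (simp add: D_def)
    qed
  qed (rule that)
  have sp: "space M = UNIV" using sets_eq_imp_space_eq[OF M(2)] by simp
  have meas: "(\<lambda>t. K * t) \<in> measurable M borel"
    using M(2) by (simp add: measurable_cong_sets[OF M(2) refl])
  show thesis
  proof (rule that[of "distr M borel (\<lambda>t. K * t)"])
    show "finite_measure (distr M borel (\<lambda>t. K * t))"
      by (rule finite_measure.finite_measure_distr[OF M(1) meas])
    show "AE t in distr M borel (\<lambda>t. K * t). 0 \<le> t \<and> t \<le> K"
      using M(3) K meas by (subst AE_distr_iff) (auto elim!: eventually_mono)
    show "(\<integral>t. t ^ j \<partial>distr M borel (\<lambda>t. K * t)) = x \<bullet> op_power T j x" for j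
      using M(4)[of j] K by (subst integral_distr[OF meas]) (auto simp: D_def powS power_mult_distrib field_simps)
  qed simp
qed

text \<open>Monotonicity is what makes the corresponding operators converge strongly. Weierstrass
  approximation of increasing ramps would destroy it, so the ramps are lowered by a vanishing amount
  whose decrease dominates the approximation errors.\<close>

lemma polynomials_increasing_to_indicator:
  fixes s K :: real
  obtains a :: "nat \<Rightarrow> nat \<Rightarrow> real" and d :: "nat \<Rightarrow> nat"
  where "\<And>k t. t \<in> {0..K} \<Longrightarrow> (\<Sum>i\<le>d k. a k i * t ^ i) \<le> (\<Sum>i\<le>d (Suc k). a (Suc k) i * t ^ i)"
    and "\<And>k t. t \<in> {0..K} \<Longrightarrow> \<bar>\<Sum>i\<le>d k. a k i * t ^ i\<bar> \<le> 3"
    and "\<And>t. t \<in> {0..K} \<Longrightarrow> (\<lambda>k. \<Sum>i\<le>d k. a k i * t ^ i) \<longlonglongrightarrow> indicator {s<..} t"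
proof -
  \<comment> \<open>The shift gains (1/2)^k / 2 between consecutive indices, while the two
    approximation errors amount to at most 3/8 of (1/2)^k.\<close>
  define g where "g k t = min 1 (max 0 (real k * (t - s))) - (1/2) ^ k" for k t
  have "\<exists>d a. \<forall>t\<in>{0..K}. \<bar>g k t - (\<Sum>i\<le>d. a i * t ^ i)\<bar> < (1/2) ^ k / 4" for k
  proof -
    have "continuous_on {0..K} (g k)" unfolding g_def by (intro continuous_intros)
    from Stone_Weierstrass_real_polynomial_function[OF compact_Icc this, of "(1/2) ^ k / 4"]
    obtain p where "real_polynomial_function p" "\<And>t. t \<in> {0..K} \<Longrightarrow> \<bar>g k t - p t\<bar> < (1/2) ^ k / 4"
      by auto
    moreover from this(1) obtain b n where "p = (\<lambda>t. \<Sum>i\<le>n. b i * t ^ i)"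
      unfolding real_polynomial_function_iff_sum by blast
    ultimately show ?thesis by (intro exI[of _ n] exI[of _ b]) auto
  qed
  then obtain d a where da: "\<And>k t. t \<in> {0..K} \<Longrightarrow> \<bar>g k t - (\<Sum>i\<le>d k. a k i * t ^ i)\<bar> < (1/2) ^ k / 4"
    by metis
  define q where "q k t = (\<Sum>i\<le>d k. a k i * t ^ i)" for k t
  have close: "\<bar>g k t - q k t\<bar> < (1/2) ^ k / 4" if "t \<in> {0..K}" for k t
    using da[OF that] by (simp add: q_def)
  have half: "(1/2::real) ^ k \<le> 1" for k by (simp add: power_le_one)
  show thesis
  proof (rule that[of a d, folded q_def])
    fix t assume t: "t \<in> {0..K}"
    show "q k t \<le> q (Suc k) t" for k
    proof -
      have "min 1 (max 0 (real k * (t - s))) \<le> min 1 (max 0 (real (Suc k) * (t - s)))"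
      proof (cases "t \<le> s")
        case True
        then have "real k * (t - s) \<le> 0" "real (Suc k) * (t - s) \<le> 0"
          by (auto simp: mult_le_0_iff)
        then show ?thesis by simp
      next
        case False
        then have "real k * (t - s) \<le> real (Suc k) * (t - s)" by (intro mult_right_mono) auto
        then show ?thesis by (intro min.mono max.mono) auto
      qed
      then have "g k t + (1/2) ^ k / 2 \<le> g (Suc k) t"
        by (simp add: g_def)
      moreover have "(1/2::real) ^ Suc k = (1/2) ^ k / 2" by simp
      moreover have "0 < (1/2::real) ^ k" by simp
      ultimately show ?thesis using close[OF t, of k] close[OF t, of "Suc k"] by linarith
    qed
    show "\<bar>q k t\<bar> \<le> 3" for k
    proof -
      have "\<bar>g k t\<bar> \<le> 2" proof -
        have "0 < (1/2::real) ^ k" by simp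
        with half[of k] show ?thesis unfolding g_def by linarith
      qed
      with close[OF t, of k] half[of k] show ?thesis by linarith
    qed
    have "(\<lambda>k. g k t) \<longlonglongrightarrow> indicator {s<..} t - 0"
      unfolding g_def
    proof (intro tendsto_diff)
      show "(\<lambda>k. min 1 (max 0 (real k * (t - s)))) \<longlonglongrightarrow> indicator {s<..} t"
      proof (cases "t \<le> s")
        case True
        then have "min 1 (max 0 (real k * (t - s))) = indicator {s<..} t" for k
        proof -
          have "real k * (t - s) \<le> 0" using True by (auto simp: mult_le_0_iff)
          then show ?thesis using True by simp
        qed
        then show ?thesis by simp
      next
        case False
        then have "filterlim (\<lambda>k. real k * (t - s)) at_top sequentially" by real_asymp
        then have "\<forall>\<^sub>F k in sequentially. real k * (t - s) \<ge> 1" by (simp add: filterlim_at_top)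
        then have "\<forall>\<^sub>F k in sequentially. min 1 (max 0 (real k * (t - s))) = indicator {s<..} t"
          by eventually_elim (use False in auto)
        then show ?thesis by (rule tendsto_eventually)
      qed
      show "(\<lambda>k. (1/2::real) ^ k) \<longlonglongrightarrow> 0" by real_asymp
    qed
    moreover have "(\<lambda>k. q k t - g k t) \<longlonglongrightarrow> 0"
    proof (rule Lim_null_comparison)
      show "\<forall>\<^sub>F k in sequentially. norm (q k t - g k t) \<le> (1/2) ^ k / 4"
        using close[OF t] by (auto simp: abs_minus_commute intro!: always_eventually less_imp_le)
      show "(\<lambda>k. (1/2::real) ^ k / 4) \<longlonglongrightarrow> 0" by real_asymp
    qed
    ultimately show "(\<lambda>k. q k t) \<longlonglongrightarrow> indicator {s<..} t"
      using tendsto_add by fastforce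
  qed
qed

lemma tendsto_inner_polarization:
  assumes "\<And>n. symmetric_op (P n)" "symmetric_op Q" "\<And>x. (\<lambda>n. x \<bullet> P n x) \<longlonglongrightarrow> x \<bullet> Q x"
  shows "(\<lambda>n. x \<bullet> P n y) \<longlonglongrightarrow> x \<bullet> Q y"
proof -
  have "(\<lambda>n. ((x + y) \<bullet> P n (x + y) - (x - y) \<bullet> P n (x - y)) / 4)
      \<longlonglongrightarrow> ((x + y) \<bullet> Q (x + y) - (x - y) \<bullet> Q (x - y)) / 4"
    by (intro tendsto_intros assms) simp
  moreover have "((x + y) \<bullet> P n (x + y) - (x - y) \<bullet> P n (x - y)) / 4 = x \<bullet> P n y" for n
    using symmetric_op_polarization[OF assms(1)[of n], of x y] by simp
  moreover have "((x + y) \<bullet> Q (x + y) - (x - y) \<bullet> Q (x - y)) / 4 = x \<bullet> Q y"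
    using symmetric_op_polarization[OF assms(2), of x y] by simp
  ultimately show ?thesis by simp
qed

lemma Int_stable_greaterThan: "Int_stable (range (greaterThan :: real \<Rightarrow> real set))"
proof (rule Int_stableI, clarsimp)
  fix a b :: real
  have "{a<..} \<inter> {b<..} = {max a b<..}" by auto
  then show "{a<..} \<inter> {b<..} \<in> range greaterThan" by blast
qed

lemma borel_sigma_sets_greaterThan: "sets borel = sigma_sets UNIV (range (greaterThan :: real \<Rightarrow> real set))"
  unfolding borel_Ioi by (rule sets_measure_of) auto

text \<open>Dynkin's lemma with the half lines as generator: they are closed under intersection, and
  their indicators are limits of the polynomials above.\<close>

lemma borel_induct_greaterThan [consumes 1, case_names greaterThan empty compl union]:
  fixes B :: "real set"
  assumes "B \<in> sets borel" "\<And>s. Pr {s<..}" "Pr {}"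
    "\<And>A. A \<in> sets borel \<Longrightarrow> Pr A \<Longrightarrow> Pr (UNIV - A)"
    "\<And>F :: nat \<Rightarrow> real set. disjoint_family F \<Longrightarrow> range F \<subseteq> sets borel \<Longrightarrow> (\<And>i. Pr (F i)) \<Longrightarrow> Pr (\<Union>i. F i)"
  shows "Pr B"
  by (rule sigma_sets_induct_disjoint[OF Int_stable_greaterThan _ assms(1)[unfolded borel_sigma_sets_greaterThan], of Pr])
    (use assms in \<open>auto simp: borel_sigma_sets_greaterThan[symmetric]\<close>)

section \<open>Resolution of a bounded positive operator\<close>

locale bounded_positive_op =
  fixes T :: "'a::{real_inner,banach} \<Rightarrow>\<^sub>L 'a" and K :: real
  assumes positive: "positive_op T" and bound: "x \<bullet> T x \<le> K * (norm x)\<^sup>2" and K_pos: "0 < K"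
begin

text \<open>A fixed choice among the measures with the prescribed moments; the operators constructed
  below are matched to this choice through their quadratic forms.\<close>

definition moment_measure :: "'a \<Rightarrow> real measure"
  where "moment_measure x = (SOME M. finite_measure M \<and> sets M = sets borel \<and>
    (AE t in M. 0 \<le> t \<and> t \<le> K) \<and> (\<forall>j. (\<integral>t. t ^ j \<partial>M) = x \<bullet> op_power T j x))"

lemma moment_measure:
  shows finite_moment_measure: "finite_measure (moment_measure x)"
    and sets_moment_measure [measurable_cong]: "sets (moment_measure x) = sets borel"
    and AE_moment_measure: "AE t in moment_measure x. t \<in> {0..K}"
    and moment: "(\<integral>t. t ^ j \<partial>moment_measure x) = x \<bullet> op_power T j x"
proof -
  have "\<exists>M. finite_measure M \<and> sets M = sets borel \<and>
    (AE t in M. 0 \<le> t \<and> t \<le> K) \<and> (\<forall>j. (\<integral>t. t ^ j \<partial>M) = x \<bullet> op_power T j x)"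
    using positive_op_moment_measure[OF positive bound K_pos] by metis
  from someI_ex[OF this, folded moment_measure_def]
  show "finite_measure (moment_measure x)" "sets (moment_measure x) = sets borel"
    "AE t in moment_measure x. t \<in> {0..K}"
    "(\<integral>t. t ^ j \<partial>moment_measure x) = x \<bullet> op_power T j x" by auto
qed

lemma AE_moment_measureI: "(\<And>t. t \<in> {0..K} \<Longrightarrow> Pr t) \<Longrightarrow> AE t in moment_measure x. Pr t"
  using AE_moment_measure by eventually_elim

lemma space_moment_measure [simp]: "space (moment_measure x) = UNIV"
  using sets_eq_imp_space_eq[OF sets_moment_measure] by simp

lemma integrable_moment_measure:
  assumes "f \<in> borel_measurable borel" "\<And>t. t \<in> {0..K} \<Longrightarrow> \<bar>f t\<bar> \<le> G"
  shows "integrable (moment_measure x) (f :: real \<Rightarrow> real)"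
proof -
  interpret finite_measure "moment_measure x" by (rule finite_moment_measure)
  show ?thesis
  proof (rule integrable_const_bound[of _ G])
    show "AE t in moment_measure x. norm (f t) \<le> G"
      using AE_moment_measure by eventually_elim (use assms(2) in auto)
    show "f \<in> borel_measurable (moment_measure x)"
      using assms(1) by (simp add: measurable_cong_sets[OF sets_moment_measure refl])
  qed
qed

lemma measurable_moment_measure:
  "f \<in> borel_measurable borel \<Longrightarrow> f \<in> borel_measurable (moment_measure x)"
  by (simp add: measurable_cong_sets[OF sets_moment_measure refl])

lemma measure_moment_measure_UNIV: "measure (moment_measure x) UNIV = (norm x)\<^sup>2"
  using moment[of x 0] by (simp add: power2_norm_eq_inner)

text \<open>\<open>P\<close> is the candidate for the spectral projection of \<open>B\<close>. The
  clause on operators commuting with \<open>T\<close> later supplies complex linearity, membership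
  in the von Neumann algebra and uniqueness of the spectral measure.\<close>

definition represents :: "real set \<Rightarrow> ('a \<Rightarrow>\<^sub>L 'a) \<Rightarrow> bool"
  where "represents B P \<longleftrightarrow> symmetric_op P \<and>
    (\<forall>C :: 'a \<Rightarrow>\<^sub>L 'a. (\<forall>x. C (T x) = T (C x)) \<longrightarrow> (\<forall>x. C (P x) = P (C x))) \<and>
    (\<forall>x. x \<bullet> P x = measure (moment_measure x) B)"

lemma representsD:
  fixes C :: "'a \<Rightarrow>\<^sub>L 'a"
  assumes "represents B P"
  shows "symmetric_op P" "x \<bullet> P x = measure (moment_measure x) B"
    and "(\<And>x. C (T x) = T (C x)) \<Longrightarrow> C (P x) = P (C x)"
  using assms by (auto simp: represents_def)

lemma represents_unique: "represents B P \<Longrightarrow> represents B Q \<Longrightarrow> P = Q"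
  by (rule symmetric_op_eqI) (simp_all add: representsD)

lemma symmetric_T: "symmetric_op T"
  using positive by (simp add: positive_op_def)

definition poly_op :: "(nat \<Rightarrow> real) \<Rightarrow> nat \<Rightarrow> ('a \<Rightarrow>\<^sub>L 'a)"
  where "poly_op a n = (\<Sum>i\<le>n. a i *\<^sub>R op_power T i)"

lemma poly_op_apply: "poly_op a n x = (\<Sum>i\<le>n. a i *\<^sub>R op_power T i x)"
  by (simp add: poly_op_def blinfun.sum_left blinfun.scaleR_left)

lemma symmetric_poly_op: "symmetric_op (poly_op a n)"
  unfolding poly_op_def by (auto intro!: symmetric_op_power symmetric_T)

lemma poly_op_commute:
  fixes C :: "'a \<Rightarrow>\<^sub>L 'a"
  assumes "\<And>x. C (T x) = T (C x)"
  shows "C (poly_op a n x) = poly_op a n (C x)"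
  by (simp add: poly_op_apply blinfun.sum_right blinfun.scaleR_right op_power_commute assms)

lemma monomial_bound:
  assumes "t \<in> {0..K}" shows "\<bar>t ^ i\<bar> \<le> K ^ i"
  using assms by (auto simp: power_mono)

text \<open>\<open>Q\<close> behaves like \<open>g(T)\<close> on powers of \<open>T\<close>, and
  linearity extends this to polynomials. The weight \<open>g\<close> is carried along for the proof
  that the projections are multiplicative.\<close>

lemma integral_poly_weighted:
  fixes Q :: "'a \<Rightarrow>\<^sub>L 'a"
  assumes [measurable]: "g \<in> borel_measurable borel" and g: "\<And>t. t \<in> {0..K} \<Longrightarrow> \<bar>g t\<bar> \<le> G"
    and Q: "\<And>j. x \<bullet> Q (op_power T j x) = (\<integral>t. g t * t ^ j \<partial>moment_measure x)"
  shows "x \<bullet> Q (poly_op a n x) = (\<integral>t. g t * (\<Sum>i\<le>n. a i * t ^ i) \<partial>moment_measure x)"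
proof -
  have int: "integrable (moment_measure x) (\<lambda>t. g t * t ^ i)" for i
  proof (rule integrable_moment_measure)
    show "\<bar>g t * t ^ i\<bar> \<le> G * K ^ i" if "t \<in> {0..K}" for t
      using monomial_bound[OF that, of i] g[OF that] unfolding abs_mult by (intro mult_mono) auto
  qed simp
  have "x \<bullet> Q (poly_op a n x) = (\<Sum>i\<le>n. a i * (\<integral>t. g t * t ^ i \<partial>moment_measure x))"
    by (simp add: poly_op_apply blinfun.sum_right blinfun.scaleR_right inner_sum_right Q)
  also have "\<dots> = (\<integral>t. (\<Sum>i\<le>n. a i * (g t * t ^ i)) \<partial>moment_measure x)"
    using int by (subst Bochner_Integration.integral_sum) auto
  also have "\<dots> = (\<integral>t. g t * (\<Sum>i\<le>n. a i * t ^ i) \<partial>moment_measure x)"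
    by (simp add: sum_distrib_left mult_ac)
  finally show ?thesis .
qed

lemma integral_poly: "x \<bullet> poly_op a n x = (\<integral>t. (\<Sum>i\<le>n. a i * t ^ i) \<partial>moment_measure x)"
  using integral_poly_weighted[of "\<lambda>_. 1" 1 x id_blinfun a n] by (simp add: moment)

lemma integral_mult_dominated:
  fixes g h :: "real \<Rightarrow> real" and f :: "nat \<Rightarrow> real \<Rightarrow> real"
  assumes [measurable]: "g \<in> borel_measurable borel" and g: "\<And>t. t \<in> {0..K} \<Longrightarrow> \<bar>g t\<bar> \<le> G"
    and [measurable]: "\<And>k. f k \<in> borel_measurable borel" "h \<in> borel_measurable borel"
    and b: "\<And>k t. t \<in> {0..K} \<Longrightarrow> \<bar>f k t\<bar> \<le> H"
    and l: "\<And>t. t \<in> {0..K} \<Longrightarrow> (\<lambda>k. f k t) \<longlonglongrightarrow> h t"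
  shows "(\<lambda>k. \<integral>t. g t * f k t \<partial>moment_measure x) \<longlonglongrightarrow> (\<integral>t. g t * h t \<partial>moment_measure x)"
proof (rule integral_dominated_convergence)
  interpret finite_measure "moment_measure x" by (rule finite_moment_measure)
  show "integrable (moment_measure x) (\<lambda>_. G * H)" by simp
  show "AE t in moment_measure x. (\<lambda>k. g t * f k t) \<longlonglongrightarrow> g t * h t"
    using AE_moment_measure by eventually_elim (intro tendsto_intros l)
  show "AE t in moment_measure x. norm (g t * f k t) \<le> G * H" for k
    using AE_moment_measure
  proof eventually_elim
    case (elim t)
    then show ?case
      using g[OF elim] b[OF elim, of k] unfolding real_norm_def abs_mult by (intro mult_mono) auto
  qed
qed (intro measurable_moment_measure, measurable)+

text \<open>The weighted limit serves two purposes: with \<open>g = 1\<close> it identifies the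
  operator of a half line, with general \<open>g\<close> it is the base case of
  \<open>represents_weighted\<close>.\<close>

lemma represents_greaterThan_poly_limit:
  obtains a d where
    "\<And>x. incseq (\<lambda>k. x \<bullet> poly_op (a k) (d k) x)"
    "\<And>x k. x \<bullet> poly_op (a k) (d k) x \<le> 3 * (norm x)\<^sup>2"
    "\<forall>g\<in>borel_measurable borel. \<forall>G x. (\<forall>t\<in>{0..K}. \<bar>g t\<bar> \<le> G) \<longrightarrow>
      (\<lambda>k. \<integral>t. g t * (\<Sum>i\<le>d k. a k i * t ^ i) \<partial>moment_measure x) \<longlonglongrightarrow>
        (\<integral>t. g t * indicator {s<..} t \<partial>moment_measure x)"
proof -
  from polynomials_increasing_to_indicator[of K s] obtain a d where
    inc: "\<And>k t. t \<in> {0..K} \<Longrightarrow> (\<Sum>i\<le>d k. a k i * t ^ i) \<le> (\<Sum>i\<le>d (Suc k). a (Suc k) i * t ^ i)"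
    and bd: "\<And>k t. t \<in> {0..K} \<Longrightarrow> \<bar>\<Sum>i\<le>d k. a k i * t ^ i\<bar> \<le> 3"
    and lim: "\<And>t. t \<in> {0..K} \<Longrightarrow> (\<lambda>k. \<Sum>i\<le>d k. a k i * t ^ i) \<longlonglongrightarrow> indicator {s<..} t"
    by blast
  have int: "integrable (moment_measure x) (\<lambda>t. \<Sum>i\<le>d k. a k i * t ^ i)" for k x
    by (rule integrable_moment_measure[of _ 3]) (use bd in auto)
  show thesis
  proof (rule that[of a d])
    show "incseq (\<lambda>k. x \<bullet> poly_op (a k) (d k) x)" for x
    proof (rule incseq_SucI)
      show "x \<bullet> poly_op (a k) (d k) x \<le> x \<bullet> poly_op (a (Suc k)) (d (Suc k)) x" for k
        unfolding integral_poly by (intro integral_mono_AE int AE_moment_measureI inc)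
    qed
    show "x \<bullet> poly_op (a k) (d k) x \<le> 3 * (norm x)\<^sup>2" for x k
    proof -
      interpret finite_measure "moment_measure x" by (rule finite_moment_measure)
      have "x \<bullet> poly_op (a k) (d k) x \<le> (\<integral>t. 3 \<partial>moment_measure x)"
        unfolding integral_poly
        by (intro integral_mono_AE int AE_moment_measureI integrable_const) (use bd[of _ k] abs_le_D1 in blast)
      then show ?thesis by (simp add: measure_moment_measure_UNIV mult.commute)
    qed
    show "\<forall>g\<in>borel_measurable borel. \<forall>G x. (\<forall>t\<in>{0..K}. \<bar>g t\<bar> \<le> G) \<longrightarrow>
      (\<lambda>k. \<integral>t. g t * (\<Sum>i\<le>d k. a k i * t ^ i) \<partial>moment_measure x) \<longlonglongrightarrow>
        (\<integral>t. g t * indicator {s<..} t \<partial>moment_measure x)"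
      by (intro ballI allI impI integral_mult_dominated) (use bd lim in auto)
  qed
qed

lemma represents_greaterThan: "\<exists>P. represents {s<..} P"
proof -
  obtain a d where
    inc: "\<And>x. incseq (\<lambda>k. x \<bullet> poly_op (a k) (d k) x)" and
    bd: "\<And>x k. x \<bullet> poly_op (a k) (d k) x \<le> 3 * (norm x)\<^sup>2" and
    lim: "\<forall>g\<in>borel_measurable borel. \<forall>G x. (\<forall>t\<in>{0..K}. \<bar>g t\<bar> \<le> G) \<longrightarrow>
      (\<lambda>k. \<integral>t. g t * (\<Sum>i\<le>d k. a k i * t ^ i) \<partial>moment_measure x) \<longlonglongrightarrow>
        (\<integral>t. g t * indicator {s<..} t \<partial>moment_measure x)" by (rule represents_greaterThan_poly_limit[of s]) (rule that)
  obtain Q where Q: "symmetric_op Q" "\<And>x. (\<lambda>k. poly_op (a k) (d k) x) \<longlonglongrightarrow> Q x"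
  proof (rule monotone_symmetric_ops_converge[of "\<lambda>k. poly_op (a k) (d k)" 3])
    show "x \<bullet> poly_op (a n) (d n) x \<le> x \<bullet> poly_op (a (Suc n)) (d (Suc n)) x" for n x
      using incseq_SucD[OF inc] .
  qed (auto intro: symmetric_poly_op bd)
  have "represents {s<..} Q"
    unfolding represents_def
  proof (intro conjI allI impI Q)
    fix C :: "'a \<Rightarrow>\<^sub>L 'a" and x
    assume C: "\<forall>x. C (T x) = T (C x)"
    have "(\<lambda>k. C (poly_op (a k) (d k) x)) \<longlonglongrightarrow> C (Q x)" by (intro tendsto_intros Q)
    moreover have "(\<lambda>k. C (poly_op (a k) (d k) x)) \<longlonglongrightarrow> Q (C x)"
      using Q(2)[of "C x"] C by (simp add: poly_op_commute)
    ultimately show "C (Q x) = Q (C x)" by (rule LIMSEQ_unique)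
  next
    fix x
    have "(\<lambda>k. x \<bullet> poly_op (a k) (d k) x) \<longlonglongrightarrow> x \<bullet> Q x" by (intro tendsto_intros Q)
    moreover have "(\<lambda>k. x \<bullet> poly_op (a k) (d k) x) \<longlonglongrightarrow> measure (moment_measure x) {s<..}"
      using lim[rule_format, of "\<lambda>_. 1" 1 x] by (simp add: integral_poly)
    ultimately show "x \<bullet> Q x = measure (moment_measure x) {s<..}" by (rule LIMSEQ_unique)
  qed
  then show ?thesis ..
qed

lemma represents_empty: "represents {} 0"
  by (auto simp: represents_def)

lemma represents_compl:
  assumes "represents B P" "B \<in> sets borel"
  shows "represents (UNIV - B) (id_blinfun - P)"
proof -
  have "measure (moment_measure x) (UNIV - B) = (norm x)\<^sup>2 - measure (moment_measure x) B" for x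
    using finite_measure.finite_measure_compl[OF finite_moment_measure, of B x] assms(2)
    by (simp add: measure_moment_measure_UNIV sets_moment_measure)
  then show ?thesis
    using assms(1)
    by (auto simp: represents_def blinfun.diff_left blinfun.diff_right inner_diff_right power2_norm_eq_inner)
qed

text \<open>The partial sums increase and their forms are bounded by the total mass
  \<open>(norm x)\<^sup>2\<close>, so they converge strongly; countable additivity of the moment
  measures identifies the form of the limit.\<close>

lemma represents_UN:
  fixes F :: "nat \<Rightarrow> real set"
  assumes F: "disjoint_family F" "\<And>i. F i \<in> sets borel" and P: "\<And>i. represents (F i) (P i)"
  obtains Q where "represents (\<Union>i. F i) Q" "\<And>x. (\<lambda>i. P i x) sums Q x"
proof -
  have pos: "0 \<le> x \<bullet> P i x" for i x by (simp add: representsD(2)[OF P])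
  have sm: "(\<lambda>i. x \<bullet> P i x) sums measure (moment_measure x) (\<Union>i. F i)" for x
    unfolding representsD(2)[OF P]
    by (rule finite_measure.finite_measure_UNION[OF finite_moment_measure])
      (use F in \<open>auto simp: sets_moment_measure\<close>)
  define S where "S n = (\<Sum>i<n. P i)" for n
  have S: "x \<bullet> S n x = (\<Sum>i<n. x \<bullet> P i x)" for n x
    by (simp add: S_def blinfun.sum_left inner_sum_right)
  obtain Q where Q: "symmetric_op Q" "\<And>x. (\<lambda>n. S n x) \<longlonglongrightarrow> Q x"
  proof (rule monotone_symmetric_ops_converge[of S 1])
    show "symmetric_op (S n)" for n unfolding S_def by (auto intro: representsD P)
    show "x \<bullet> S n x \<le> x \<bullet> S (Suc n) x" for n x using pos by (simp add: S)
    show "x \<bullet> S n x \<le> 1 * (norm x)\<^sup>2" for n x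
    proof -
      have "x \<bullet> S n x \<le> measure (moment_measure x) (\<Union>i. F i)"
        unfolding S using sm pos by (metis sum_le_suminf sums_iff finite_lessThan)
      also have "\<dots> \<le> measure (moment_measure x) UNIV"
        using finite_measure.finite_measure_mono[OF finite_moment_measure, of "\<Union>i. F i" UNIV x]
        by (simp add: sets_moment_measure)
      finally show ?thesis by (simp add: measure_moment_measure_UNIV)
    qed
  qed (rule that)
  have Qs: "(\<lambda>i. P i x) sums Q x" for x
    using Q(2)[of x] by (simp add: sums_def S_def blinfun.sum_left)
  have "represents (\<Union>i. F i) Q"
    unfolding represents_def
  proof (intro conjI allI impI Q)
    fix C :: "'a \<Rightarrow>\<^sub>L 'a" and x
    assume C: "\<forall>x. C (T x) = T (C x)"
    have "(\<lambda>i. C (P i x)) sums C (Q x)" by (rule bounded_linear.sums[OF blinfun.bounded_linear_right Qs])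
    moreover have "(\<lambda>i. C (P i x)) sums Q (C x)"
      using Qs[of "C x"] representsD(3)[OF P] C by simp
    ultimately show "C (Q x) = Q (C x)" by (rule sums_unique2)
  next
    fix x
    have "(\<lambda>i. x \<bullet> P i x) sums (x \<bullet> Q x)" by (rule bounded_linear.sums[OF bounded_linear_inner_right Qs])
    with sm[of x] show "x \<bullet> Q x = measure (moment_measure x) (\<Union>i. F i)" by (metis sums_unique2)
  qed
  then show thesis using Qs that by blast
qed

lemma represents_ex: "B \<in> sets borel \<Longrightarrow> \<exists>P. represents B P"
proof (induction B rule: borel_induct_greaterThan)
  case (union F)
  then obtain P where P: "\<And>i. represents (F i) (P i)" by metis
  have "F i \<in> sets borel" for i using union.hyps(2) by auto
  from represents_UN[OF union.hyps(1) this P] show ?case by blast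
qed (auto intro: represents_greaterThan represents_empty represents_compl)

text \<open>Stepping stone to multiplicativity: an operator that acts as multiplication by
  \<open>g\<close> on the powers of \<open>T\<close> also does so on the operators representing
  Borel sets. Half lines come from the polynomial limits, all other sets from Dynkin's
  lemma.\<close>

lemma represents_weighted:
  fixes Q :: "'a \<Rightarrow>\<^sub>L 'a"
  assumes g[measurable]: "g \<in> borel_measurable borel" and gb: "\<And>t. t \<in> {0..K} \<Longrightarrow> \<bar>g t\<bar> \<le> G"
    and Q: "symmetric_op Q" "\<And>j x. x \<bullet> Q (op_power T j x) = (\<integral>t. g t * t ^ j \<partial>moment_measure x)"
    and B: "B \<in> sets borel" "represents B P"
  shows "x \<bullet> Q (P x) = (\<integral>t. g t * indicator B t \<partial>moment_measure x)"
  using B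
proof (induction B arbitrary: P x rule: borel_induct_greaterThan)
  case (greaterThan s)
  obtain a d where
    inc: "\<And>x. incseq (\<lambda>k. x \<bullet> poly_op (a k) (d k) x)" and
    bd: "\<And>x k. x \<bullet> poly_op (a k) (d k) x \<le> 3 * (norm x)\<^sup>2" and
    lim: "\<forall>g\<in>borel_measurable borel. \<forall>G x. (\<forall>t\<in>{0..K}. \<bar>g t\<bar> \<le> G) \<longrightarrow>
      (\<lambda>k. \<integral>t. g t * (\<Sum>i\<le>d k. a k i * t ^ i) \<partial>moment_measure x) \<longlonglongrightarrow>
        (\<integral>t. g t * indicator {s<..} t \<partial>moment_measure x)" by (rule represents_greaterThan_poly_limit[of s]) (rule that)
  have "(\<lambda>k. x \<bullet> poly_op (a k) (d k) x) \<longlonglongrightarrow> x \<bullet> P x" for x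
    using lim[rule_format, of "\<lambda>_. 1" 1 x] by (simp add: integral_poly representsD(2)[OF greaterThan])
  \<comment> \<open>\<open>Q x\<close> and \<open>x\<close> are different vectors, so convergence of
    the quadratic forms has to be upgraded to weak convergence.\<close>
  from tendsto_inner_polarization[OF symmetric_poly_op representsD(1)[OF greaterThan] this]
  have "(\<lambda>k. Q x \<bullet> poly_op (a k) (d k) x) \<longlonglongrightarrow> Q x \<bullet> P x" .
  then have "(\<lambda>k. x \<bullet> Q (poly_op (a k) (d k) x)) \<longlonglongrightarrow> x \<bullet> Q (P x)"
    by (simp add: symmetric_opD[OF Q(1)])
  moreover have "(\<lambda>k. x \<bullet> Q (poly_op (a k) (d k) x)) \<longlonglongrightarrow> (\<integral>t. g t * indicator {s<..} t \<partial>moment_measure x)"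

  proof -
    have "x \<bullet> Q (poly_op (a k) (d k) x) = (\<integral>t. g t * (\<Sum>i\<le>d k. a k i * t ^ i) \<partial>moment_measure x)" for k
      by (rule integral_poly_weighted[OF g]) (use gb Q(2) in auto)
    then show ?thesis using lim[rule_format, OF g, of G x] gb by simp
  qed
  ultimately show ?case by (rule LIMSEQ_unique)
next
  case empty
  then have "P = 0" using represents_empty represents_unique by blast
  then show ?case by simp
next
  case (compl A)
  have A: "represents A (id_blinfun - P)"
    using represents_compl[OF compl.prems] compl.hyps by (simp add: Diff_Diff_Int)
  have int: "integrable (moment_measure x) g" "integrable (moment_measure x) (\<lambda>t. g t * indicator A t)"
  proof -
    show "integrable (moment_measure x) g" using integrable_moment_measure[OF g gb] .
    then show "integrable (moment_measure x) (\<lambda>t. g t * indicator A t)"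
      using compl.hyps by (intro integrable_real_mult_indicator) (auto simp: sets_moment_measure)
  qed
  have "x \<bullet> Q x - x \<bullet> Q (P x) = (\<integral>t. g t * indicator A t \<partial>moment_measure x)"
    using compl.IH[OF A, of x] by (simp add: blinfun.diff_left blinfun.diff_right inner_diff_right)
  moreover have "x \<bullet> Q x = (\<integral>t. g t \<partial>moment_measure x)" using Q(2)[of x 0] by simp
  moreover have "(\<integral>t. g t * indicator (UNIV - A) t \<partial>moment_measure x)
      = (\<integral>t. g t - g t * indicator A t \<partial>moment_measure x)"
    by (intro Bochner_Integration.integral_cong) (auto simp: indicator_def)
  ultimately show ?case using int by simp
next
  case (union F)
  have Fs: "F i \<in> sets borel" for i using union.hyps by auto
  obtain R where R: "\<And>i. represents (F i) (R i)" using represents_ex[OF Fs] by metis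
  obtain P' where P': "represents (\<Union>i. F i) P'" "\<And>x. (\<lambda>i. R i x) sums P' x"
    using represents_UN[OF union.hyps(1) Fs R] by blast
  have P: "P' = P" using represents_unique P'(1) union.prems by blast
  have "(\<lambda>i. x \<bullet> Q (R i x)) sums (x \<bullet> Q (P x))"
    by (intro bounded_linear.sums[OF bounded_linear_inner_right]
        bounded_linear.sums[OF blinfun.bounded_linear_right] P'(2)[unfolded P])
  then have "(\<lambda>n. \<Sum>i<n. \<integral>t. g t * indicator (F i) t \<partial>moment_measure x) \<longlonglongrightarrow> x \<bullet> Q (P x)"
    by (simp add: sums_def union.IH[OF R])
  moreover have "(\<lambda>n. \<Sum>i<n. \<integral>t. g t * indicator (F i) t \<partial>moment_measure x)
      = (\<lambda>n. \<integral>t. g t * (\<Sum>i<n. indicator (F i) t) \<partial>moment_measure x)"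
  proof
    fix n
    have "integrable (moment_measure x) (\<lambda>t. g t * indicator (F i) t)" for i
      using integrable_moment_measure[OF g gb, of x] Fs
      by (intro integrable_real_mult_indicator) (auto simp: sets_moment_measure)
    then show "(\<Sum>i<n. \<integral>t. g t * indicator (F i) t \<partial>moment_measure x)
      = (\<integral>t. g t * (\<Sum>i<n. indicator (F i) t) \<partial>moment_measure x)"
      unfolding sum_distrib_left by (intro Bochner_Integration.integral_sum[symmetric])
  qed
  moreover have "(\<lambda>n. \<integral>t. g t * (\<Sum>i<n. indicator (F i) t) \<partial>moment_measure x)
      \<longlonglongrightarrow> (\<integral>t. g t * indicator (\<Union>i. F i) t \<partial>moment_measure x)"
  proof (rule integral_mult_dominated[OF g gb])
    have ind: "(\<lambda>i. indicator (F i) t :: real) sums indicator (\<Union>i. F i) t" for t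
      by (rule indicator_sums) (use union.hyps(1) in \<open>auto simp: disjoint_family_on_def\<close>)
    then show "(\<lambda>n. \<Sum>i<n. indicator (F i) t :: real) \<longlonglongrightarrow> indicator (\<Union>i. F i) t" for t
      by (simp add: sums_def)
    show "\<bar>\<Sum>i<n. indicator (F i) t\<bar> \<le> (1::real)" for n t
    proof -
      have "(\<Sum>i<n. indicator (F i) t) \<le> (indicator (\<Union>i. F i) t :: real)"
        using sum_le_suminf[OF sums_summable[OF ind[of t]], of "{..<n}"] sums_unique[OF ind[of t]] by simp
      also have "\<dots> \<le> 1" by simp
      finally show ?thesis by (simp add: sum_nonneg)
    qed
    show "(\<lambda>t. \<Sum>i<n. indicator (F i) t :: real) \<in> borel_measurable borel" for n
      using Fs by measurable
    show "(indicator (\<Union>i. F i) :: real \<Rightarrow> real) \<in> borel_measurable borel"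
      using Fs by (intro borel_measurable_indicator sets.countable_UN) auto
  qed
  ultimately show ?case using LIMSEQ_unique by simp
qed

lemma represents_Int:
  assumes B: "B \<in> sets borel" "represents B P" and C: "C \<in> sets borel" "represents C Q"
  shows "represents (B \<inter> C) (P o\<^sub>L Q)"
proof -
  note [measurable] = B(1) C(1)
  have comm: "P (Q x) = Q (P x)" for x
    by (rule representsD(3)[OF C(2)]) (use representsD(3)[OF B(2), of T] in simp)
  \<comment> \<open>Two rounds of \<open>represents_weighted\<close>: here powers of
    \<open>T\<close> are paired with \<open>C\<close>, and the outcome is the moment condition that
    \<open>Q\<close> has to satisfy in the round with \<open>B\<close>.\<close>
  have 1: "x \<bullet> op_power T j (Q x) = (\<integral>t. (indicator {0..K} t * t ^ j) * indicator C t \<partial>moment_measure x)" for x j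
  proof (rule represents_weighted[OF _ _ symmetric_op_power[OF symmetric_T] _ C])
    show "\<bar>indicator {0..K} t * t ^ j\<bar> \<le> K ^ j" if "t \<in> {0..K}" for t
      using monomial_bound[OF that] that by simp
    show "x \<bullet> op_power T j (op_power T i x) = (\<integral>t. indicator {0..K} t * t ^ j * t ^ i \<partial>moment_measure x)" for x i
    proof -
      have "x \<bullet> op_power T j (op_power T i x) = (\<integral>t. t ^ (j + i) \<partial>moment_measure x)"
        by (simp add: moment op_power_add)
      also have "\<dots> = (\<integral>t. indicator {0..K} t * t ^ j * t ^ i \<partial>moment_measure x)"
        by (intro integral_cong_AE measurable_moment_measure AE_moment_measureI) (auto simp: power_add)
      finally show ?thesis .
    qed
  qed simp
  have "x \<bullet> Q (P x) = (\<integral>t. indicator C t * indicator B t \<partial>moment_measure x)" for x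
  proof (rule represents_weighted[OF _ _ representsD(1)[OF C(2)] _ B])
    show "\<bar>indicator C t\<bar> \<le> (1::real)" for t :: real by simp
    show "x \<bullet> Q (op_power T j x) = (\<integral>t. indicator C t * t ^ j \<partial>moment_measure x)" for x j
    proof -
      have "Q (op_power T j x) = op_power T j (Q x)"
        using op_power_commute[of Q T j x] representsD(3)[OF C(2), of T] by simp
      moreover have "(\<integral>t. (indicator {0..K} t * t ^ j) * indicator C t \<partial>moment_measure x)
          = (\<integral>t. indicator C t * t ^ j \<partial>moment_measure x)"
        by (intro integral_cong_AE measurable_moment_measure AE_moment_measureI) auto
      ultimately show ?thesis using 1[of x j] by simp
    qed
  qed simp
  moreover have "(\<integral>t. indicator C t * indicator B t \<partial>moment_measure x) = measure (moment_measure x) (B \<inter> C)" for x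
    by (simp add: indicator_inter_arith[symmetric] Int_commute)
  moreover have "symmetric_op (P o\<^sub>L Q)"
    by (rule symmetric_op_compose) (use representsD(1) B C comm in \<open>auto intro!: blinfun_eqI\<close>)
  moreover have "R (P (Q x)) = P (Q (R x))" if "\<And>x. R (T x) = T (R x)" for R :: "'a \<Rightarrow>\<^sub>L 'a" and x
    using representsD(3)[OF B(2), of R] representsD(3)[OF C(2), of R] that by simp
  ultimately show ?thesis by (auto simp: represents_def comm)
qed

end

section \<open>Projection-valued measures\<close>

lemma cinner_scaleC_left: "cinner (c *\<^sub>C x) y = cnj c * cinner x (y :: 'a::complex_hilbert)"
  by (metis cinner_commute cinner_scaleC_right complex_cnj_mult)

lemma cinner_eq_inner:
  "cinner x y = Complex (x \<bullet> y) (- (x \<bullet> (\<i> *\<^sub>C (y :: 'a::complex_hilbert))))"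
  by (simp add: inner_eq_Re_cinner cinner_scaleC_right complex_eq_iff)

lemma norm_scaleC_ii: "norm (\<i> *\<^sub>C (x :: 'a::complex_hilbert)) = norm x"
  by (simp add: norm_eq_sqrt_inner inner_eq_Re_cinner cinner_scaleC_left cinner_scaleC_right)

text \<open>Multiplication by \<i> as a bounded real-linear operator: commuting with it is the same
  as complex linearity.\<close>

definition imaginary_unit_op :: "'a::complex_hilbert \<Rightarrow>\<^sub>L 'a"
  where "imaginary_unit_op = Blinfun (\<lambda>x. \<i> *\<^sub>C x)"

lemma imaginary_unit_op_apply [simp]: "imaginary_unit_op x = \<i> *\<^sub>C x"
proof -
  have "bounded_linear (\<lambda>x::'a. \<i> *\<^sub>C x)"
  proof (rule bounded_linear_intro)
    show "\<i> *\<^sub>C (r *\<^sub>R x) = r *\<^sub>R (\<i> *\<^sub>C x)" for r and x :: 'a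
      by (simp add: scaleR_scaleC scaleC_scaleC mult.commute)
    show "norm (\<i> *\<^sub>C x) \<le> norm x * 1" for x :: 'a by (simp add: norm_scaleC_ii)
  qed (rule scaleC_add_right)
  then show ?thesis by (simp add: imaginary_unit_op_def bounded_linear_Blinfun_apply)
qed

lemma scaleC_conv_ii: "c *\<^sub>C (x :: 'a::complex_hilbert) = Re c *\<^sub>R x + Im c *\<^sub>R (\<i> *\<^sub>C x)"
proof -
  have "c *\<^sub>C x = (complex_of_real (Re c) + complex_of_real (Im c) * \<i>) *\<^sub>C x"
    by (simp add: complex_eq[symmetric] mult.commute)
  then show ?thesis by (simp only: scaleC_add_left scaleC_scaleC[symmetric] scaleR_scaleC)
qed

lemma bounded_ops_iff: "A \<in> bounded_ops \<longleftrightarrow> (\<forall>x. A (\<i> *\<^sub>C x) = \<i> *\<^sub>C A x)"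
proof
  assume *: "\<forall>x. A (\<i> *\<^sub>C x) = \<i> *\<^sub>C A x"
  show "A \<in> bounded_ops"
    unfolding bounded_ops_def
  proof (intro CollectI allI)
    fix c x
    show "A (c *\<^sub>C x) = c *\<^sub>C A x"
      by (simp only: scaleC_conv_ii[of c] blinfun.add_right blinfun.scaleR_right *[rule_format])
  qed
qed (simp add: bounded_ops_def)

lemma symmetric_op_cinner:
  assumes "symmetric_op A" "A \<in> bounded_ops"
  shows "cinner x (A y) = cinner (A x) y"
proof -
  have "x \<bullet> (\<i> *\<^sub>C A y) = A x \<bullet> (\<i> *\<^sub>C y)"
    using assms symmetric_opD[OF assms(1), of x "\<i> *\<^sub>C y"] by (simp add: bounded_ops_iff)
  then show ?thesis using assms(1) by (simp add: cinner_eq_inner symmetric_opD)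
qed

lemma symmetric_op_cinner_real:
  assumes "symmetric_op A" "A \<in> bounded_ops"
  shows "cinner x (A x) = complex_of_real (x \<bullet> A x)"
proof -
  have "cinner x (A x) = cnj (cinner x (A x))"
    using symmetric_op_cinner[OF assms, of x x] cinner_commute by metis
  then have "Im (cinner x (A x)) = 0" by (metis cnj.simps(2) equal_neg_zero)
  then show ?thesis by (simp add: complex_eq_iff inner_eq_Re_cinner)
qed

text \<open>Polarizing the vanishing imaginary part shows that
  \<open>x \<bullet> (\<i> *\<^sub>C A y)\<close> is antisymmetric; replacing \<open>y\<close> by
  \<open>\<i> *\<^sub>C y\<close> turns antisymmetry into symmetry of \<open>A\<close>.\<close>

lemma real_cinner_imp_symmetric_op:
  assumes "A \<in> bounded_ops" "\<And>x. cinner x (A x) \<in> \<real>"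
  shows "symmetric_op A"
proof -
  have *: "x \<bullet> (\<i> *\<^sub>C A x) = 0" for x
    using assms(2)[of x] by (simp add: cinner_eq_inner complex_is_Real_iff)
  have anti: "x \<bullet> (\<i> *\<^sub>C A y) = - (y \<bullet> (\<i> *\<^sub>C A x))" for x y
    using *[of "x + y"] *[of x] *[of y]
    by (simp add: blinfun.add_right scaleC_add_right inner_add_left inner_add_right)
  have skew: "(\<i> *\<^sub>C u) \<bullet> v = - (u \<bullet> (\<i> *\<^sub>C v))" for u v :: 'a
    by (simp add: inner_eq_Re_cinner cinner_scaleC_left cinner_scaleC_right)
  have sq: "\<i> *\<^sub>C (\<i> *\<^sub>C u) = - u" for u :: 'a
    using scaleR_scaleC[of "-1" u] by (simp add: scaleC_scaleC)
  have "x \<bullet> A y = A x \<bullet> y" for x y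
  proof -
    have "x \<bullet> (\<i> *\<^sub>C A (\<i> *\<^sub>C y)) = - ((\<i> *\<^sub>C y) \<bullet> (\<i> *\<^sub>C A x))" by (rule anti)
    then show ?thesis
      using assms(1) by (simp add: bounded_ops_iff sq skew inner_commute)
  qed
  then show ?thesis by (simp add: symmetric_op_def)
qed

lemma op_pos_iff: "op_pos A \<longleftrightarrow> A \<in> bounded_ops \<and> positive_op A"
proof
  assume A: "op_pos A"
  then have "A \<in> bounded_ops" "\<And>x. cinner x (A x) \<in> \<real>"
    by (auto simp: op_pos_def nonneg_Reals_subset_Reals[THEN subsetD])
  moreover have "0 \<le> x \<bullet> A x" for x
    using A by (auto simp: op_pos_def inner_eq_Re_cinner complex_nonneg_Reals_iff)
  ultimately show "A \<in> bounded_ops \<and> positive_op A"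
    by (simp add: positive_op_def real_cinner_imp_symmetric_op)
next
  assume "A \<in> bounded_ops \<and> positive_op A"
  then show "op_pos A"
    by (auto simp: op_pos_def positive_op_def symmetric_op_cinner_real complex_nonneg_Reals_iff)
qed

lemma bounded_ops_closed [intro, simp]:
  fixes A B :: "'a::complex_hilbert \<Rightarrow>\<^sub>L 'a"
  shows "(0 :: 'a \<Rightarrow>\<^sub>L 'a) \<in> bounded_ops" "(id_blinfun :: 'a \<Rightarrow>\<^sub>L 'a) \<in> bounded_ops"
  "A \<in> bounded_ops \<Longrightarrow> B \<in> bounded_ops \<Longrightarrow> A + B \<in> bounded_ops"
  "A \<in> bounded_ops \<Longrightarrow> B \<in> bounded_ops \<Longrightarrow> A - B \<in> bounded_ops"
  "A \<in> bounded_ops \<Longrightarrow> B \<in> bounded_ops \<Longrightarrow> A o\<^sub>L B \<in> bounded_ops"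
  "A \<in> bounded_ops \<Longrightarrow> r *\<^sub>R A \<in> bounded_ops"
proof -
  have *: "(0::'a) = \<i> *\<^sub>C 0"
    using imaginary_unit_op_apply[of "0::'a"] blinfun.zero_right[of imaginary_unit_op] by simp
  have **: "\<i> *\<^sub>C (x - y) = \<i> *\<^sub>C x - \<i> *\<^sub>C y" for x y :: 'a
    using blinfun.diff_right[of imaginary_unit_op x y] by simp
  show "(0::'a \<Rightarrow>\<^sub>L 'a) \<in> bounded_ops" "(id_blinfun::'a \<Rightarrow>\<^sub>L 'a) \<in> bounded_ops"
    using * by (simp_all add: bounded_ops_iff)
  show "r *\<^sub>R A \<in> bounded_ops" if "A \<in> bounded_ops"
    using that by (simp add: bounded_ops_iff blinfun.scaleR_left scaleR_scaleC scaleC_scaleC mult.commute)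
  show "A + B \<in> bounded_ops" "A - B \<in> bounded_ops" "A o\<^sub>L B \<in> bounded_ops"
    if "A \<in> bounded_ops" "B \<in> bounded_ops"
    using that by (simp_all add: bounded_ops_iff blinfun.add_left blinfun.diff_left scaleC_add_right **)
qed

lemma is_projection_iff:
  "is_projection P \<longleftrightarrow> P \<in> bounded_ops \<and> symmetric_op P \<and> P o\<^sub>L P = P"
proof
  assume P: "is_projection P"
  have "symmetric_op P"
    using P unfolding is_projection_def symmetric_op_def inner_eq_Re_cinner by metis
  then show "P \<in> bounded_ops \<and> symmetric_op P \<and> P o\<^sub>L P = P" using P by (simp add: is_projection_def)
next
  assume "P \<in> bounded_ops \<and> symmetric_op P \<and> P o\<^sub>L P = P"
  then show "is_projection P" by (simp add: is_projection_def symmetric_op_cinner)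
qed

lemma is_spectral_integralD:
  assumes "is_spectral_integral E f A"
  shows "A \<in> bounded_ops" "integrable (vector_measure E x) f"
    and "x \<bullet> A x = integral\<^sup>L (vector_measure E x) f" "symmetric_op A"
  using assms
  by (auto simp: is_spectral_integral_def inner_eq_Re_cinner intro!: real_cinner_imp_symmetric_op)

lemma is_spectral_integralI:
  assumes "A \<in> bounded_ops" "symmetric_op A" "\<And>x. integrable (vector_measure E x) f"
    "\<And>x. x \<bullet> A x = integral\<^sup>L (vector_measure E x) f"
  shows "is_spectral_integral E f A"
  using assms by (simp add: is_spectral_integral_def symmetric_op_cinner_real)

lemma is_spectral_integral_unique:
  "is_spectral_integral E f A \<Longrightarrow> is_spectral_integral E f B \<Longrightarrow> A = B"
  by (rule symmetric_op_eqI) (simp_all add: is_spectral_integralD)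

locale pvm =
  fixes E :: "real set \<Rightarrow> ('a::complex_hilbert \<Rightarrow>\<^sub>L 'a)"
  assumes pvm: "projection_valued_measure E"
begin

lemma
  assumes "B \<in> sets borel"
  shows symmetric: "symmetric_op (E B)" and bounded_ops: "E B \<in> bounded_ops"
    and idem: "E B (E B x) = E B x"
proof -
  have "is_projection (E B)" using pvm assms by (simp add: projection_valued_measure_def)
  then have "symmetric_op (E B)" "E B \<in> bounded_ops" "E B o\<^sub>L E B = E B" by (auto simp: is_projection_iff)
  then show "symmetric_op (E B)" "E B \<in> bounded_ops" "E B (E B x) = E B x"
    by (auto simp: blinfun_apply_blinfun_compose[symmetric])
qed

lemma UNIV [simp]: "E UNIV = id_blinfun"
  using pvm by (simp add: projection_valued_measure_def)

lemma not_borel: "B \<notin> sets borel \<Longrightarrow> E B = 0"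
  using pvm by (simp add: projection_valued_measure_def)

lemma Int: "B \<in> sets borel \<Longrightarrow> C \<in> sets borel \<Longrightarrow> E (B \<inter> C) = E B o\<^sub>L E C"
  using pvm by (simp add: projection_valued_measure_def)

lemma Int_apply: "B \<in> sets borel \<Longrightarrow> C \<in> sets borel \<Longrightarrow> E B (E C x) = E (B \<inter> C) x"
  by (simp add: Int)

lemma sums:
  "disjoint_family F \<Longrightarrow> range F \<subseteq> sets borel \<Longrightarrow> (\<lambda>i. E (F i) x) sums E (\<Union>i. F i) x"
  using pvm by (simp add: projection_valued_measure_def)

lemma empty [simp]: "E {} = 0"
proof (rule blinfun_eqI)
  fix x
  \<comment> \<open>Infinitely many copies of the empty set are disjoint, so a constant series
    converges.\<close>
  have "(\<lambda>i::nat. E {} x) sums E (\<Union>i::nat. {}) x" by (rule sums) (auto simp: disjoint_family_on_def)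
  then have "(\<lambda>i::nat. E {} x) \<longlonglongrightarrow> 0" by (intro summable_LIMSEQ_zero sums_summable)
  then show "E {} x = blinfun_apply 0 x" by (simp add: LIMSEQ_const_iff)
qed

lemma inner_nonneg: "B \<in> sets borel \<Longrightarrow> x \<bullet> E B x = (norm (E B x))\<^sup>2"
  using symmetric_opD[OF symmetric, of B x "E B x"] idem[of B x]
  by (simp add: power2_norm_eq_inner)

lemma positive: "B \<in> sets borel \<Longrightarrow> positive_op (E B)"
  by (simp add: positive_op_def symmetric inner_nonneg)

lemma Un:
  assumes "B \<in> sets borel" "C \<in> sets borel" "B \<inter> C = {}"
  shows "E (B \<union> C) = E B + E C"
proof (rule blinfun_eqI)
  fix x
  have "range (binaryset B C) \<subseteq> sets borel" using assms by (auto simp: range_binaryset_eq)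
  moreover have "disjoint_family (binaryset B C)"
    using assms(3) by (auto simp: disjoint_family_on_def binaryset_def)
  ultimately have "(\<lambda>i. E (binaryset B C i) x) sums E (\<Union>i. binaryset B C i) x" by (rule sums[rotated])
  moreover have "(\<lambda>i. E (binaryset B C i) x) sums (\<Sum>i\<in>{0,1}. E (binaryset B C i) x)"
    by (rule sums_finite) (auto simp: binaryset_def)
  ultimately show "E (B \<union> C) x = (E B + E C) x"
    by (auto simp: UN_binaryset_eq blinfun.add_left binaryset_def dest: sums_unique2)
qed

lemma compl: "B \<in> sets borel \<Longrightarrow> E (UNIV - B) = id_blinfun - E B"
  using Un[of B "UNIV - B"] by (simp add: algebra_simps)

lemma sets_vector_measure [simp, measurable_cong]: "sets (vector_measure E x) = sets borel"
  by (simp add: vector_measure_def sets_measure_of sigma_algebra.sigma_sets_eq[OF sets.sigma_algebra_axioms, of borel, simplified])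

lemma space_vector_measure [simp]: "space (vector_measure E x) = UNIV"
  by (simp add: vector_measure_def)

lemma emeasure_vector_measure:
  assumes "B \<in> sets borel"
  shows "emeasure (vector_measure E x) B = ennreal (x \<bullet> E B x)"
proof (rule emeasure_measure_of[of "vector_measure E x" UNIV "sets borel"])
  show "vector_measure E x = measure_of UNIV (sets borel) (\<lambda>B. ennreal (x \<bullet> E B x))"
    by (simp add: vector_measure_def inner_eq_Re_cinner)
  show "positive (sets (vector_measure E x)) (\<lambda>B. ennreal (x \<bullet> E B x))"
    by (simp add: positive_def)
  show "countably_additive (sets (vector_measure E x)) (\<lambda>B. ennreal (x \<bullet> E B x))"
  proof (rule countably_additiveI)
    fix F :: "nat \<Rightarrow> real set"
    assume "range F \<subseteq> sets (vector_measure E x)" and F: "disjoint_family F"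
    then have Fb: "range F \<subseteq> sets borel" by simp
    have "(\<lambda>i. x \<bullet> E (F i) x) sums (x \<bullet> E (\<Union>i. F i) x)"
      by (intro bounded_linear.sums[OF bounded_linear_inner_right] sums F Fb)
    then show "(\<Sum>i. ennreal (x \<bullet> E (F i) x)) = ennreal (x \<bullet> E (\<Union>i. F i) x)"
      using Fb by (intro suminf_ennreal_eq) (auto simp: inner_nonneg)
  qed
qed (use assms in auto)

lemma measure_vector_measure:
  "B \<in> sets borel \<Longrightarrow> measure (vector_measure E x) B = x \<bullet> E B x"
  by (simp add: measure_def emeasure_vector_measure inner_nonneg)

lemma finite_vector_measure: "finite_measure (vector_measure E x)"
  by (rule finite_measureI) (simp add: emeasure_vector_measure)

lemma null_sets_vector_measure:
  assumes "B \<in> sets borel" "E B x = 0"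
  shows "AE t in vector_measure E x. t \<notin> B"
  by (rule AE_not_in) (use assms in \<open>auto simp: null_sets_def emeasure_vector_measure\<close>)

lemma vector_measure_eqI:
  assumes "\<And>B. B \<in> sets borel \<Longrightarrow> x \<bullet> E B x = y \<bullet> E B y"
  shows "vector_measure E x = vector_measure E y"
  by (rule measure_eqI) (use assms in \<open>auto simp: emeasure_vector_measure\<close>)

end

text \<open>If \<open>u\<close> lies in the range of \<open>E B\<close> and \<open>w\<close> in its complement, then \<open>u + w\<close> and \<open>u - w\<close>
  have the same vector measure, so polarization gives \<open>u \<bullet> A w = 0\<close>.\<close>

lemma (in pvm) spectral_integral_commute:
  assumes A: "is_spectral_integral E f A" and B: "B \<in> sets borel"
  shows "A (E B x) = E B (A x)"
proof -
  note int = is_spectral_integralD(3)[OF A] and sA = is_spectral_integralD(4)[OF A]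
  have orth: "u \<bullet> A w = 0" if u: "E B u = u" and w: "E B w = 0" for u w
  proof -
    have "u \<bullet> E C w = 0" if C: "C \<in> sets borel" for C
    proof -
      have "u \<bullet> E C w = u \<bullet> E B (E C w)" using symmetric_opD[OF symmetric[OF B], of u "E C w"] u by simp
      also have "E B (E C w) = E C (E B w)" using B C by (simp add: Int_apply Int_commute)
      finally show ?thesis using w by simp
    qed
    then have "(u + w) \<bullet> E C (u + w) = (u - w) \<bullet> E C (u - w)" if "C \<in> sets borel" for C
      using symmetric_op_polarization[OF symmetric[OF that], of u w] that by simp
    then have "vector_measure E (u + w) = vector_measure E (u - w)" by (rule vector_measure_eqI)
    then show ?thesis using symmetric_op_polarization[OF sA, of u w] by (simp add: int)
  qed
  \<comment> \<open>Both off-diagonal blocks of \<open>A\<close> with respect to \<open>E B\<close>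
    vanish by \<open>orth\<close>: here the one leading into the range, below, in terms of
    \<open>v\<close>, the one leading out of it.\<close>
  have "E B (A x) = E B (A (E B x)) + E B (A (x - E B x))"
    by (simp add: blinfun.diff_right)
  moreover have "E B (A (x - E B x)) = 0"
  proof -
    have "v \<bullet> E B (A (x - E B x)) = 0" for v
    proof -
      have "v \<bullet> E B (A (x - E B x)) = E B v \<bullet> A (x - E B x)"
        by (rule symmetric_opD[OF symmetric[OF B]])
      also have "\<dots> = 0" by (rule orth) (use B in \<open>auto simp: idem blinfun.diff_right\<close>)
      finally show ?thesis .
    qed
    from this[of "E B (A (x - E B x))"] show ?thesis by simp
  qed
  moreover have "A (E B x) - E B (A (E B x)) = 0"
  proof -
    define v where "v = A (E B x) - E B (A (E B x))"
    have "E B v = 0" using B by (simp add: v_def blinfun.diff_right idem)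
    have "v \<bullet> A (E B x) = A v \<bullet> E B x" by (rule symmetric_opD[OF sA])
    also have "\<dots> = E B x \<bullet> A v" by (rule inner_commute)
    also have "\<dots> = 0" by (rule orth) (use B \<open>E B v = 0\<close> in \<open>auto simp: idem\<close>)
    finally have "v \<bullet> A (E B x) = 0" .
    moreover have "v \<bullet> E B (A (E B x)) = E B v \<bullet> A (E B x)" by (rule symmetric_opD[OF symmetric[OF B]])
    ultimately have "v \<bullet> v = 0" using \<open>E B v = 0\<close> by (simp add: v_def[of] inner_diff_right)
    then show ?thesis by (simp add: v_def)
  qed
  ultimately show ?thesis by simp
qed

text \<open>The vector measure of \<open>z\<close> is concentrated on the given half line and has
  positive mass because \<open>z\<close> is not zero, which gives the strict inequalities. A strict
  and a non-strict bound at the same \<open>s\<close> exclude each other in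
  \<open>pvm_unique\<close>.\<close>

lemma (in pvm) integral_less_bound:
  assumes T: "is_spectral_integral E (\<lambda>t. t) T" and z: "z \<noteq> 0"
  shows "E {s<..} z = z \<Longrightarrow> s * (norm z)\<^sup>2 < z \<bullet> T z" and "E {..s} z = z \<Longrightarrow> z \<bullet> T z \<le> s * (norm z)\<^sup>2"
    and "E {..<s} z = z \<Longrightarrow> z \<bullet> T z < s * (norm z)\<^sup>2"
proof -
  interpret finite_measure "vector_measure E z" by (rule finite_vector_measure)
  note int = is_spectral_integralD(2,3)[OF T, of z]
  have m: "measure (vector_measure E z) UNIV = (norm z)\<^sup>2"
    by (simp add: measure_vector_measure power2_norm_eq_inner)
  have "emeasure (vector_measure E z) UNIV = ennreal ((norm z)\<^sup>2)"
    by (simp add: emeasure_vector_measure power2_norm_eq_inner)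
  then have nz: "\<not> (AE t in vector_measure E z. False)"
    using z AE_iff_measurable[of UNIV "vector_measure E z" "\<lambda>_. False"] by auto
  have strict: False if "(\<integral>t. f t \<partial>vector_measure E z) \<le> 0" "integrable (vector_measure E z) f"
    "AE t in vector_measure E z. 0 < f t" for f :: "real \<Rightarrow> real"
  proof -
    have nn: "AE t in vector_measure E z. 0 \<le> f t" using that(3) by eventually_elim simp
    moreover have "(\<integral>t. f t \<partial>vector_measure E z) = 0"
      using that(1) integral_nonneg_AE[OF nn] by simp
    ultimately have "AE t in vector_measure E z. f t = 0"
      using integral_nonneg_eq_0_iff_AE[OF that(2)] by blast
    with that(3) have "AE t in vector_measure E z. False" by eventually_elim simp
    then show False using nz by simp
  qed
  have cmp: "AE t in vector_measure E z. t \<in> B" if "E B z = z" "B \<in> sets borel" for B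
  proof -
    have "E (UNIV - B) z = 0" using that by (simp add: compl blinfun.diff_left)
    then have "AE t in vector_measure E z. t \<notin> UNIV - B" using that by (intro null_sets_vector_measure) auto
    then show ?thesis by simp
  qed
  show "s * (norm z)\<^sup>2 < z \<bullet> T z" if "E {s<..} z = z"
  proof (rule ccontr)
    assume "\<not> ?thesis"
    then show False
      using int m cmp[OF that] by (intro strict[of "\<lambda>t. t - s"]) (auto simp: mult.commute)
  qed
  show "z \<bullet> T z < s * (norm z)\<^sup>2" if "E {..<s} z = z"
  proof (rule ccontr)
    assume "\<not> ?thesis"
    then show False
      using int m cmp[OF that] by (intro strict[of "\<lambda>t. s - t"]) (auto simp: mult.commute)
  qed
  show "z \<bullet> T z \<le> s * (norm z)\<^sup>2" if "E {..s} z = z"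
  proof -
    have "(\<integral>t. t \<partial>vector_measure E z) \<le> (\<integral>t. s \<partial>vector_measure E z)"
      using cmp[OF that] int by (intro integral_mono_AE) auto
    then show ?thesis using int m by (simp add: mult.commute)
  qed
qed

lemma pvm_eqI:
  assumes E: "pvm E" and F: "pvm F" and eq: "\<And>s. E {s<..} = F {s<..}"
  shows "E = F"
proof
  fix B
  show "E B = F B"
  proof (cases "B \<in> sets borel")
    case True
    then show ?thesis
    proof (induction B rule: borel_induct_greaterThan)
      case (union G)
      show ?case
      proof (rule blinfun_eqI)
        fix x
        have "(\<lambda>i. E (G i) x) sums E (\<Union>i. G i) x" "(\<lambda>i. F (G i) x) sums F (\<Union>i. G i) x"
          by (intro pvm.sums[OF E] pvm.sums[OF F] union)+
        then show "E (\<Union>i. G i) x = F (\<Union>i. G i) x" using union.IH sums_unique2 by simp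
      qed
    qed (simp_all add: eq pvm.empty[OF E] pvm.empty[OF F] pvm.compl[OF E] pvm.compl[OF F])
  qed (simp add: pvm.not_borel[OF E] pvm.not_borel[OF F])
qed

text \<open>Since the projections of \<open>F\<close> commute with \<open>T\<close>,
  \<open>comm\<close> makes them commute with those of \<open>E\<close>. A nonzero vector in the
  ranges of both \<open>E {s<..}\<close> and \<open>F {..s}\<close> would violate the bounds on the
  form of \<open>T\<close>, so the product of these projections is 0; exchanging the half lines
  gives equality.\<close>

lemma pvm_unique:
  assumes E: "pvm E" and F: "pvm F"
    and TE: "is_spectral_integral E (\<lambda>t. t) T" and TF: "is_spectral_integral F (\<lambda>t. t) T"
    and comm: "\<forall>C. (\<forall>x. blinfun_apply C (T x) = T (C x)) \<longrightarrow> (\<forall>B x. C (E B x) = E B (C x))"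
  shows "E = F"
proof (rule pvm_eqI[OF E F])
  fix s :: real
  interpret E: pvm E by (rule E)
  interpret F: pvm F by (rule F)
  have c: "F B (E C x) = E C (F B x)" if "B \<in> sets borel" for B C x
    using comm F.spectral_integral_commute[OF TF that] by metis
  have "F {..s} (E {s<..} x) = 0" for x
  proof (rule ccontr)
    let ?z = "F {..s} (E {s<..} x)"
    assume "?z \<noteq> 0"
    from F.integral_less_bound(2)[OF TF this, of s] E.integral_less_bound(1)[OF TE this, of s]
    show False by (simp add: F.idem c E.idem)
  qed
  moreover have "F {s<..} (E {..s} x) = 0" for x
  proof (rule ccontr)
    let ?z = "F {s<..} (E {..s} x)"
    assume "?z \<noteq> 0"
    from F.integral_less_bound(1)[OF TF this, of s] E.integral_less_bound(2)[OF TE this, of s]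
    show False by (simp add: F.idem c E.idem)
  qed
  moreover have "UNIV - {s<..} = {..s}" by auto
  ultimately show "E {s<..} = F {s<..}"
    using E.compl[of "{s<..}"] F.compl[of "{s<..}"]
    by (intro blinfun_eqI) (simp add: blinfun.diff_left blinfun.diff_right)
qed

section \<open>The spectral theorem and uniqueness of the spectral measure\<close>

context bounded_positive_op
begin

definition resolution :: "real set \<Rightarrow> ('a \<Rightarrow>\<^sub>L 'a)"
  where "resolution B = (if B \<in> sets borel then SOME P. represents B P else 0)"

lemma represents_resolution: "B \<in> sets borel \<Longrightarrow> represents B (resolution B)"
  unfolding resolution_def using someI_ex[OF represents_ex] by simp

lemma resolution_eqI: "B \<in> sets borel \<Longrightarrow> represents B P \<Longrightarrow> resolution B = P"
  using represents_resolution represents_unique by blast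

lemma resolution_commute:
  fixes C :: "'a \<Rightarrow>\<^sub>L 'a"
  assumes "\<And>x. C (T x) = T (C x)"
  shows "C (resolution B x) = resolution B (C x)"
proof (cases "B \<in> sets borel")
  case True
  then show ?thesis by (intro representsD(3)[OF represents_resolution] assms)
qed (simp add: resolution_def)

end

lemma op_pos_spectral_theorem:
  fixes T :: "'a::complex_hilbert \<Rightarrow>\<^sub>L 'a"
  assumes T: "op_pos T"
  obtains E where "pvm E" "is_spectral_integral E (\<lambda>t. t) T"
    "\<forall>C. (\<forall>x. blinfun_apply C (T x) = T (C x)) \<longrightarrow> (\<forall>B x. C (E B x) = E B (C x))"
    "\<And>B. B \<inter> {0..norm T + 1} = {} \<Longrightarrow> E B = 0"
    "\<And>x j. x \<bullet> op_power T j x = (\<integral>t. t ^ j \<partial>vector_measure E x)"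
proof -
  \<comment> \<open>Adding 1 keeps the bound positive also for \<open>T = 0\<close>.\<close>
  interpret bounded_positive_op T "norm T + 1"
  proof
    show "positive_op T" using T by (simp add: op_pos_iff)
    show "0 < norm T + 1" by (simp add: add_nonneg_pos)
    show "x \<bullet> T x \<le> (norm T + 1) * (norm x)\<^sup>2" for x
    proof -
      have "x \<bullet> T x \<le> norm T * (norm x)\<^sup>2" using inner_blinfun_le_norm[of x T] by linarith
      also have "\<dots> \<le> (norm T + 1) * (norm x)\<^sup>2" by (intro mult_right_mono) auto
      finally show ?thesis .
    qed
  qed
  let ?E = resolution
  note rep = represents_resolution
  have Tb: "T (\<i> *\<^sub>C x) = \<i> *\<^sub>C T x" for x using T by (simp add: op_pos_iff bounded_ops_iff)
  \<comment> \<open>The resolution commutes with every operator that commutes with \<open>T\<close>,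
    in particular with multiplication by \<i>.\<close>
  have Eb: "?E B \<in> bounded_ops" for B
    unfolding bounded_ops_iff using resolution_commute[of imaginary_unit_op B] by (simp add: Tb)
  have Int: "?E (B \<inter> C) = ?E B o\<^sub>L ?E C" if "B \<in> sets borel" "C \<in> sets borel" for B C
    using that by (intro resolution_eqI represents_Int rep) auto
  have "projection_valued_measure ?E"
    unfolding projection_valued_measure_def
  proof (intro conjI ballI allI impI)
    fix B :: "real set" assume B: "B \<in> sets borel"
    show "is_projection (?E B)"
      using representsD(1)[OF rep[OF B]] Int[OF B B] Eb by (simp add: is_projection_iff)
  next
    fix B :: "real set" assume B: "B \<notin> sets borel"
    then show "?E B = 0" by (simp add: resolution_def)
  next
    show "?E UNIV = id_blinfun"
      using represents_compl[OF represents_empty] by (intro resolution_eqI) auto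
  next
    fix F :: "nat \<Rightarrow> real set" and x
    assume F: "range F \<subseteq> sets borel" "disjoint_family F"
    have Fi: "F i \<in> sets borel" for i using F(1) by auto
    obtain Q where Q: "represents (\<Union>i. F i) Q" "\<forall>x. (\<lambda>i. ?E (F i) x) sums Q x"
      using represents_UN[OF F(2) Fi rep[OF Fi]] by metis
    moreover have "?E (\<Union>i. F i) = Q" using Fi by (intro resolution_eqI Q) auto
    ultimately show "(\<lambda>i. ?E (F i) x) sums ?E (\<Union>i. F i) x" by simp
  qed (rule Int)
  then have E: "pvm ?E" by unfold_locales
  \<comment> \<open>The forms of the resolution reproduce the chosen moment measures, so integrals
    against vector measures can be read off from moments.\<close>
  have vm: "vector_measure ?E x = moment_measure x" for x
  proof (rule measure_eqI)
    fix B assume "B \<in> sets (vector_measure ?E x)"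
    then have B: "B \<in> sets borel" by (simp add: pvm.sets_vector_measure[OF E])
    then show "emeasure (vector_measure ?E x) B = emeasure (moment_measure x) B"
      using finite_measure.emeasure_eq_measure[OF finite_moment_measure]
      by (simp add: pvm.emeasure_vector_measure[OF E] representsD(2)[OF rep])
  qed (simp add: pvm.sets_vector_measure[OF E] sets_moment_measure)
  show thesis
  proof (rule that[OF E])
    show "is_spectral_integral ?E (\<lambda>t. t) T"
    proof (rule is_spectral_integralI)
      show "T \<in> bounded_ops" "symmetric_op T" using T by (auto simp: op_pos_iff symmetric_T)
      show "integrable (vector_measure ?E x) (\<lambda>t. t)" for x
        unfolding vm by (rule integrable_moment_measure[of _ "norm T + 1"]) auto
      show "x \<bullet> T x = integral\<^sup>L (vector_measure ?E x) (\<lambda>t. t)" for x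
        unfolding vm using moment[of x 1] by simp
    qed
    show "x \<bullet> op_power T j x = (\<integral>t. t ^ j \<partial>vector_measure ?E x)" for x j
      unfolding vm by (simp add: moment)
    show "?E B = 0" if "B \<inter> {0..norm T + 1} = {}" for B
    proof (cases "B \<in> sets borel")
      case True
      have "measure (moment_measure x) B = 0" for x
      proof -
        have "AE t in moment_measure x. t \<notin> B" by (rule AE_moment_measureI) (use that in auto)
        then show ?thesis
          using True by (subst measure_eq_AE[of B "{}"]) (auto simp: sets_moment_measure elim!: eventually_mono)
      qed
      then have "represents B 0" by (simp add: represents_def)
      then show ?thesis using True by (intro resolution_eqI)
    qed (simp add: resolution_def)
  qed (simp add: resolution_commute)
qed

text \<open>The constructed resolution satisfies the description of \<open>spectral_measure\<close>,
  and \<open>pvm_unique\<close> shows that nothing else does.\<close>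

lemma
  fixes T C :: "'a::complex_hilbert \<Rightarrow>\<^sub>L 'a"
  assumes T: "op_pos T"
  shows pvm_spectral_measure: "pvm (spectral_measure T)"
    and spectral_integral_spectral_measure: "is_spectral_integral (spectral_measure T) (\<lambda>t. t) T"
    and spectral_measure_commute:
      "(\<And>x. C (T x) = T (C x)) \<Longrightarrow> C (spectral_measure T B x) = spectral_measure T B (C x)"
    and spectral_measure_outside: "B \<inter> {0..norm T + 1} = {} \<Longrightarrow> spectral_measure T B = 0"
    and spectral_measure_moment:
      "x \<bullet> op_power T j x = (\<integral>t. t ^ j \<partial>vector_measure (spectral_measure T) x)"
    and spectral_measure_eqI:
      "pvm F \<Longrightarrow> is_spectral_integral F (\<lambda>t. t) T \<Longrightarrow> spectral_measure T = F"
proof -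
  obtain E where E: "pvm E" "is_spectral_integral E (\<lambda>t. t) T"
    "\<forall>C. (\<forall>x. blinfun_apply C (T x) = T (C x)) \<longrightarrow> (\<forall>B x. C (E B x) = E B (C x))"
    "\<And>B. B \<inter> {0..norm T + 1} = {} \<Longrightarrow> E B = 0"
    "\<And>x j. x \<bullet> op_power T j x = (\<integral>t. t ^ j \<partial>vector_measure E x)"
    by (rule op_pos_spectral_theorem[OF T]) (rule that)
  have u: "F = E" if "pvm F" "is_spectral_integral F (\<lambda>t. t) T" for F
    using pvm_unique[OF E(1) that(1) E(2) that(2) E(3)] by simp
  have eq: "spectral_measure T = E"
    unfolding spectral_measure_def
  proof (rule the_equality)
    show "projection_valued_measure E \<and> is_spectral_integral E (\<lambda>t. t) T"
      using E(1,2) by (simp add: pvm_def)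
    show "F = E" if "projection_valued_measure F \<and> is_spectral_integral F (\<lambda>t. t) T" for F
      using that by (intro u) (simp_all add: pvm_def)
  qed
  show "pvm (spectral_measure T)" "is_spectral_integral (spectral_measure T) (\<lambda>t. t) T"
    "B \<inter> {0..norm T + 1} = {} \<Longrightarrow> spectral_measure T B = 0"
    "x \<bullet> op_power T j x = (\<integral>t. t ^ j \<partial>vector_measure (spectral_measure T) x)"
    "pvm F \<Longrightarrow> is_spectral_integral F (\<lambda>t. t) T \<Longrightarrow> spectral_measure T = F"
    unfolding eq by (rule E E(4) u[symmetric], assumption?)+
  show "(\<And>x. C (T x) = T (C x)) \<Longrightarrow> C (spectral_measure T B x) = spectral_measure T B (C x)"
    unfolding eq using E(3) by blast
qed

lemma AE_vector_measure_spectral: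
  fixes T :: "'a::complex_hilbert \<Rightarrow>\<^sub>L 'a"
  assumes T: "op_pos T"
  shows "AE t in vector_measure (spectral_measure T) x. t \<in> {0..norm T + 1}"
proof -
  have "AE t in vector_measure (spectral_measure T) x. t \<notin> - {0..norm T + 1}"
    by (rule pvm.null_sets_vector_measure[OF pvm_spectral_measure[OF T]])
      (use spectral_measure_outside[OF T, of "- {0..norm T + 1}"] in auto)
  then show ?thesis by simp
qed

section \<open>Images of spectral measures, square roots and absolute values\<close>

definition pvm_image :: "(real \<Rightarrow> real) \<Rightarrow> (real set \<Rightarrow> ('a::complex_hilbert \<Rightarrow>\<^sub>L 'a)) \<Rightarrow> real set \<Rightarrow> ('a \<Rightarrow>\<^sub>L 'a)"
  where "pvm_image f E B = (if B \<in> sets borel then E (f -` B) else 0)"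

lemma
  assumes E: "pvm E" and f: "f \<in> borel_measurable borel"
  shows pvm_pvm_image: "pvm (pvm_image f E)"
    and vector_measure_pvm_image: "vector_measure (pvm_image f E) x = distr (vector_measure E x) borel f"
proof -
  interpret pvm E by (rule E)
  have m: "f -` B \<in> sets borel" if "B \<in> sets borel" for B
    using measurable_sets[OF f that] by simp
  show *: "pvm (pvm_image f E)"
    unfolding pvm_def projection_valued_measure_def
  proof (intro conjI ballI allI impI)
    show "is_projection (pvm_image f E B)" if "B \<in> sets borel" for B
      using pvm m[OF that] that by (simp add: pvm_image_def projection_valued_measure_def)
    show "pvm_image f E B = 0" if "B \<notin> sets borel" for B using that by (simp add: pvm_image_def)
    show "pvm_image f E (B \<inter> C) = pvm_image f E B o\<^sub>L pvm_image f E C"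
      if "B \<in> sets borel" "C \<in> sets borel" for B C
      using that m by (simp add: pvm_image_def Int)
    show "(\<lambda>i. pvm_image f E (F i) x) sums pvm_image f E (\<Union>i. F i) x"
      if F: "range F \<subseteq> sets borel" "disjoint_family F" for F :: "nat \<Rightarrow> real set" and x
    proof -
      have Fi: "F i \<in> sets borel" for i using F by auto
      have "(\<lambda>i. E (f -` F i) x) sums E (\<Union>i. f -` F i) x"
        by (rule sums) (use F(2) m[OF Fi] in \<open>auto simp: disjoint_family_on_def\<close>)
      then show ?thesis using Fi by (simp add: pvm_image_def vimage_UN sets.countable_UN)
    qed
  qed (simp add: pvm_image_def)
  show "vector_measure (pvm_image f E) x = distr (vector_measure E x) borel f"
  proof (rule measure_eqI)
    fix B assume "B \<in> sets (vector_measure (pvm_image f E) x)"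
    then have B: "B \<in> sets borel" by (simp add: pvm.sets_vector_measure[OF *])
    have fm: "f \<in> measurable (vector_measure E x) borel" using f by simp
    show "emeasure (vector_measure (pvm_image f E) x) B = emeasure (distr (vector_measure E x) borel f) B"
      using B m[OF B] fm
      by (simp add: emeasure_distr pvm.emeasure_vector_measure[OF *] emeasure_vector_measure) (simp add: pvm_image_def)
  qed (simp add: pvm.sets_vector_measure[OF *])
qed

lemma spectral_integral_pvm_image:
  assumes E: "pvm E" and f: "f \<in> borel_measurable borel" and g: "g \<in> borel_measurable borel"
  shows "is_spectral_integral (pvm_image f E) g A \<longleftrightarrow> is_spectral_integral E (\<lambda>t. g (f t)) A"
proof -
  have "f \<in> measurable (vector_measure E x) borel" for x
    using f by (simp add: pvm.sets_vector_measure[OF E] cong: measurable_cong_sets)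
  then show ?thesis
    using g by (simp add: is_spectral_integral_def vector_measure_pvm_image[OF E f]
        integrable_distr_eq integral_distr)
qed

text \<open>Spectral mapping: the identity integrated against the image is \<open>f\<close>
  integrated against the original measure, and spectral measures are unique.\<close>

lemma spectral_measure_spectral_integral:
  fixes T A :: "'a::complex_hilbert \<Rightarrow>\<^sub>L 'a"
  assumes T: "op_pos T" and A: "op_pos A" and f: "f \<in> borel_measurable borel"
    and "is_spectral_integral (spectral_measure T) f A"
  shows "spectral_measure A = pvm_image f (spectral_measure T)"
  using assms pvm_spectral_measure[OF T]
  by (intro spectral_measure_eqI[OF A] pvm_pvm_image) (simp_all add: spectral_integral_pvm_image)

lemma is_spectral_integral_cong_AE:
  assumes E: "pvm E" and "f \<in> borel_measurable borel" "g \<in> borel_measurable borel"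
    "\<And>x. AE t in vector_measure E x. f t = g t"
  shows "is_spectral_integral E f A \<longleftrightarrow> is_spectral_integral E g A"
proof -
  have m: "f \<in> borel_measurable (vector_measure E x)" "g \<in> borel_measurable (vector_measure E x)" for x
    using assms(2,3) by (simp_all add: pvm.sets_vector_measure[OF E] cong: measurable_cong_sets)
  show ?thesis
    unfolding is_spectral_integral_def
    using integrable_cong_AE[OF m assms(4)] integral_cong_AE[OF m assms(4)] by metis
qed

text \<open>The spectral measure of \<open>A\<close> is the image under the square root of that of
  its square, because it lives on [0,oo), where \<open>sqrt (t\<^sup>2) = t\<close>. Positive
  operators with equal squares thus have equal spectral measures. This makes \<open>op_abs\<close>
  well defined.\<close>

lemma positive_square_root_unique:
  fixes A B :: "'a::complex_hilbert \<Rightarrow>\<^sub>L 'a"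
  assumes A: "op_pos A" and B: "op_pos B" and sq: "A o\<^sub>L A = B o\<^sub>L B"
  shows "A = B"
proof -
  have sqrt_image: "spectral_measure A = pvm_image sqrt (spectral_measure (A o\<^sub>L A))"
    if A: "op_pos A" for A :: "'a \<Rightarrow>\<^sub>L 'a"
  proof -
    have AA: "op_pos (A o\<^sub>L A)"
    proof -
      have "x \<bullet> A (A x) = (norm (A x))\<^sup>2" for x
        using A symmetric_opD[of A x "A x"] by (simp add: op_pos_iff positive_op_def power2_norm_eq_inner)
      then show ?thesis
        using A by (auto simp: op_pos_iff positive_op_def intro!: symmetric_op_compose)
    qed
    note E = pvm_spectral_measure[OF A]
    have "is_spectral_integral (spectral_measure A) (\<lambda>t. t\<^sup>2) (A o\<^sub>L A)"
    proof (rule is_spectral_integralI)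
      show "A o\<^sub>L A \<in> bounded_ops" "symmetric_op (A o\<^sub>L A)"
        using AA by (auto simp: op_pos_iff positive_op_def)
      show "x \<bullet> (A o\<^sub>L A) x = (\<integral>t. t\<^sup>2 \<partial>vector_measure (spectral_measure A) x)" for x
        using spectral_measure_moment[OF A, of x 2] by (simp add: numeral_2_eq_2)
      show "integrable (vector_measure (spectral_measure A) x) (\<lambda>t. t\<^sup>2)" for x
      proof (rule finite_measure.integrable_const_bound[OF pvm.finite_vector_measure[OF E]])
        show "AE t in vector_measure (spectral_measure A) x. norm (t\<^sup>2) \<le> (norm A + 1)\<^sup>2"
          using AE_vector_measure_spectral[OF A] by eventually_elim (auto intro!: power_mono)
      qed (simp add: pvm.sets_vector_measure[OF E] cong: measurable_cong_sets)
    qed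
    then have eq: "spectral_measure (A o\<^sub>L A) = pvm_image (\<lambda>t. t\<^sup>2) (spectral_measure A)"
      by (intro spectral_measure_spectral_integral A AA) auto
    have "is_spectral_integral (spectral_measure A) (\<lambda>t. sqrt (t\<^sup>2)) A"
      using spectral_integral_spectral_measure[OF A]
    proof (rule is_spectral_integral_cong_AE[OF E, THEN iffD1, rotated -1])
      show "AE t in vector_measure (spectral_measure A) x. t = sqrt (t\<^sup>2)" for x
        using AE_vector_measure_spectral[OF A] by eventually_elim simp
    qed auto
    then show ?thesis
      unfolding eq
      by (intro spectral_measure_eqI[OF A] pvm_pvm_image E)
        (simp_all add: spectral_integral_pvm_image pvm_pvm_image E)
  qed
  have "spectral_measure A = spectral_measure B"
    using sqrt_image[OF A] sqrt_image[OF B] sq by simp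
  then show ?thesis
    using spectral_integral_spectral_measure[OF A] spectral_integral_spectral_measure[OF B]
    by (metis is_spectral_integral_unique)
qed

lemma op_adjoint_symmetric:
  fixes A :: "'a::complex_hilbert \<Rightarrow>\<^sub>L 'a"
  assumes A: "A \<in> bounded_ops" "symmetric_op A"
  shows "op_adjoint A = A"
  unfolding op_adjoint_def
proof (rule the_equality)
  show "\<forall>x y. cinner (A x) y = cinner x (A y)" using symmetric_op_cinner A by metis
next
  fix B :: "'a \<Rightarrow>\<^sub>L 'a" assume B: "\<forall>x y. cinner (B x) y = cinner x (A y)"
  show "B = A"
  proof (rule blinfun_eq_innerI)
    fix x y
    have "B y \<bullet> x = A y \<bullet> x"
      using B symmetric_opD[OF A(2), of y x] by (simp add: inner_eq_Re_cinner)
    then show "x \<bullet> B y = x \<bullet> A y" by (simp add: inner_commute)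
  qed
qed

lemma op_abs_positive:
  assumes A: "op_pos A"
  shows "op_abs A = A"
proof -
  have "op_adjoint A = A" using A by (simp add: op_adjoint_symmetric op_pos_iff positive_op_def)
  then show ?thesis
    unfolding op_abs_def using A positive_square_root_unique by (intro the_equality) auto
qed

section \<open>The trace on the functional calculus\<close>

text \<open>Elements of the commutant of \<open>N\<close> commute with \<open>T\<close> and hence
  with \<open>P\<close>. Since \<open>C\<close> ranges over all real-linear operators,
  multiplication by \<i> is among them and yields complex linearity of \<open>P\<close>.\<close>

lemma von_neumann_algebra_double_commutantI:
  fixes T P :: "'a::complex_hilbert \<Rightarrow>\<^sub>L 'a"
  assumes N: "von_neumann_algebra N" and T: "T \<in> N"
    and comm: "\<forall>C. (\<forall>x. blinfun_apply C (T x) = T (C x)) \<longrightarrow> (\<forall>x. C (P x) = P (C x))"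
  shows "P \<in> N"
proof -
  have Tb: "T (\<i> *\<^sub>C x) = \<i> *\<^sub>C T x" for x
    using N T by (auto simp: von_neumann_algebra_def bounded_ops_iff)
  then have "P \<in> bounded_ops"
    using comm[rule_format, of imaginary_unit_op] by (simp add: bounded_ops_iff)
  moreover have "A o\<^sub>L P = P o\<^sub>L A" if A: "A \<in> commutant N" for A
  proof (rule blinfun_eqI)
    fix x
    have "T o\<^sub>L A = A o\<^sub>L T" using A T by (simp add: commutant_def)
    then have "A (T x) = T (A x)" for x by (metis blinfun_apply_blinfun_compose)
    then show "(A o\<^sub>L P) x = (P o\<^sub>L A) x" using comm by simp
  qed
  ultimately have "P \<in> commutant (commutant N)" by (auto simp: commutant_def)
  then show ?thesis using N by (simp add: von_neumann_algebra_def)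
qed

lemma op_le_iff:
  fixes A B :: "'a::complex_hilbert \<Rightarrow>\<^sub>L 'a"
  assumes "A \<in> bounded_ops" "B \<in> bounded_ops" "symmetric_op A" "symmetric_op B"
  shows "op_le A B \<longleftrightarrow> (\<forall>x. x \<bullet> A x \<le> x \<bullet> B x)"
  using assms by (auto simp: op_le_def op_pos_iff positive_op_def blinfun.diff_left inner_diff_right)

text \<open>An increasing sequence is a directed set, and convergence of the forms makes
  \<open>Q\<close> its least upper bound.\<close>

lemma normal_trace_LIMSEQ:
  fixes P :: "nat \<Rightarrow> 'a::complex_hilbert \<Rightarrow>\<^sub>L 'a"
  assumes \<tau>: "normal_trace N \<tau>"
    and P: "\<And>n. P n \<in> pos_part N" and Q: "Q \<in> pos_part N"
    and inc: "\<And>x. incseq (\<lambda>n. x \<bullet> P n x)" and lim: "\<And>x. (\<lambda>n. x \<bullet> P n x) \<longlonglongrightarrow> x \<bullet> Q x"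
  shows "\<tau> Q = (SUP n. \<tau> (P n))"
proof -
  have sa: "A \<in> bounded_ops \<and> symmetric_op A" if "A \<in> pos_part N" for A
    using that by (simp add: pos_part_def op_pos_iff positive_op_def)
  have le: "op_le A B \<longleftrightarrow> (\<forall>x. x \<bullet> A x \<le> x \<bullet> B x)" if "A \<in> pos_part N" "B \<in> pos_part N" for A B
    using that sa by (intro op_le_iff) auto
  have mono: "op_le (P m) (P n)" if "m \<le> n" for m n
    using incseqD[OF inc that] le P by simp
  have up: "op_le (P n) Q" for n
    using incseq_le[OF inc lim] le P Q by simp
  have "range P \<noteq> {} \<and> range P \<subseteq> pos_part N \<and>
       (\<forall>B\<in>range P. \<forall>C\<in>range P. \<exists>F\<in>range P. op_le B F \<and> op_le C F) \<and>
       Q \<in> pos_part N \<and> (\<forall>B\<in>range P. op_le B Q) \<and>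
       (\<forall>C\<in>pos_part N. (\<forall>B\<in>range P. op_le B C) \<longrightarrow> op_le Q C)"
  proof (intro conjI ballI impI)
    fix B C assume "B \<in> range P" "C \<in> range P"
    then obtain m n where "B = P m" "C = P n" by auto
    then show "\<exists>F\<in>range P. op_le B F \<and> op_le C F"
      by (intro bexI[of _ "P (max m n)"]) (auto intro: mono)
  next
    fix C assume C: "C \<in> pos_part N" "\<forall>B\<in>range P. op_le B C"
    have "x \<bullet> Q x \<le> x \<bullet> C x" for x
      by (rule LIMSEQ_le_const2[OF lim]) (use C P le in auto)
    then show "op_le Q C" using le Q C(1) by simp
  qed (use P Q up in auto)
  then have "\<tau> Q = (SUP B\<in>range P. \<tau> B)"
    using \<tau> unfolding normal_trace_def by blast
  then show ?thesis by (simp add: image_image)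
qed

locale traced_positive_op =
  fixes N :: "('a::complex_hilbert \<Rightarrow>\<^sub>L 'a) set" and \<tau> :: "('a \<Rightarrow>\<^sub>L 'a) \<Rightarrow> ennreal"
    and T :: "'a \<Rightarrow>\<^sub>L 'a"
  assumes vN: "von_neumann_algebra N" and tr: "is_trace N \<tau>" and normal: "normal_trace N \<tau>"
    and T: "T \<in> pos_part N"
begin

abbreviation "E \<equiv> spectral_measure T"

lemma T_pos: "op_pos T" and T_in: "T \<in> N"
  using T by (auto simp: pos_part_def)

sublocale E: pvm E
  by (rule pvm_spectral_measure[OF T_pos])

definition commuting :: "('a \<Rightarrow>\<^sub>L 'a) \<Rightarrow> bool"
  where "commuting P \<longleftrightarrow> (\<forall>C. (\<forall>x. blinfun_apply C (T x) = T (C x)) \<longrightarrow> (\<forall>x. C (P x) = P (C x)))"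

lemma commuting_pos_part: "commuting P \<Longrightarrow> positive_op P \<Longrightarrow> P \<in> pos_part N"
  using von_neumann_algebra_double_commutantI[OF vN T_in] vN
  by (auto simp: pos_part_def op_pos_iff commuting_def von_neumann_algebra_def)

lemma commuting_E: "commuting (E B)"
  using spectral_measure_commute[OF T_pos] by (auto simp: commuting_def)

lemma E_pos_part: "B \<in> sets borel \<Longrightarrow> E B \<in> pos_part N"
  by (intro commuting_pos_part commuting_E E.positive)

lemma trace_add: "A \<in> pos_part N \<Longrightarrow> B \<in> pos_part N \<Longrightarrow> \<tau> (A + B) = \<tau> A + \<tau> B"
  using tr by (simp add: is_trace_def)

lemma trace_scaleR: "A \<in> pos_part N \<Longrightarrow> 0 \<le> c \<Longrightarrow> \<tau> (c *\<^sub>R A) = ennreal c * \<tau> A"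
  using tr by (simp add: is_trace_def)

lemma trace_0 [simp]: "\<tau> 0 = 0"
  using trace_scaleR[OF T, of 0] by simp

definition trace_measure :: "real measure"
  where "trace_measure = measure_of UNIV (sets borel) (\<lambda>B. \<tau> (E B))"

lemma sets_trace_measure [simp, measurable_cong]: "sets trace_measure = sets borel"
  by (simp add: trace_measure_def sets_measure_of sigma_algebra.sigma_sets_eq[OF sets.sigma_algebra_axioms, of borel, simplified])

lemma space_trace_measure [simp]: "space trace_measure = UNIV"
  by (simp add: trace_measure_def)

lemma emeasure_trace_measure:
  assumes "B \<in> sets borel"
  shows "emeasure trace_measure B = \<tau> (E B)"
proof (rule emeasure_measure_of[OF trace_measure_def])
  show "positive (sets trace_measure) (\<lambda>B. \<tau> (E B))" by (simp add: positive_def)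
  show "countably_additive (sets trace_measure) (\<lambda>B. \<tau> (E B))"
  proof (rule countably_additiveI)
    fix F :: "nat \<Rightarrow> real set"
    assume "range F \<subseteq> sets trace_measure" and F: "disjoint_family F"
    then have Fb: "range F \<subseteq> sets borel" and Fi: "F i \<in> sets borel" for i by auto
    define P where "P n = (\<Sum>i<n. E (F i))" for n
    have pos: "P n \<in> pos_part N \<and> \<tau> (P n) = (\<Sum>i<n. \<tau> (E (F i)))" for n
    proof (induction n)
      case 0
      have "(0 :: 'a \<Rightarrow>\<^sub>L 'a) \<in> pos_part N" using E_pos_part[of "{}"] by simp
      then show ?case by (simp add: P_def)
    next
      case (Suc n)
      have "commuting (P (Suc n))"
        using commuting_E unfolding commuting_def P_def
        by (simp add: blinfun.sum_left blinfun.add_left blinfun.sum_right blinfun.add_right)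
      moreover have "positive_op (P (Suc n))"
        unfolding positive_op_def P_def
        by (auto intro!: symmetric_op_sum E.symmetric Fi sum_nonneg
            simp: blinfun.sum_left inner_sum_right E.inner_nonneg[OF Fi] simp del: sum.lessThan_Suc)
      ultimately have "P (Suc n) \<in> pos_part N" by (rule commuting_pos_part)
      then show ?case using trace_add[of "P n" "E (F n)"] Suc E_pos_part[OF Fi] by (simp add: P_def)
    qed
    have "\<tau> (E (\<Union>i. F i)) = (SUP n. \<tau> (P n))"
    proof (rule normal_trace_LIMSEQ[OF normal])
      have eq: "x \<bullet> P n x = (\<Sum>i<n. x \<bullet> E (F i) x)" for n x
        by (simp add: P_def blinfun.sum_left inner_sum_right)
      show "incseq (\<lambda>n. x \<bullet> P n x)" for x
        by (rule incseq_SucI) (simp add: eq E.inner_nonneg Fi)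
      show "(\<lambda>n. x \<bullet> P n x) \<longlonglongrightarrow> x \<bullet> E (\<Union>i. F i) x" for x
        unfolding eq sums_def[symmetric]
        by (intro bounded_linear.sums[OF bounded_linear_inner_right] E.sums F Fb)
      show "E (\<Union>i. F i) \<in> pos_part N" using Fi by (intro E_pos_part) auto
    qed (use pos in auto)
    then show "(\<Sum>i. \<tau> (E (F i))) = \<tau> (E (\<Union>i. F i))"
      using pos by (simp add: suminf_eq_SUP)
  qed
qed (use assms in auto)

text \<open>The operator is built along with its trace by induction over nonnegative Borel
  functions. The bound \<open>G\<close> gives the form bound for strong convergence of increasing
  sequences; \<open>commuting\<close> keeps every operator of the induction in \<open>N\<close>,
  where the trace is additive and normal.\<close>

lemma bounded_calculus_ex:
  assumes "f \<in> borel_measurable borel" "\<And>t. 0 \<le> f t" "\<And>t. f t \<le> G"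
  shows "\<exists>P. positive_op P \<and> commuting P \<and> is_spectral_integral E f P \<and>
    \<tau> P = (\<integral>\<^sup>+t. ennreal (f t) \<partial>trace_measure)"
  using assms
proof (induction f arbitrary: G rule: borel_measurable_induct_real)
  case (set B)
  then have B: "B \<in> sets borel" by simp
  have "is_spectral_integral E (indicator B) (E B)"
    using B by (intro is_spectral_integralI E.bounded_ops E.symmetric)
      (auto simp: E.measure_vector_measure E.emeasure_vector_measure integrable_indicator_iff)
  moreover have "\<tau> (E B) = (\<integral>\<^sup>+t. ennreal (indicator B t) \<partial>trace_measure)"
    using B by (simp add: emeasure_trace_measure ennreal_indicator)
  ultimately show ?case using B commuting_E E.positive by blast
next
  case (mult u c)
  show ?case
  \<comment> \<open>For \<open>c = 0\<close> the bound on the product says nothing about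
    \<open>u\<close>, so the induction hypothesis is out of reach.\<close>
  proof (cases "c = 0")
    case True
    have "is_spectral_integral E (\<lambda>t. 0) 0" by (intro is_spectral_integralI) auto
    then show ?thesis
      using True by (intro exI[of _ 0]) (auto simp: positive_op_def commuting_def)
  next
    case False
    then have c: "0 < c" using mult by simp
    have "u x \<le> G / c" for x using mult.prems[of x] c by (simp add: field_simps)
    from mult.IH[OF this] obtain P where P: "positive_op P" "commuting P" "is_spectral_integral E u P"
      "\<tau> P = (\<integral>\<^sup>+t. ennreal (u t) \<partial>trace_measure)" by blast
    have "positive_op (c *\<^sub>R P)" using P(1) c by (auto simp: positive_op_def blinfun.scaleR_left)
    moreover have "commuting (c *\<^sub>R P)"
      using P(2) by (simp add: commuting_def blinfun.scaleR_left blinfun.scaleR_right)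
    moreover have "is_spectral_integral E (\<lambda>t. c * u t) (c *\<^sub>R P)"
      using is_spectral_integralD[OF P(3)] by (intro is_spectral_integralI) (auto simp: blinfun.scaleR_left)
    moreover have "\<tau> (c *\<^sub>R P) = (\<integral>\<^sup>+t. ennreal (c * u t) \<partial>trace_measure)"
      using c P mult by (simp add: trace_scaleR commuting_pos_part ennreal_mult nn_integral_cmult)
    ultimately show ?thesis by blast
  qed
next
  case (add u v)
  have "u x \<le> G" "v x \<le> G" for x
    using add.prems[of x] add.hyps(2)[of x] add.hyps(4)[of x] by linarith+
  from add.IH(1)[OF this(1)] add.IH(2)[OF this(2)]
  obtain P Q where P: "positive_op P" "commuting P" "is_spectral_integral E u P"
      "\<tau> P = (\<integral>\<^sup>+t. ennreal (u t) \<partial>trace_measure)"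
    and Q: "positive_op Q" "commuting Q" "is_spectral_integral E v Q"
      "\<tau> Q = (\<integral>\<^sup>+t. ennreal (v t) \<partial>trace_measure)" by blast
  have "positive_op (Q + P)" using P(1) Q(1) by (auto simp: positive_op_def blinfun.add_left inner_add_right)
  moreover have "commuting (Q + P)"
    using P(2) Q(2) by (simp add: commuting_def blinfun.add_left blinfun.add_right)
  moreover have "is_spectral_integral E (\<lambda>t. v t + u t) (Q + P)"
    using is_spectral_integralD[OF P(3)] is_spectral_integralD[OF Q(3)]
    by (intro is_spectral_integralI) (auto simp: blinfun.add_left inner_add_right)
  moreover have "\<tau> (Q + P) = (\<integral>\<^sup>+t. ennreal (v t + u t) \<partial>trace_measure)"
    using P Q add.hyps by (simp add: trace_add commuting_pos_part nn_integral_add)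
  ultimately show ?case by blast
next
  case (seq U)
  note lim = seq.hyps(4)[simplified]
  have Ule: "U i x \<le> f x" for i x
    using incseq_le[OF _ lim[of x]] seq.hyps(3) by (auto simp: incseq_def le_fun_def)
  then have UG: "U i x \<le> G" for i x using seq.prems order_trans by blast
  have "\<exists>P. positive_op P \<and> commuting P \<and> is_spectral_integral E (U i) P \<and>
      \<tau> P = (\<integral>\<^sup>+t. ennreal (U i t) \<partial>trace_measure)" for i
    by (rule seq.IH[OF UG])
  then obtain P where P: "\<And>i. positive_op (P i)" "\<And>i. commuting (P i)"
    "\<And>i. is_spectral_integral E (U i) (P i)" "\<And>i. \<tau> (P i) = (\<integral>\<^sup>+t. ennreal (U i t) \<partial>trace_measure)"
    by metis
  have Um[measurable]: "U i \<in> borel_measurable borel" for i using seq.hyps(1) by simp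
  have fm[measurable]: "f \<in> borel_measurable borel" by (rule borel_measurable_LIMSEQ_real[OF lim]) auto
  have f0: "0 \<le> f x" for x using Ule[of 0 x] seq.hyps(2)[of 0 x] by linarith
  have inc: "incseq (\<lambda>n. x \<bullet> P n x)" for x
  proof (rule incseq_SucI)
    show "x \<bullet> P n x \<le> x \<bullet> P (Suc n) x" for n
      unfolding is_spectral_integralD(3)[OF P(3)]
      by (intro integral_mono is_spectral_integralD(2)[OF P(3)])
        (use seq.hyps(3) in \<open>auto simp: incseq_Suc_iff le_fun_def\<close>)
  qed
  have intf: "integrable (vector_measure E x) f" for x
    by (rule finite_measure.integrable_const_bound[OF E.finite_vector_measure, where B = G])
      (use seq.prems f0 in auto)
  have conv: "(\<lambda>n. x \<bullet> P n x) \<longlonglongrightarrow> (\<integral>t. f t \<partial>vector_measure E x)" for x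
    unfolding is_spectral_integralD(3)[OF P(3)]
    by (rule integral_dominated_convergence[OF _ _ intf]) (use lim Ule seq.hyps(2) in auto)
  have bd: "x \<bullet> P n x \<le> G * (norm x)\<^sup>2" for n x
  proof -
    interpret finite_measure "vector_measure E x" by (rule E.finite_vector_measure)
    have "x \<bullet> P n x \<le> (\<integral>t. G \<partial>vector_measure E x)"
      unfolding is_spectral_integralD(3)[OF P(3)]
      by (intro integral_mono is_spectral_integralD(2)[OF P(3)]) (use UG in auto)
    then show ?thesis by (simp add: E.measure_vector_measure power2_norm_eq_inner mult.commute)
  qed
  obtain Q where Q: "symmetric_op Q" "\<And>x. (\<lambda>n. P n x) \<longlonglongrightarrow> Q x"
    by (rule monotone_symmetric_ops_converge[of P G])
      (use P(1) inc bd in \<open>auto simp: positive_op_def incseq_Suc_iff intro: that\<close>)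
  have Qint: "x \<bullet> Q x = (\<integral>t. f t \<partial>vector_measure E x)" for x
    using LIMSEQ_unique[OF tendsto_inner[OF tendsto_const Q(2)] conv] by blast
  have Qpos: "positive_op Q"
    using Q(1) f0 by (simp add: positive_op_def Qint)
  have Qcomm: "commuting Q"
    unfolding commuting_def
  proof (intro allI impI)
    fix C :: "'a \<Rightarrow>\<^sub>L 'a" and x assume C: "\<forall>x. C (T x) = T (C x)"
    have "(\<lambda>n. C (P n x)) \<longlonglongrightarrow> C (Q x)" by (intro tendsto_intros Q)
    moreover have "(\<lambda>n. C (P n x)) \<longlonglongrightarrow> Q (C x)"
      using Q(2)[of "C x"] P(2) C by (simp add: commuting_def)
    ultimately show "C (Q x) = Q (C x)" by (rule LIMSEQ_unique)
  qed
  have QN: "Q \<in> pos_part N" by (rule commuting_pos_part[OF Qcomm Qpos])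
  have "\<tau> Q = (SUP n. \<tau> (P n))"
    by (rule normal_trace_LIMSEQ[OF normal]) (use P QN inc conv Qint in \<open>auto intro: commuting_pos_part\<close>)
  also have "\<dots> = (\<integral>\<^sup>+t. (SUP n. ennreal (U n t)) \<partial>trace_measure)"
    unfolding P(4)
    by (rule nn_integral_monotone_convergence_SUP[symmetric])
      (use seq.hyps(3) in \<open>auto simp: incseq_def le_fun_def intro!: ennreal_leI\<close>)
  also have "\<dots> = (\<integral>\<^sup>+t. ennreal (f t) \<partial>trace_measure)"
  proof (rule nn_integral_cong)
    fix t
    have "incseq (\<lambda>n. ennreal (U n t))"
      using seq.hyps(3) by (auto simp: incseq_def le_fun_def intro!: ennreal_leI)
    from LIMSEQ_unique[OF LIMSEQ_SUP[OF this] tendsto_ennrealI[OF lim[of t]]]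
    show "(SUP n. ennreal (U n t)) = ennreal (f t)" .
  qed
  finally have "\<tau> Q = (\<integral>\<^sup>+t. ennreal (f t) \<partial>trace_measure)" .
  moreover have "is_spectral_integral E f Q"
    using QN Q(1) Qint intf by (intro is_spectral_integralI) (auto simp: pos_part_def op_pos_iff)
  ultimately show ?case using Qpos Qcomm by blast
qed

lemma AE_E: "AE t in vector_measure E x. t \<in> {0..norm T + 1}"
  by (rule AE_vector_measure_spectral[OF T_pos])

lemma AE_trace_measure: "AE t in trace_measure. t \<in> {0..norm T + 1}"
proof -
  have "emeasure trace_measure (- {0..norm T + 1}) = 0"
    using spectral_measure_outside[OF T_pos, of "- {0..norm T + 1}"] by (simp add: emeasure_trace_measure)
  then have "AE t in trace_measure. t \<notin> - {0..norm T + 1}" by (intro AE_not_in) (auto simp: null_sets_def)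
  then show ?thesis by simp
qed

lemma AE_trace_measureI: "(\<And>t. t \<in> {0..norm T + 1} \<Longrightarrow> Pr t) \<Longrightarrow> AE t in trace_measure. Pr t"
  using AE_trace_measure by eventually_elim

lemma
  assumes f: "f \<in> borel_measurable borel" and b: "\<And>t. t \<in> {0..norm T + 1} \<Longrightarrow> 0 \<le> f t \<and> f t \<le> G"
  shows functional_calculus_pos: "op_pos (functional_calculus f T)"
    and spectral_integral_functional_calculus: "is_spectral_integral E f (functional_calculus f T)"
    and trace_functional_calculus: "\<tau> (functional_calculus f T) = (\<integral>\<^sup>+t. ennreal (f t) \<partial>trace_measure)"
proof -
  \<comment> \<open>\<open>f\<close> is constrained only on an interval carrying the spectrum;
    cutting it off there makes it nonnegative and bounded everywhere and changes it only on null
    sets.\<close>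
  define g where "g = (\<lambda>t. f t * indicator {0..norm T + 1} t)"
  have g: "g \<in> borel_measurable borel" unfolding g_def using f by measurable
  have "0 \<le> g t" "g t \<le> max G 0" for t using b[of t] by (auto simp: g_def indicator_def)
  from bounded_calculus_ex[OF g this] obtain P where P: "positive_op P" "commuting P"
    "is_spectral_integral E g P" "\<tau> P = (\<integral>\<^sup>+t. ennreal (g t) \<partial>trace_measure)" by blast
  have fP: "is_spectral_integral E f P"
    using P(3)
  proof (rule is_spectral_integral_cong_AE[OF E.pvm_axioms g f, THEN iffD1, rotated])
    show "AE t in vector_measure E x. g t = f t" for x
      using AE_E by eventually_elim (simp add: g_def)
  qed
  then have eq: "functional_calculus f T = P"
    unfolding functional_calculus_def by (intro the_equality) (auto intro: is_spectral_integral_unique)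
  show "op_pos (functional_calculus f T)"
    using commuting_pos_part[OF P(2,1)] by (simp add: eq pos_part_def)
  show "is_spectral_integral E f (functional_calculus f T)" using fP by (simp add: eq)
  have "(\<integral>\<^sup>+t. ennreal (g t) \<partial>trace_measure) = (\<integral>\<^sup>+t. ennreal (f t) \<partial>trace_measure)"
    by (intro nn_integral_cong_AE AE_trace_measureI) (simp add: g_def)
  then show "\<tau> (functional_calculus f T) = (\<integral>\<^sup>+t. ennreal (f t) \<partial>trace_measure)"
    by (simp add: eq P(4))
qed

text \<open>The law of \<open>T\<^sup>p\<close> under the trace, restricted to \<open>(0,\<infinity>)\<close> because \<open>\<tau> (E {0})\<close> may be infinite.\<close>

definition power_law :: "real \<Rightarrow> real measure"
  where "power_law p = distr (density trace_measure (indicator {0<..})) borel (\<lambda>t. t powr p)"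

lemma sets_power_law [simp, measurable_cong]: "sets (power_law p) = sets borel"
  by (simp add: power_law_def)

lemma nn_integral_power_law:
  assumes [measurable]: "g \<in> borel_measurable borel"
  shows "(\<integral>\<^sup>+y. g y \<partial>power_law p) = (\<integral>\<^sup>+t. g (t powr p) * indicator {0<..} t \<partial>trace_measure)"
  unfolding power_law_def
  by (subst nn_integral_distr, simp_all) (subst nn_integral_density, auto simp: mult.commute)

lemma AE_power_law:
  assumes "0 < p"
  shows "AE y in power_law p. 0 < y \<and> y \<le> (norm T + 1) powr p"
proof -
  have "AE t in density trace_measure (indicator {0<..}). 0 < t powr p \<and> t powr p \<le> (norm T + 1) powr p"
    using assms
    by (subst AE_density, measurable) (intro AE_trace_measureI, auto intro!: powr_mono2 simp: indicator_def)
  then show ?thesis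
    unfolding power_law_def by (subst AE_distr_iff) auto
qed

text \<open>The point 0 may be discarded because \<open>0 powr s = 0\<close>; on (0,oo),
  \<open>t powr s\<close> is the power \<open>s / p\<close> of \<open>t powr p\<close>.\<close>

lemma trace_op_powr:
  assumes "0 < s" "0 < p"
  shows "\<tau> (op_powr T s) = (\<integral>\<^sup>+y. ennreal (y powr (s / p)) \<partial>power_law p)"
proof -
  have "\<tau> (op_powr T s) = (\<integral>\<^sup>+t. ennreal (t powr s) \<partial>trace_measure)"
    unfolding op_powr_def
    by (rule trace_functional_calculus[where G = "(norm T + 1) powr s"])
      (use assms in \<open>auto intro!: powr_mono2\<close>)
  also have "\<dots> = (\<integral>\<^sup>+t. ennreal ((t powr p) powr (s / p)) * indicator {0<..} t \<partial>trace_measure)"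
    using assms by (intro nn_integral_cong_AE AE_trace_measureI) (auto simp: powr_powr indicator_def)
  finally show ?thesis by (simp add: nn_integral_power_law)
qed

lemma trace_heat_op:
  assumes "0 < p" "0 < q" "0 \<le> u"
  shows "\<tau> (heat_op T q u) = (\<integral>\<^sup>+y. ennreal (exp (- u * y powr (- q / p))) \<partial>power_law p)"
proof -
  have "\<tau> (heat_op T q u) = (\<integral>\<^sup>+t. ennreal (if t > 0 then exp (- u * t powr (- q)) else 0) \<partial>trace_measure)"
    unfolding heat_op_def
    by (rule trace_functional_calculus[where G = 1]) (use assms in auto)
  also have "\<dots> = (\<integral>\<^sup>+t. ennreal (exp (- u * (t powr p) powr (- q / p))) * indicator {0<..} t \<partial>trace_measure)"
    by (rule nn_integral_cong) (use assms in \<open>auto simp: powr_powr indicator_def\<close>)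
  finally show ?thesis by (simp add: nn_integral_power_law)
qed

text \<open>For levels \<open>s \<ge> 0\<close> the set where \<open>x powr p\<close> exceeds
  \<open>s\<close> does not contain 0, so the law restricted to (0,oo) has the same tails as the
  spectral measure of \<open>op_powr T p\<close>.\<close>

lemma singular_number_op_powr:
  assumes "0 < p"
  shows "singular_number \<tau> (op_powr T p) t = Inf {s. 0 \<le> s \<and> emeasure (power_law p) {s<..} \<le> ennreal t}"
proof -
  have pos: "op_pos (op_powr T p)" and int: "is_spectral_integral E (\<lambda>x. x powr p) (op_powr T p)"
    unfolding op_powr_def
    by (rule functional_calculus_pos[where G = "(norm T + 1) powr p"] spectral_integral_functional_calculus[where G = "(norm T + 1) powr p"];
        use assms in \<open>auto intro!: powr_mono2\<close>)+
  have sm: "spectral_measure (op_powr T p) = pvm_image (\<lambda>x. x powr p) E"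
    by (rule spectral_measure_spectral_integral[OF T_pos pos _ int]) simp
  have "\<tau> (spectral_measure (op_abs (op_powr T p)) {s<..}) = emeasure (power_law p) {s<..}" if "0 \<le> s" for s
  proof -
    have "(\<lambda>x::real. x powr p) -` {s<..} \<in> sets borel"
      using measurable_sets[of "\<lambda>x::real. x powr p" borel borel "{s<..}"] by simp
    then have "\<tau> (spectral_measure (op_abs (op_powr T p)) {s<..})
        = (\<integral>\<^sup>+t. indicator ((\<lambda>x::real. x powr p) -` {s<..}) t \<partial>trace_measure)"
      by (simp add: op_abs_positive[OF pos] sm pvm_image_def emeasure_trace_measure)
    also have "\<dots> = (\<integral>\<^sup>+t. indicator {s<..} (t powr p) * indicator {0<..} t \<partial>trace_measure)"
    proof (intro nn_integral_cong_AE AE_trace_measureI)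
      show "indicator ((\<lambda>x. x powr p) -` {s<..}) t = (indicator {s<..} (t powr p) * indicator {0<..} t :: ennreal)"
        if "t \<in> {0..norm T + 1}" for t
        using that \<open>0 \<le> s\<close> by (cases "t = 0") (auto simp: indicator_def)
    qed
    also have "\<dots> = emeasure (power_law p) {s<..}"
      by (subst nn_integral_power_law[symmetric]) auto
    finally show ?thesis .
  qed
  then have "{s. 0 \<le> s \<and> \<tau> (spectral_measure (op_abs (op_powr T p)) {s<..}) \<le> ennreal t}
      = {s. 0 \<le> s \<and> emeasure (power_law p) {s<..} \<le> ennreal t}" by auto
  then show ?thesis by (simp add: singular_number_def)
qed

end

section \<open>Power-invariant means and cut-off moments\<close>

text \<open>Functions on which a state concentrated at infinity has a well-defined value. Borel
  measurability on the whole line ensures that late truncations lie in \<open>Linf\<close>.\<close>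

definition tail_bounded :: "(real \<Rightarrow> real) \<Rightarrow> bool"
  where "tail_bounded f \<longleftrightarrow> f \<in> borel_measurable borel \<and> (\<exists>B. \<forall>\<^sub>F t in at_top. \<bar>f t\<bar> \<le> B)"

lemma tail_boundedI: "f \<in> borel_measurable borel \<Longrightarrow> \<forall>\<^sub>F t in at_top. \<bar>f t\<bar> \<le> B \<Longrightarrow> tail_bounded f"
  by (auto simp: tail_bounded_def)

lemma tail_bounded_const [simp]: "tail_bounded (\<lambda>_. c)"
  by (rule tail_boundedI[of _ "\<bar>c\<bar>"]) auto

lemma tail_bounded_add:
  assumes "tail_bounded f" "tail_bounded g" shows "tail_bounded (\<lambda>t. f t + g t)"
proof -
  obtain B C where "\<forall>\<^sub>F t in at_top. \<bar>f t\<bar> \<le> B" "\<forall>\<^sub>F t in at_top. \<bar>g t\<bar> \<le> C"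
    using assms by (auto simp: tail_bounded_def)
  then have "\<forall>\<^sub>F t in at_top. \<bar>f t + g t\<bar> \<le> B + C"
    by eventually_elim linarith
  then show ?thesis using assms by (auto simp: tail_bounded_def)
qed

lemma tail_bounded_cmult:
  assumes "tail_bounded f" shows "tail_bounded (\<lambda>t. c * f t)"
proof -
  obtain B where "\<forall>\<^sub>F t in at_top. \<bar>f t\<bar> \<le> B" using assms by (auto simp: tail_bounded_def)
  then have "\<forall>\<^sub>F t in at_top. \<bar>c * f t\<bar> \<le> \<bar>c\<bar> * B"
    by eventually_elim (simp add: abs_mult mult_left_mono)
  then show ?thesis using assms by (auto simp: tail_bounded_def)
qed

lemma tail_bounded_powr:
  assumes "tail_bounded f" "0 < a" shows "tail_bounded (\<lambda>t. f (t powr a))"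
proof -
  obtain B where B: "\<forall>\<^sub>F t in at_top. \<bar>f t\<bar> \<le> B" and [measurable]: "f \<in> borel_measurable borel"
    using assms by (auto simp: tail_bounded_def)
  have "filterlim (\<lambda>t::real. t powr a) at_top at_top" using assms(2) by real_asymp
  then have "\<forall>\<^sub>F t in at_top. \<bar>f (t powr a)\<bar> \<le> B" using B by (rule eventually_compose_filterlim[rotated])
  then show ?thesis by (rule tail_boundedI[rotated]) measurable
qed

lemma tail_bounded_tendsto:
  assumes "f \<in> borel_measurable borel" "(f \<longlongrightarrow> l) at_top" shows "tail_bounded f"
proof (rule tail_boundedI[OF assms(1)])
  have "\<forall>\<^sub>F t in at_top. dist (f t) l < 1" using assms(2) by (rule tendstoD) simp
  then show "\<forall>\<^sub>F t in at_top. \<bar>f t\<bar> \<le> \<bar>l\<bar> + 1"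
    by eventually_elim (simp add: dist_real_def)
qed

lemma tail_bounded_sum:
  "(\<And>i. i \<in> I \<Longrightarrow> tail_bounded (f i)) \<Longrightarrow> tail_bounded (\<lambda>t. \<Sum>i\<in>I. f i t)"
  by (induction I rule: infinite_finite_induct) (auto intro: tail_bounded_add)

text \<open>Interface between the asymptotic estimates and the DPM state, free of truncations and
  complex values; \<open>DPM\<close> provides the instance.\<close>

locale power_mean =
  fixes L :: "(real \<Rightarrow> real) \<Rightarrow> real"
  assumes add: "tail_bounded f \<Longrightarrow> tail_bounded g \<Longrightarrow> L (\<lambda>t. f t + g t) = L f + L g"
    and cmult: "tail_bounded f \<Longrightarrow> L (\<lambda>t. c * f t) = c * L f"
    and mono: "tail_bounded f \<Longrightarrow> tail_bounded g \<Longrightarrow> \<forall>\<^sub>F t in at_top. f t \<le> g t \<Longrightarrow> L f \<le> L g"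
    and const: "L (\<lambda>_. c) = c"
    and powr: "tail_bounded f \<Longrightarrow> 0 < a \<Longrightarrow> L (\<lambda>t. f (t powr a)) = L f"
begin

lemma tendsto:
  assumes "f \<in> borel_measurable borel" "(f \<longlongrightarrow> l) at_top" shows "L f = l"
proof (rule antisym)
  note tb = tail_bounded_tendsto[OF assms]
  show "L f \<le> l"
  proof (rule field_le_epsilon)
    fix e :: real assume "0 < e"
    then have "\<forall>\<^sub>F t in at_top. dist (f t) l < e" using assms(2) by (rule tendstoD[rotated])
    then have "\<forall>\<^sub>F t in at_top. f t \<le> l + e" by eventually_elim (simp add: dist_real_def)
    from mono[OF tb tail_bounded_const this] show "L f \<le> l + e" by (simp add: const)
  qed
  show "l \<le> L f"
  proof (rule field_le_epsilon)
    fix e :: real assume "0 < e"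
    then have "\<forall>\<^sub>F t in at_top. dist (f t) l < e" using assms(2) by (rule tendstoD[rotated])
    then have "\<forall>\<^sub>F t in at_top. l - e \<le> f t" by eventually_elim (simp add: dist_real_def)
    from mono[OF tail_bounded_const tb this] show "l \<le> L f + e" by (simp add: const)
  qed
qed

lemma sum:
  "finite I \<Longrightarrow> (\<And>i. i \<in> I \<Longrightarrow> tail_bounded (f i)) \<Longrightarrow> L (\<lambda>t. \<Sum>i\<in>I. f i t) = (\<Sum>i\<in>I. L (f i))"
  by (induction I rule: finite_induct) (auto simp: const add tail_bounded_sum)

end

text \<open>Abstraction of \<open>power_law p\<close>: \<open>K\<close> bounds the spectrum of
  \<open>op_powr T p\<close>, and \<open>zeta_bound\<close> is what the condition defining
  \<open>Z_class\<close> gives for the exponent \<open>1 + e = s / p\<close>.\<close>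

locale dixmier_law =
  fixes m :: "real measure" and K e0 C :: real
  assumes sets_m [measurable_cong]: "sets m = sets borel"
    and AE_m: "AE y in m. 0 < y \<and> y \<le> K" and K: "1 \<le> K" and e0: "0 < e0" and C: "0 \<le> C"
    and zeta_bound: "0 < e \<Longrightarrow> e < e0 \<Longrightarrow>
      ennreal e * (\<integral>\<^sup>+y. ennreal (y powr (1 + e)) \<partial>m) \<le> ennreal C"
begin

lemma space_m [simp]: "space m = UNIV"
  using sets_eq_imp_space_eq[OF sets_m] by simp

lemma AE_mI: "(\<And>y. 0 < y \<Longrightarrow> y \<le> K \<Longrightarrow> Pr y) \<Longrightarrow> AE y in m. Pr y"
  using AE_m by eventually_elim simp

lemma measurable_m: "f \<in> borel_measurable borel \<Longrightarrow> f \<in> borel_measurable m"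
  by (simp add: measurable_cong_sets[OF sets_m refl])

lemma integrable_m_bound:
  fixes f g :: "real \<Rightarrow> real"
  assumes "integrable m g" "f \<in> borel_measurable borel" "\<And>y. 0 < y \<Longrightarrow> y \<le> K \<Longrightarrow> \<bar>f y\<bar> \<le> g y"
  shows "integrable m f"
  by (rule Bochner_Integration.integrable_bound[OF assms(1) measurable_m[OF assms(2)]])
    (intro AE_mI, use assms(3) in \<open>auto intro: order_trans[OF _ abs_ge_self]\<close>)

text \<open>\<open>zeta_bound\<close> covers only exponents close to 1; for larger ones the surplus
  power of \<open>y\<close> is bounded by a power of \<open>K\<close>.\<close>

lemma integrable_powr:
  assumes "0 < e" shows "integrable m (\<lambda>y. y powr (1 + e))"
proof -
  have small: "integrable m (\<lambda>y. y powr (1 + e))" if "0 < e" "e < e0" for e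
  proof (rule integrableI_nonneg)
    show "(\<integral>\<^sup>+y. ennreal (y powr (1 + e)) \<partial>m) < \<infinity>"
    proof (rule ccontr)
      assume "\<not> ?thesis"
      then have "ennreal e * (\<integral>\<^sup>+y. ennreal (y powr (1 + e)) \<partial>m) = \<infinity>"
        using that by (simp add: less_top[symmetric] ennreal_mult_top)
      then show False using zeta_bound[OF that] by (simp add: top_unique)
    qed
  qed (auto intro: measurable_m)
  show ?thesis
  proof (cases "e < e0")
    case False
    show ?thesis
    proof (rule integrable_m_bound)
      show "integrable m (\<lambda>y. K powr (e - e0 / 2) * y powr (1 + e0 / 2))"
        using small[of "e0 / 2"] e0 by simp
      fix y :: real assume y: "0 < y" "y \<le> K"
      have "y powr (1 + e) = y powr (e - e0 / 2) * y powr (1 + e0 / 2)"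
        by (simp add: powr_add[symmetric] add.commute)
      also have "\<dots> \<le> K powr (e - e0 / 2) * y powr (1 + e0 / 2)"
        using y False e0 by (intro mult_right_mono powr_mono2) auto
      finally show "\<bar>y powr (1 + e)\<bar> \<le> K powr (e - e0 / 2) * y powr (1 + e0 / 2)" by simp
    qed simp
  qed (use small assms in auto)
qed

lemma integral_powr_le:
  assumes "0 < e" "e < e0" shows "(\<integral>y. y powr (1 + e) \<partial>m) \<le> C / e"
proof -
  have "ennreal e * ennreal (\<integral>y. y powr (1 + e) \<partial>m) \<le> ennreal C"
    using zeta_bound[OF assms] nn_integral_eq_integral[OF integrable_powr[OF assms(1)]] by simp
  then have "e * (\<integral>y. y powr (1 + e) \<partial>m) \<le> C"
    using assms C by (simp add: ennreal_mult[symmetric] ennreal_le_iff)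
  then show ?thesis using assms by (simp add: field_simps)
qed

lemma integrable_cutoff:
  assumes "0 < b" shows "integrable m (\<lambda>y. y * indicator {b<..} y)"
proof (rule integrable_m_bound)
  show "integrable m (\<lambda>y. (1 / b) * y powr (1 + 1))" using integrable_powr[of 1] by simp
  show "\<bar>y * indicator {b<..} y\<bar> \<le> (1 / b) * y powr (1 + 1)" if "0 < y" "y \<le> K" for y
    using that assms by (auto simp: indicator_def field_simps power2_eq_square)
qed simp

text \<open>This is the function A of the overview. The value 0 for \<open>t \<le> 0\<close> makes
  it monotone, hence Borel, on the whole line.\<close>

definition cutoff_moment :: "real \<Rightarrow> real"
  where "cutoff_moment t = (if t > 0 then \<integral>y. y * indicator {1 / t<..} y \<partial>m else 0)"

lemma cutoff_moment_nonneg: "0 \<le> cutoff_moment t"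
  unfolding cutoff_moment_def by (auto intro!: integral_nonneg_AE AE_mI)

lemma cutoff_moment_mono: "s \<le> t \<Longrightarrow> cutoff_moment s \<le> cutoff_moment t"
proof (cases "s > 0")
  case True
  assume "s \<le> t"
  with True have "1 / t \<le> 1 / s" by (simp add: frac_le)
  then have "(\<integral>y. y * indicator {1 / s<..} y \<partial>m) \<le> (\<integral>y. y * indicator {1 / t<..} y \<partial>m)"
    using True \<open>s \<le> t\<close>
    by (intro integral_mono_AE integrable_cutoff AE_mI) (auto split: split_indicator)
  then show ?thesis using True \<open>s \<le> t\<close> by (simp add: cutoff_moment_def)
next
  case False
  then show ?thesis using cutoff_moment_nonneg[of t] by (simp add: cutoff_moment_def[of s])
qed

lemma measurable_cutoff_moment [measurable]: "cutoff_moment \<in> borel_measurable borel"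
  by (rule borel_measurable_mono) (simp add: mono_def cutoff_moment_mono)

lemma nn_integral_cutoff:
  assumes "0 < t"
  shows "(\<integral>\<^sup>+y. ennreal y * indicator {1 / t<..} y \<partial>m) = ennreal (cutoff_moment t)"
proof -
  have "(\<integral>\<^sup>+y. ennreal y * indicator {1 / t<..} y \<partial>m) = (\<integral>\<^sup>+y. ennreal (y * indicator {1 / t<..} y) \<partial>m)"
    by (intro nn_integral_cong) (auto simp: indicator_def)
  also have "\<dots> = ennreal (cutoff_moment t)"
    using assms unfolding cutoff_moment_def
    by (subst nn_integral_eq_integral) (auto intro!: integrable_cutoff AE_mI)
  finally show ?thesis .
qed

lemma cutoff_moment_le:
  assumes "1 < t" "1 / ln t < e0"
  shows "cutoff_moment t \<le> exp 1 * C * ln t"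
proof -
  have l: "0 < ln t" using assms by simp
  have "cutoff_moment t \<le> (\<integral>y. exp 1 * y powr (1 + 1 / ln t) \<partial>m)"
    unfolding cutoff_moment_def using assms l
  proof (simp only: if_True less_trans[OF zero_less_one assms(1)], intro integral_mono_AE AE_mI)
    show "integrable m (\<lambda>y. exp 1 * y powr (1 + 1 / ln t))" using l by (simp add: integrable_powr)
    fix y assume y: "0 < y" "y \<le> K"
    show "y * indicator {1 / t<..} y \<le> exp 1 * y powr (1 + 1 / ln t)"
    proof (cases "1 / t < y")
      case True
      \<comment> \<open>At the cut-off point \<open>y = 1 / t\<close> the extra power equals
        \<open>exp (- 1)\<close>, which is where the factor \<open>exp 1\<close> comes from.\<close>
      have "1 = exp (1 + (1 / ln t) * ln (1 / t))" using l assms by (simp add: ln_div)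
      also have "\<dots> \<le> exp (1 + (1 / ln t) * ln y)"
        using True l y assms by (intro iffD2[OF exp_le_cancel_iff] add_left_mono mult_left_mono) auto
      also have "\<dots> = exp 1 * y powr (1 / ln t)" using y by (simp add: exp_add powr_def)
      finally have "y * 1 \<le> y * (exp 1 * y powr (1 / ln t))" using y by (intro mult_left_mono) auto
      then show ?thesis using True y by (simp add: powr_add mult_ac)
    qed simp
  qed (use assms in \<open>auto intro: integrable_cutoff\<close>)
  also have "\<dots> \<le> exp 1 * (C / (1 / ln t))"
    using integral_powr_le[of "1 / ln t"] l assms by simp
  finally show ?thesis by simp
qed

lemma eventually_small_log: "\<forall>\<^sub>F t in at_top. 1 < t \<and> 1 \<le> ln t \<and> 1 / ln t < e0"
proof -
  have "((\<lambda>t::real. 1 / ln t) \<longlongrightarrow> 0) at_top" by real_asymp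
  then have "\<forall>\<^sub>F t in at_top. 1 / ln t < e0" using e0 by (rule order_tendstoD)
  moreover have "\<forall>\<^sub>F t::real in at_top. 1 \<le> ln t" by real_asymp
  ultimately show ?thesis using eventually_gt_at_top[of 1] by eventually_elim simp
qed

lemma tail_bounded_cutoff: "tail_bounded (\<lambda>t. cutoff_moment t / ln t)"
proof (rule tail_boundedI)
  show "\<forall>\<^sub>F t in at_top. \<bar>cutoff_moment t / ln t\<bar> \<le> exp 1 * C"
    using eventually_small_log
  proof eventually_elim
    case (elim t)
    then show ?case using cutoff_moment_le[of t] cutoff_moment_nonneg[of t] by (simp add: field_simps)
  qed
qed measurable

lemma tail_bounded_cutoff_powr:
  assumes "0 < c" shows "tail_bounded (\<lambda>t. cutoff_moment (t powr c) / ln t)"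
proof -
  have "tail_bounded (\<lambda>t. c * (cutoff_moment (t powr c) / ln (t powr c)))"
    by (intro tail_bounded_cmult tail_bounded_powr[OF tail_bounded_cutoff] assms)
  then show ?thesis using assms
    by (simp add: ln_powr)
qed

lemma emeasure_tail_finite:
  assumes "0 < b" shows "emeasure m {b<..} < \<infinity>"
proof -
  have "emeasure m {b<..} = (\<integral>\<^sup>+y. indicator {b<..} y \<partial>m)" by simp
  also have "\<dots> \<le> (\<integral>\<^sup>+y. ennreal ((1 / b) * (y * indicator {b<..} y)) \<partial>m)"
    using assms by (intro nn_integral_mono) (auto simp: indicator_def field_simps)
  also have "\<dots> < \<infinity>"
    using nn_integral_eq_integral[OF integrable_mult_right[OF integrable_cutoff[OF assms], of "1 / b"]] assms
    by (subst nn_integral_eq_integral) (auto intro!: AE_mI integrable_cutoff)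
  finally show ?thesis .
qed

text \<open>The law may have infinite mass near 0, but its tails away from 0 are finite and exhaust
  it. Fubini's theorem in the heat and layer-cake computations relies on this.\<close>

sublocale sigma_finite_measure m
proof
  have "emeasure m {..0} = 0"
  proof -
    have "AE y in m. y \<notin> {..0}" by (rule AE_mI) auto
    then show ?thesis by (subst AE_iff_measurable[symmetric, where P = "\<lambda>y. y \<notin> {..0}"]) (auto simp: sets_m)
  qed
  moreover have "emeasure m {1 / real (Suc n)<..} \<noteq> \<infinity>" for n
    using emeasure_tail_finite[of "1 / real (Suc n)"] by auto
  moreover have "{..0} \<union> (\<Union>n. {1 / real (Suc n)<..}) = (UNIV :: real set)"
  proof -
    have "x \<in> (\<Union>n. {1 / real (Suc n)<..})" if "0 < x" for x :: real
      using reals_Archimedean[OF that] by (auto simp: inverse_eq_divide)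
    then show ?thesis by (metis UNIV_eq_I UnI1 UnI2 atMost_iff not_le)
  qed
  ultimately show "\<exists>A. countable A \<and> A \<subseteq> sets m \<and> \<Union>A = space m \<and> (\<forall>a\<in>A. emeasure m a \<noteq> \<infinity>)"
    by (intro exI[of _ "insert {..0} (range (\<lambda>n. {1 / real (Suc n)<..}))"]) (auto simp: sets_m)
qed

end

locale dixmier_law_mean = dixmier_law + power_mean
begin

text \<open>\<open>ln (t powr c) = c * ln t\<close>, so up to the factor \<open>c\<close> the
  function arises from the case \<open>c = 1\<close> by a power substitution.\<close>

lemma mean_cutoff_powr:
  assumes "0 < c"
  shows "L (\<lambda>t. cutoff_moment (t powr c) / ln t) = c * L (\<lambda>t. cutoff_moment t / ln t)"
proof -
  have "L (\<lambda>t. cutoff_moment (t powr c) / ln t) = L (\<lambda>t. c * (cutoff_moment (t powr c) / ln (t powr c)))"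
    using assms by (simp add: ln_powr)
  also have "\<dots> = c * L (\<lambda>t. cutoff_moment (t powr c) / ln (t powr c))"
    by (intro cmult tail_bounded_powr[OF tail_bounded_cutoff] assms)
  also have "L (\<lambda>t. cutoff_moment (t powr c) / ln (t powr c)) = L (\<lambda>t. cutoff_moment t / ln t)"
    by (intro powr[OF tail_bounded_cutoff] assms)
  finally show ?thesis .
qed

lemma mean_div_ln: "L (\<lambda>t. b / ln t) = 0"
  by (rule tendsto) (measurable, real_asymp)

lemma tail_bounded_div_ln: "tail_bounded (\<lambda>t. b / ln t)"
  by (rule tail_bounded_tendsto[of _ 0]) (measurable, real_asymp)

end

section \<open>The zeta function\<close>

text \<open>The sum telescopes to \<open>exp (- d * j) - exp (- d * n)\<close> for \<open>x\<close>
  between \<open>d * j\<close> and \<open>d * (j + 1)\<close>, \<open>j < n\<close>; the right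
  endpoints in the indicators put it above the exponential.\<close>

lemma exp_step_upper:
  fixes x d :: real
  assumes "0 < d" "0 \<le> x"
  shows "exp (- x) - exp (- (d * real n)) \<le>
    (\<Sum>i<n. (exp (- (d * real i)) - exp (- (d * real (Suc i)))) * indicator {..<d * real (Suc i)} x)"
proof (induction n)
  case 0
  then show ?case using assms by simp
next
  case (Suc n)
  let ?S = "\<lambda>n. \<Sum>i<n. (exp (- (d * real i)) - exp (- (d * real (Suc i)))) * indicator {..<d * real (Suc i)} x"
  have c0: "0 \<le> exp (- (d * real i)) - exp (- (d * real (Suc i)))" for i using assms by simp
  show ?case
  proof (cases "x < d * real (Suc n)")
    case True
    then show ?thesis using Suc by simp
  next
    case False
    then have "exp (- x) - exp (- (d * real (Suc n))) \<le> 0" by simp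
    also have "0 \<le> ?S (Suc n)" by (intro sum_nonneg mult_nonneg_nonneg c0) auto
    finally show ?thesis .
  qed
qed

text \<open>With left endpoints the jump number \<open>j\<close> is left out, so that the value
  between \<open>d * j\<close> and \<open>d * (j + 1)\<close> is
  \<open>exp (- d * (j + 1)) - exp (- d * n)\<close>.\<close>

lemma exp_step_lower:
  fixes x d :: real
  assumes "0 < d"
  shows "(\<Sum>i<n. (exp (- (d * real i)) - exp (- (d * real (Suc i)))) * indicator {..<d * real i} x)
    \<le> max 0 (exp (- x) - exp (- (d * real n)))"
proof (induction n)
  case (Suc n)
  let ?c = "exp (- (d * real n)) - exp (- (d * real (Suc n)))"
  let ?R = "\<lambda>n. \<Sum>i<n. (exp (- (d * real i)) - exp (- (d * real (Suc i)))) * indicator {..<d * real i} x"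
  show ?case
  proof (cases "x < d * real n")
    case True
    then have "?R (Suc n) = ?R n + ?c" by (simp only: sum.lessThan_Suc) simp
    moreover have "?R n \<le> exp (- x) - exp (- (d * real n))"
      using Suc.IH True by (simp only: max_absorb2 diff_ge_0_iff_ge exp_le_cancel_iff neg_le_iff_le less_imp_le)
    ultimately show ?thesis by linarith
  next
    case False
    then have "?R (Suc n) = ?R n" by (simp only: sum.lessThan_Suc) simp
    also have "\<dots> \<le> 0" using Suc.IH False by (simp only: max_absorb1 diff_le_0_iff_le exp_le_cancel_iff neg_le_iff_le not_less)
    finally show ?thesis by simp
  qed
qed simp

text \<open>Summation by parts. The weights \<open>Suc i\<close> and \<open>i\<close> arise because
  the mean of \<open>cutoff_moment (t powr c) / ln t\<close> is proportional to \<open>c\<close>;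
  multiplied by \<open>d\<close>, the geometric sums are Riemann sums for the integral of
  \<open>exp (- x)\<close>, which is 1.\<close>

lemma exp_step_sum:
  fixes d :: real
  shows "(\<Sum>i<n. (exp (- (d * real i)) - exp (- (d * real (Suc i)))) * real (Suc i))
    = (\<Sum>i<n. exp (- d) ^ i) - real n * exp (- d) ^ n"
    and "(\<Sum>i<n. (exp (- (d * real i)) - exp (- (d * real (Suc i)))) * real i)
    = (\<Sum>i<n. exp (- d) ^ i) - real n * exp (- d) ^ n - (1 - exp (- d) ^ n)"
proof -
  have e: "exp (- (d * real i)) = exp (- d) ^ i" for i
    by (simp add: exp_of_nat_mult[symmetric] mult.commute)
  show "(\<Sum>i<n. (exp (- (d * real i)) - exp (- (d * real (Suc i)))) * real (Suc i))
    = (\<Sum>i<n. exp (- d) ^ i) - real n * exp (- d) ^ n"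
    unfolding e by (induction n) (auto simp: algebra_simps)
  show "(\<Sum>i<n. (exp (- (d * real i)) - exp (- (d * real (Suc i)))) * real i)
    = (\<Sum>i<n. exp (- d) ^ i) - real n * exp (- d) ^ n - (1 - exp (- d) ^ n)"
    unfolding e by (induction n) (auto simp: algebra_simps)
qed

context dixmier_law
begin

text \<open>With \<open>t = exp r\<close> this is \<open>1 / r\<close> times the zeta function of
  the law at \<open>1 + 1 / r\<close>, so \<omega> can evaluate it on the same scale as the other
  two functionals.\<close>

definition zeta_mean :: "real \<Rightarrow> real"
  where "zeta_mean t = (\<integral>y. y powr (1 + 1 / ln t) \<partial>m) / ln t"

lemma measurable_zeta_mean: "zeta_mean \<in> borel_measurable borel"
proof -
  have "(\<lambda>t. \<integral>y. y powr (1 + 1 / ln t) \<partial>m) \<in> borel_measurable borel"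
    by (rule borel_measurable_lebesgue_integral) measurable
  then show ?thesis unfolding zeta_mean_def[abs_def] by measurable
qed

lemma tail_bounded_zeta_mean: "tail_bounded zeta_mean"
proof (rule tail_boundedI[OF measurable_zeta_mean])
  show "\<forall>\<^sub>F t in at_top. \<bar>zeta_mean t\<bar> \<le> C"
    using eventually_small_log
  proof eventually_elim
    case (elim t)
    have "0 \<le> (\<integral>y. y powr (1 + 1 / ln t) \<partial>m)" by simp
    moreover have "(\<integral>y. y powr (1 + 1 / ln t) \<partial>m) \<le> C / (1 / ln t)"
      by (rule integral_powr_le) (use elim in auto)
    ultimately show ?case using elim by (simp add: zeta_mean_def field_simps)
  qed
qed

lemma cutoff_indicator_iff:
  fixes y t c :: real
  assumes "0 < y" "1 < t"
  shows "indicator {1 / (t powr c)<..} y = (indicator {..<c} (- ln y / ln t) :: real)"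
proof -
  have l: "0 < ln t" using assms by simp
  have "1 / (t powr c) < y \<longleftrightarrow> ln (1 / (t powr c)) < ln y" using assms by (subst ln_less_cancel_iff) auto
  also have "\<dots> \<longleftrightarrow> - ln y / ln t < c"
    using assms l by (auto simp: ln_div ln_powr field_simps)
  finally show ?thesis by (simp add: indicator_def)
qed

lemma powr_inverse_ln:
  fixes y t :: real
  assumes "0 < y" shows "y powr (1 + 1 / ln t) = y * exp (- (- ln y / ln t))"
  using assms by (simp add: powr_def distrib_right exp_add)

text \<open>\<open>y powr (1 + 1 / ln t)\<close> is \<open>y * exp (- x)\<close> with
  \<open>x = - ln y / ln t\<close>, and \<open>x < c\<close> means
  \<open>y > 1 / (t powr c)\<close>; so a step function in \<open>x\<close> becomes a sum of cut-off
  moments. Points \<open>y > 1\<close>, where \<open>x\<close> is negative, contribute at most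
  \<open>K * cutoff_moment 1\<close>.\<close>

lemma zeta_mean_upper:
  assumes d: "0 < d" and t: "1 \<le> ln t" "1 < t" "1 / ln t < e0"
  shows "zeta_mean t \<le> (\<Sum>i<n. (exp (- (d * real i)) - exp (- (d * real (Suc i)))) *
      (cutoff_moment (t powr (d * real (Suc i))) / ln t)) + (2 * C * exp (- (d * real n / 2)) + K * cutoff_moment 1 / ln t)"
proof -
  let ?c = "\<lambda>i. exp (- (d * real i)) - exp (- (d * real (Suc i)))"
  have l: "0 < ln t" using t by simp
  have c0: "0 \<le> ?c i" for i using d by simp
  have pt: "y powr (1 + 1 / ln t) \<le> (\<Sum>i<n. ?c i * (y * indicator {1 / (t powr (d * real (Suc i)))<..} y)) +
      (exp (- (d * real n / 2)) * y powr (1 + 1 / (2 * ln t)) + K * (y * indicator {1 / 1<..} y))"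
    if y: "0 < y" "y \<le> K" for y
  proof (cases "y \<le> 1")
    case True
    define x where "x = - ln y / ln t"
    define S where "S = (\<Sum>i<n. ?c i * indicator {..<d * real (Suc i)} x)"
    have "ln y \<le> 0" using True y by simp
    then have x: "0 \<le> x" using l by (simp add: x_def divide_nonpos_pos)
    have S0: "0 \<le> S" unfolding S_def by (intro sum_nonneg mult_nonneg_nonneg c0) auto
    \<comment> \<open>A constant error \<open>exp (- d * n)\<close> could not be integrated, as the
      integral of \<open>y\<close> may diverge. It is traded for half the decay in \<open>n\<close>
      and half the decay in \<open>x\<close>; the latter produces the zeta function at
      \<open>1 + 1 / (2 * ln t)\<close>, of order \<open>ln t\<close>.\<close>
    have "exp (- x) - S \<le> exp (- (d * real n / 2)) * exp (- x / 2)"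
    proof (cases "x \<le> d * real n")
      case True
      have "exp (- x) - S \<le> exp (- (d * real n))" using exp_step_upper[OF d x, of n] by (simp add: S_def)
      also have "\<dots> \<le> exp (- (d * real n / 2) + - x / 2)" using True by simp
      finally show ?thesis by (simp only: exp_add)
    next
      case False
      have "exp (- x) - S \<le> exp (- x)" using S0 by simp
      also have "\<dots> \<le> exp (- (d * real n / 2) + - x / 2)" using False by simp
      finally show ?thesis by (simp only: exp_add)
    qed
    then have "y * exp (- x) \<le> y * (S + exp (- (d * real n / 2)) * exp (- x / 2))"
      using y by (intro mult_left_mono) auto
    also have "\<dots> = y * S + exp (- (d * real n / 2)) * (y * exp (- x / 2))" by (simp add: algebra_simps)
    also have "y * S = (\<Sum>i<n. ?c i * (y * indicator {1 / (t powr (d * real (Suc i)))<..} y))"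
      unfolding S_def cutoff_indicator_iff[OF y(1) t(2)] x_def[symmetric]
      unfolding sum_distrib_left by (intro sum.cong refl) (simp only: mult_ac)
    also have "y * exp (- x / 2) = y powr (1 + 1 / (2 * ln t))"
    proof -
      have "(1 + 1 / (2 * ln t)) * ln y = ln y + - x / 2" by (simp add: x_def algebra_simps)
      then show ?thesis using y by (simp only: powr_def exp_add) simp
    qed
    also have "y * exp (- x) = y powr (1 + 1 / ln t)" using powr_inverse_ln[OF y(1)] by (simp add: x_def)
    finally show ?thesis using True by simp
  next
    case False
    have "y powr (1 / ln t) \<le> K powr (1 / ln t)" using y l by (intro powr_mono2) auto
    also have "\<dots> \<le> K powr 1" using K t by (intro powr_mono) (auto simp: divide_le_eq_1)
    finally have "y * y powr (1 / ln t) \<le> y * K" using y K by (intro mult_left_mono) auto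
    then have "y powr (1 + 1 / ln t) \<le> K * (y * indicator {1 / 1<..} y)"
      using False y by (simp add: powr_add mult.commute)
    moreover have "0 \<le> (\<Sum>i<n. ?c i * (y * indicator {1 / (t powr (d * real (Suc i)))<..} y))"
      using y by (intro sum_nonneg mult_nonneg_nonneg c0) auto
    ultimately show ?thesis by (simp add: add_increasing)
  qed
  have "(\<integral>y. y powr (1 + 1 / ln t) \<partial>m) \<le>
      (\<integral>y. (\<Sum>i<n. ?c i * (y * indicator {1 / (t powr (d * real (Suc i)))<..} y)) +
      (exp (- (d * real n / 2)) * y powr (1 + 1 / (2 * ln t)) + K * (y * indicator {1 / 1<..} y)) \<partial>m)"
    using l t by (intro integral_mono_AE AE_mI pt integrable_powr Bochner_Integration.integrable_add
        Bochner_Integration.integrable_sum integrable_mult_right integrable_cutoff) auto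
  also have "\<dots> = (\<Sum>i<n. ?c i * (\<integral>y. y * indicator {1 / (t powr (d * real (Suc i)))<..} y \<partial>m)) +
      (exp (- (d * real n / 2)) * (\<integral>y. y powr (1 + 1 / (2 * ln t)) \<partial>m) + K * (\<integral>y. y * indicator {1 / 1<..} y \<partial>m))"
    using l t
    by (subst Bochner_Integration.integral_add Bochner_Integration.integral_sum,
        (intro integrable_powr Bochner_Integration.integrable_add
        Bochner_Integration.integrable_sum integrable_mult_right integrable_cutoff; simp)+)+ simp
  also have "\<dots> = (\<Sum>i<n. ?c i * cutoff_moment (t powr (d * real (Suc i)))) +
      (exp (- (d * real n / 2)) * (\<integral>y. y powr (1 + 1 / (2 * ln t)) \<partial>m) + K * cutoff_moment 1)"
    using t by (simp add: cutoff_moment_def)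
  also have "\<dots> \<le> (\<Sum>i<n. ?c i * cutoff_moment (t powr (d * real (Suc i)))) +
      (exp (- (d * real n / 2)) * (C / (1 / (2 * ln t))) + K * cutoff_moment 1)"
  proof (intro add_left_mono add_right_mono mult_left_mono integral_powr_le)
    have "1 / (2 * ln t) \<le> 1 / ln t" using l by (simp add: field_simps)
    then show "1 / (2 * ln t) < e0" using t by linarith
  qed (use l in auto)
  finally have "zeta_mean t \<le> ((\<Sum>i<n. ?c i * cutoff_moment (t powr (d * real (Suc i)))) +
      (exp (- (d * real n / 2)) * (C / (1 / (2 * ln t))) + K * cutoff_moment 1)) / ln t"
    unfolding zeta_mean_def using l by (intro divide_right_mono) auto
  also have "\<dots> = (\<Sum>i<n. ?c i * (cutoff_moment (t powr (d * real (Suc i))) / ln t)) +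
     (2 * C * exp (- (d * real n / 2)) + K * cutoff_moment 1 / ln t)"
    using l by (simp add: add_divide_distrib sum_divide_distrib mult_ac)
  finally show ?thesis .
qed

text \<open>From below the truncation error has the right sign and is dropped. The summand
  \<open>i = 0\<close> involves \<open>t powr 0\<close> and is treated separately in
  \<open>mean_zeta\<close>.\<close>

lemma zeta_mean_lower:
  assumes d: "0 < d" and t: "1 < t"
  shows "(\<Sum>i<n. (exp (- (d * real i)) - exp (- (d * real (Suc i)))) *
      (cutoff_moment (t powr (d * real i)) / ln t)) \<le> zeta_mean t"
proof -
  let ?c = "\<lambda>i. exp (- (d * real i)) - exp (- (d * real (Suc i)))"
  have l: "0 < ln t" using t by simp
  have pt: "(\<Sum>i<n. ?c i * (y * indicator {1 / (t powr (d * real i))<..} y)) \<le> y powr (1 + 1 / ln t)"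
    if y: "0 < y" "y \<le> K" for y
  proof -
    define x where "x = - ln y / ln t"
    have "(\<Sum>i<n. ?c i * indicator {..<d * real i} x) \<le> exp (- x)"
      using exp_step_lower[OF d, of x n] by (rule order_trans) simp
    then have "y * (\<Sum>i<n. ?c i * indicator {..<d * real i} x) \<le> y * exp (- x)"
      using y by (intro mult_left_mono) auto
    also have "y * (\<Sum>i<n. ?c i * indicator {..<d * real i} x)
       = (\<Sum>i<n. ?c i * (y * indicator {1 / (t powr (d * real i))<..} y))"
      unfolding cutoff_indicator_iff[OF y(1) t] x_def[symmetric]
      unfolding sum_distrib_left by (intro sum.cong refl) (simp only: mult_ac)
    finally show ?thesis using powr_inverse_ln[OF y(1)] by (simp add: x_def)
  qed
  have int: "integrable m (\<lambda>y. ?c i * (y * indicator {1 / (t powr (d * real i))<..} y))" for i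
    using t by (intro integrable_mult_right integrable_cutoff) auto
  have "(\<Sum>i<n. ?c i * cutoff_moment (t powr (d * real i)))
      = (\<Sum>i<n. \<integral>y. ?c i * (y * indicator {1 / (t powr (d * real i))<..} y) \<partial>m)"
    using t by (simp add: cutoff_moment_def)
  also have "\<dots> = (\<integral>y. (\<Sum>i<n. ?c i * (y * indicator {1 / (t powr (d * real i))<..} y)) \<partial>m)"
    by (rule Bochner_Integration.integral_sum[symmetric]) (rule int)
  also have "\<dots> \<le> (\<integral>y. y powr (1 + 1 / ln t) \<partial>m)"
    using l by (intro integral_mono_AE AE_mI pt integrable_powr Bochner_Integration.integrable_sum int) auto
  finally have "(\<Sum>i<n. ?c i * cutoff_moment (t powr (d * real i))) / ln t \<le> zeta_mean t"
    unfolding zeta_mean_def using l by (intro divide_right_mono) auto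
  then show ?thesis by (simp add: sum_divide_distrib)
qed

end

context dixmier_law_mean
begin

text \<open>For a fixed mesh \<open>d\<close> the limit in \<open>n\<close> removes the truncation
  error. The bounds that remain are the claimed value times \<open>d / (1 - exp (- d))\<close> and
  times the same factor minus \<open>d\<close>; both factors tend to 1 as \<open>d\<close> tends to
  0.\<close>

lemma mean_zeta: "L zeta_mean = L (\<lambda>t. cutoff_moment t / ln t)"
proof (rule antisym)
  let ?c = "\<lambda>d i. exp (- (d * real i)) - exp (- (d * real (Suc i)))"
  let ?a = "L (\<lambda>t. cutoff_moment t / ln t)"
  have geo: "(\<lambda>n. \<Sum>i<n. exp (- d) ^ i) \<longlonglongrightarrow> 1 / (1 - exp (- d))" if "0 < d" for d :: real
    using geometric_sums[of "exp (- d)"] that by (simp add: sums_def)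
  have nr: "(\<lambda>n. real n * exp (- d) ^ n) \<longlonglongrightarrow> 0" "(\<lambda>n. exp (- d) ^ n) \<longlonglongrightarrow> 0" if "0 < d" for d :: real
  proof -
    have "norm (exp (- d)) < 1" using that by simp
    from powser_times_n_limit_0[OF this] show "(\<lambda>n. real n * exp (- d) ^ n) \<longlonglongrightarrow> 0" by simp
    show "(\<lambda>n. exp (- d) ^ n) \<longlonglongrightarrow> 0" using that by (intro LIMSEQ_realpow_zero) auto
  qed
  have upper: "L zeta_mean \<le> d / (1 - exp (- d)) * ?a" if d: "0 < d" for d
  proof -
    have "L zeta_mean \<le> d * ?a * ((\<Sum>i<n. exp (- d) ^ i) - real n * exp (- d) ^ n) + 2 * C * exp (- (d * real n / 2))" for n
    proof -
      have tb: "tail_bounded (\<lambda>t. ?c d i * (cutoff_moment (t powr (d * real (Suc i))) / ln t))" for i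
        using d by (intro tail_bounded_cmult tail_bounded_cutoff_powr) auto
      have "L zeta_mean \<le> L (\<lambda>t. (\<Sum>i<n. ?c d i * (cutoff_moment (t powr (d * real (Suc i))) / ln t)) +
          (2 * C * exp (- (d * real n / 2)) + K * cutoff_moment 1 / ln t))"
      proof (rule mono[OF tail_bounded_zeta_mean])
        show "\<forall>\<^sub>F t in at_top. zeta_mean t \<le> (\<Sum>i<n. ?c d i * (cutoff_moment (t powr (d * real (Suc i))) / ln t)) +
          (2 * C * exp (- (d * real n / 2)) + K * cutoff_moment 1 / ln t)"
          using eventually_small_log by eventually_elim (rule zeta_mean_upper[OF d]; simp)
      qed (intro tail_bounded_add tail_bounded_sum tb tail_bounded_const tail_bounded_div_ln)
      also have "\<dots> = (\<Sum>i<n. L (\<lambda>t. ?c d i * (cutoff_moment (t powr (d * real (Suc i))) / ln t)))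
          + (2 * C * exp (- (d * real n / 2)) + 0)"
        by (subst add, (intro tail_bounded_add tail_bounded_sum tb tail_bounded_const tail_bounded_div_ln)+)+
          (simp only: sum[OF finite_lessThan tb] const mean_div_ln)
      also have "(\<Sum>i<n. L (\<lambda>t. ?c d i * (cutoff_moment (t powr (d * real (Suc i))) / ln t)))
          = (\<Sum>i<n. d * ?a * (?c d i * real (Suc i)))"
      proof (rule sum.cong[OF refl])
        fix i
        show "L (\<lambda>t. ?c d i * (cutoff_moment (t powr (d * real (Suc i))) / ln t)) = d * ?a * (?c d i * real (Suc i))"
          using d by (subst cmult, intro tail_bounded_cutoff_powr) (auto simp: mean_cutoff_powr simp del: of_nat_Suc)
      qed
      finally show ?thesis by (simp only: sum_distrib_left[symmetric] exp_step_sum add_0_right)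
    qed
    moreover have "(\<lambda>n. d * ?a * ((\<Sum>i<n. exp (- d) ^ i) - real n * exp (- d) ^ n) + 2 * C * exp (- (d * real n / 2)))
        \<longlonglongrightarrow> d * ?a * (1 / (1 - exp (- d)) - 0) + 2 * C * 0"
    proof (intro tendsto_intros geo nr d)
      show "(\<lambda>n. exp (- (d * real n / 2))) \<longlonglongrightarrow> 0" using d by real_asymp
    qed
    ultimately have "L zeta_mean \<le> d * ?a * (1 / (1 - exp (- d)) - 0) + 2 * C * 0"
      by (intro LIMSEQ_le_const[of _ _ "L zeta_mean"]) auto
    then show ?thesis by (simp add: mult_ac)
  qed
  show "L zeta_mean \<le> ?a"
  proof (rule tendsto_lowerbound)
    have "((\<lambda>d::real. d / (1 - exp (- d))) \<longlongrightarrow> 1) (at_right 0)" by real_asymp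
    from tendsto_mult_right[OF this, of ?a]
    show "((\<lambda>d. d / (1 - exp (- d)) * ?a) \<longlongrightarrow> ?a) (at_right 0)" by simp
    show "\<forall>\<^sub>F d in at_right 0. L zeta_mean \<le> d / (1 - exp (- d)) * ?a"
      using eventually_at_right_less[of 0] by eventually_elim (rule upper)
  qed simp
  have lower: "d * ?a * (1 / (1 - exp (- d)) - 1) \<le> L zeta_mean" if d: "0 < d" for d
  proof -
    have "d * ?a * ((\<Sum>i<n. exp (- d) ^ i) - real n * exp (- d) ^ n - (1 - exp (- d) ^ n)) \<le> L zeta_mean" for n
    proof -
      have tb0: "tail_bounded (\<lambda>t. cutoff_moment (t powr (d * real i)) / ln t)"
        and L0: "L (\<lambda>t. cutoff_moment (t powr (d * real i)) / ln t) = d * real i * ?a" for i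
      proof -
        \<comment> \<open>For \<open>i = 0\<close> the exponent is 0 and power invariance does not
          apply; the function tends to 0, in agreement with the factor
          \<open>real i\<close>.\<close>
        have z: "tail_bounded (\<lambda>t. cutoff_moment (t powr 0) / ln t) \<and> L (\<lambda>t. cutoff_moment (t powr 0) / ln t) = 0"
        proof -
          have ev: "\<forall>\<^sub>F t::real in at_top. cutoff_moment (t powr 0) / ln t = cutoff_moment 1 / ln t"
            using eventually_gt_at_top[of 0] by eventually_elim simp
          have lim: "((\<lambda>t. cutoff_moment (t powr 0) / ln t) \<longlongrightarrow> 0) at_top"
            unfolding tendsto_cong[OF ev] by real_asymp
          have "(\<lambda>t. cutoff_moment (t powr 0) / ln t) \<in> borel_measurable borel" by measurable
          then show ?thesis using lim tail_bounded_tendsto tendsto by blast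
        qed
        show "tail_bounded (\<lambda>t. cutoff_moment (t powr (d * real i)) / ln t)"
          "L (\<lambda>t. cutoff_moment (t powr (d * real i)) / ln t) = d * real i * ?a"
          using z tail_bounded_cutoff_powr[of "d * real i"] mean_cutoff_powr[of "d * real i"] d
          by (cases "i = 0"; simp)+
      qed
      have tb: "tail_bounded (\<lambda>t. ?c d i * (cutoff_moment (t powr (d * real i)) / ln t))" for i
        by (intro tail_bounded_cmult tb0)
      have "(\<Sum>i<n. d * ?a * (?c d i * real i)) = L (\<lambda>t. \<Sum>i<n. ?c d i * (cutoff_moment (t powr (d * real i)) / ln t))"
        unfolding sum[OF finite_lessThan tb] cmult[OF tb0] L0
        by (intro sum.cong refl) (simp only: mult_ac)
      also have "\<dots> \<le> L zeta_mean"
      proof (rule mono[OF tail_bounded_sum[OF tb] tail_bounded_zeta_mean])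
        show "\<forall>\<^sub>F t in at_top. (\<Sum>i<n. ?c d i * (cutoff_moment (t powr (d * real i)) / ln t)) \<le> zeta_mean t"
          using eventually_gt_at_top[of 1] by eventually_elim (rule zeta_mean_lower[OF d])
      qed
      finally show ?thesis by (simp only: sum_distrib_left[symmetric] exp_step_sum)
    qed
    moreover have "(\<lambda>n. d * ?a * ((\<Sum>i<n. exp (- d) ^ i) - real n * exp (- d) ^ n - (1 - exp (- d) ^ n)))
        \<longlonglongrightarrow> d * ?a * (1 / (1 - exp (- d)) - 0 - (1 - 0))"
      by (intro tendsto_intros geo nr d)
    ultimately have "d * ?a * (1 / (1 - exp (- d)) - 0 - (1 - 0)) \<le> L zeta_mean"
      by (intro LIMSEQ_le_const2[of _ _ "L zeta_mean"]) auto
    then show ?thesis by simp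
  qed
  show "?a \<le> L zeta_mean"
  proof (rule tendsto_upperbound)
    have "((\<lambda>d::real. d * (1 / (1 - exp (- d)) - 1)) \<longlongrightarrow> 1) (at_right 0)" by real_asymp
    from tendsto_mult_right[OF this, of ?a]
    show "((\<lambda>d. d * ?a * (1 / (1 - exp (- d)) - 1)) \<longlongrightarrow> ?a) (at_right 0)" by (simp add: mult_ac)
    show "\<forall>\<^sub>F d in at_right 0. d * ?a * (1 / (1 - exp (- d)) - 1) \<le> L zeta_mean"
      using eventually_at_right_less[of 0] by eventually_elim (rule lower)
  qed simp
qed

end

section \<open>The heat function\<close>

lemma power_div_fact_le_exp:
  fixes z :: real assumes "0 \<le> z" shows "z ^ n / fact n \<le> exp z"
proof -
  have "(\<Sum>i\<in>{n}. z ^ i /\<^sub>R fact i) \<le> (\<Sum>i. z ^ i /\<^sub>R fact i)"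
    using assms by (intro sum_le_suminf sums_summable[OF exp_converges]) auto
  then show ?thesis using sums_unique[OF exp_converges[of z]] by (simp add: field_simps)
qed

text \<open>\<open>exp z \<ge> z ^ n / fact n\<close> at \<open>z = y powr - b\<close>, with
  \<open>n\<close> so large that \<open>b * n > 3\<close>. The cube leaves a square, and hence an
  integrable power, after division by \<open>y\<close> in
  \<open>heat_integral_upper\<close>.\<close>

lemma exp_neg_powr_le_power:
  fixes b :: real
  assumes "0 < b"
  obtains c where "0 \<le> c" "\<And>y. 0 < y \<Longrightarrow> y \<le> 1 \<Longrightarrow> exp (- (y powr - b)) \<le> c * y ^ 3"
proof -
  obtain n :: nat where n: "3 / b < real n" using reals_Archimedean2 by blast
  have "exp (- (y powr - b)) \<le> fact n * y ^ 3" if y: "0 < y" "y \<le> 1" for y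
  proof -
    define z where "z = y powr - b"
    have z: "0 < z" using y by (simp add: z_def)
    have "exp (- z) \<le> fact n / z ^ n"
      using power_div_fact_le_exp[of z n] z by (simp add: exp_minus field_simps)
    also have "1 / z ^ n = y powr (b * real n)"
    proof -
      have "z ^ n = z powr real n" using z by (simp add: powr_realpow)
      also have "\<dots> = y powr - (b * real n)" by (simp add: z_def powr_powr)
      finally show ?thesis by (simp add: powr_minus_divide)
    qed
    then have "fact n / z ^ n = fact n * y powr (b * real n)" by (metis divide_inverse inverse_eq_divide)
    also have "\<dots> \<le> fact n * y powr 3"
      using y n assms by (intro mult_left_mono powr_mono') (auto simp: field_simps)
    finally show ?thesis using y by (simp add: z_def)
  qed
  then show thesis using that[of "fact n"] by simp
qed

text \<open>The integrand of the logarithmic mean after the substitution \<open>v = s * y\<close>,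
  with \<open>a = q / p\<close>.\<close>

definition heat_profile :: "real \<Rightarrow> real \<Rightarrow> real"
  where "heat_profile a v = exp (- (v powr - a)) / v\<^sup>2"

lemma heat_profile_nonneg: "0 \<le> heat_profile a v"
  by (simp add: heat_profile_def)

lemma measurable_heat_profile [measurable]: "heat_profile a \<in> borel_measurable borel"
  unfolding heat_profile_def[abs_def] by measurable

text \<open>The substitution \<open>w = v powr - a\<close> leads to Euler's integral for
  \<open>Gamma (1 / a)\<close>, and the Jacobian leaves the factor \<open>1 / a\<close>.\<close>

lemma nn_integral_heat_profile:
  assumes a: "0 < a"
  shows "(\<integral>\<^sup>+v. ennreal (heat_profile a v) * indicator {0<..} v \<partial>lborel) = ennreal (1 / a * Gamma (1 / a))"
proof -
  define f :: "real \<Rightarrow> real" where "f w = w powr (1 / a - 1) / exp w" for w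
  define g where "g v = v powr - a" for v :: real
  define g' where "g' v = - a * v powr (- a - 1)" for v :: real
  have img: "g ` {0<..} = {0<..}"
  proof (intro equalityI subsetI)
    fix w :: real assume "w \<in> {0<..}"
    then have "w = g (w powr (- 1 / a))" "w powr (- 1 / a) \<in> {0<..}"
      using a by (auto simp: g_def powr_powr)
    then show "w \<in> g ` {0<..}" by blast
  qed (auto simp: g_def)
  have "(f has_integral Gamma (1 / a)) {0..}"
    unfolding f_def using Gamma_integral_real[of "1 / a"] a by simp
  then have G: "(f has_integral Gamma (1 / a)) {0<..}"
    by (rule has_integral_spike_set_eq[THEN iffD1, rotated -1])
      (rule negligible_subset[of "{0}"], auto)+
  then have "f absolutely_integrable_on {0<..}"
    by (intro nonnegative_absolutely_integrable_1) (auto simp: f_def)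
  with G have "f absolutely_integrable_on g ` {0<..} \<and> integral (g ` {0<..}) f = Gamma (1 / a)"
    unfolding img by (simp add: integral_unique)
  then have *: "(\<lambda>v. \<bar>g' v\<bar> * f (g v)) absolutely_integrable_on {0<..} \<and>
      integral {0<..} (\<lambda>v. \<bar>g' v\<bar> * f (g v)) = Gamma (1 / a)"
  proof (rule has_absolute_integral_change_of_variables_1'[where S = "{0<..}" and g = g and g' = g' and f = f, THEN iffD2, rotated -1])
    show "(g has_field_derivative g' v) (at v within {0<..})" if "v \<in> {0<..}" for v
      unfolding g_def g'_def using that by (auto intro!: derivative_eq_intros)
    show "inj_on g {0<..}"
    proof (rule inj_onI)
      fix u v assume "u \<in> {0<..}" "v \<in> {0<..}" "g u = g v"
      moreover from this have "(u powr - a) powr (- 1 / a) = (v powr - a) powr (- 1 / a)" by (simp add: g_def)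
      ultimately show "u = v" using a by (simp add: powr_powr)
    qed
  qed simp_all
  have eq: "\<bar>g' v\<bar> * f (g v) = a * heat_profile a v" if "0 < v" for v
  proof -
    have "v powr (- a - 1) * (v powr - a) powr (1 / a - 1) = v powr (- 2)"
    proof -
      have "- a - 1 + - a * (1 / a - 1) = -2" using a by (simp add: field_simps)
      then show ?thesis by (simp only: powr_powr powr_add[symmetric])
    qed
    moreover have "v powr (- 2) = 1 / v\<^sup>2" using that by (simp add: powr_minus_divide)
    ultimately show ?thesis
      using a that by (simp add: g'_def f_def g_def heat_profile_def abs_mult exp_minus field_simps)
  qed
  have "((\<lambda>v. \<bar>g' v\<bar> * f (g v)) has_integral Gamma (1 / a)) {0<..}"
    using * absolutely_integrable_on_def by (auto simp: has_integral_iff dest: set_lebesgue_integral_eq_integral)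
  then have "((\<lambda>v. a * heat_profile a v) has_integral Gamma (1 / a)) {0<..}"
    by (rule has_integral_cong[THEN iffD1, rotated]) (use eq in auto)
  from has_integral_mult_right[OF this, of "1 / a"] a
  have "(heat_profile a has_integral (1 / a * Gamma (1 / a))) {0<..}" by simp
  from nn_integral_has_integral_lebesgue'[OF _ this] show ?thesis by (simp add: heat_profile_nonneg)
qed

text \<open>Monotone convergence along the intervals from \<open>1 / (n + 1)\<close> to
  \<open>n + 1\<close>. A compact window can be fitted into \<open>{y..t * y}\<close> for all
  relevant \<open>y\<close> at once, which the lower bound for the heat integral exploits.\<close>

lemma heat_profile_truncation:
  assumes a: "0 < a" and \<theta>: "\<theta> < 1 / a * Gamma (1 / a)" "0 \<le> \<theta>"
  obtains \<eta> R where "0 < \<eta>" "0 < R"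
    "ennreal \<theta> \<le> (\<integral>\<^sup>+v. ennreal (heat_profile a v) * indicator {\<eta>..R} v \<partial>lborel)"
proof -
  define F where "F n v = ennreal (heat_profile a v) * indicator {1 / real (Suc n)..real (Suc n)} v" for n v
  have inc: "incseq F"
  proof (intro incseq_SucI le_funI)
    fix n v
    have "{1 / real (Suc n)..real (Suc n)} \<subseteq> {1 / real (Suc (Suc n))..real (Suc (Suc n))}"
      by (auto simp: frac_le intro: order_trans[of "1 / (2 + real n)" "1 / (1 + real n)"])
    then show "F n v \<le> F (Suc n) v"
      unfolding F_def by (intro mult_left_mono) (auto split: split_indicator)
  qed
  have sup: "(SUP n. F n v) = ennreal (heat_profile a v) * indicator {0<..} v" for v
  proof (cases "0 < v")
    case True
    obtain n1 where n1: "v \<le> real n1" using real_arch_simple by blast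
    obtain n2 where n2: "1 / real (Suc n2) < v" using reals_Archimedean[OF True] by (auto simp: inverse_eq_divide)
    define n where "n = max n1 n2"
    have "1 / real (Suc n) \<le> 1 / real (Suc n2)" by (intro divide_left_mono) (auto simp: n_def)
    then have "F n v = ennreal (heat_profile a v)" using n1 n2 by (auto simp: F_def n_def indicator_def)
    then have "ennreal (heat_profile a v) \<le> (SUP n. F n v)" by (metis SUP_upper UNIV_I)
    moreover have "(SUP n. F n v) \<le> ennreal (heat_profile a v)"
      by (rule SUP_least) (auto simp: F_def split: split_indicator)
    ultimately show ?thesis using True by simp
  next
    case False
    then have "F n v = 0" for n
    proof -
      have "0 < 1 / real (Suc n)" by simp
      then have "v \<notin> {1 / real (Suc n)..real (Suc n)}" using False unfolding atLeastAtMost_iff by linarith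
      then show ?thesis by (simp add: F_def)
    qed
    then show ?thesis using False by simp
  qed
  have "ennreal \<theta> < ennreal (1 / a * Gamma (1 / a))" using \<theta> by (simp add: ennreal_less_iff)
  also have "\<dots> = (\<integral>\<^sup>+v. (SUP n. F n v) \<partial>lborel)" unfolding sup nn_integral_heat_profile[OF a] ..
  also have "\<dots> = (SUP n. integral\<^sup>N lborel (F n))"
    by (rule nn_integral_monotone_convergence_SUP[OF inc]) (unfold F_def[abs_def], measurable)
  finally obtain n where "ennreal \<theta> < integral\<^sup>N lborel (F n)" by (auto simp: less_SUP_iff)
  then have "ennreal \<theta> \<le> (\<integral>\<^sup>+v. ennreal (heat_profile a v) * indicator {1 / real (Suc n)..real (Suc n)} v \<partial>lborel)"
    unfolding F_def[abs_def] by (rule less_imp_le)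
  then show thesis by (intro that[of "1 / real (Suc n)" "real (Suc n)"]) simp_all
qed

context dixmier_law
begin

text \<open>For \<open>a = q / p\<close> and \<open>y = x powr p\<close> with \<open>x\<close> in
  the spectrum of \<open>T\<close>, \<open>(s * y) powr - a\<close> is \<open>x powr - q\<close>
  times \<open>s powr (- q / p)\<close>; so this is the trace in the theorem.\<close>

definition heat :: "real \<Rightarrow> real \<Rightarrow> ennreal"
  where "heat a s = (\<integral>\<^sup>+y. ennreal (exp (- ((s * y) powr - a))) \<partial>m)"

text \<open>The logarithmic mean integrates \<open>heat a s / s\<close> against
  \<open>ds / s\<close>, whence the square. Values in [0,\<infinity>] allow Fubini's theorem before
  finiteness is known.\<close>

definition heat_integral :: "real \<Rightarrow> real \<Rightarrow> ennreal"
  where "heat_integral a t = (\<integral>\<^sup>+s. ennreal (1 / s\<^sup>2) * heat a s * indicator {1..t} s \<partial>lborel)"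

definition heat_kernel :: "real \<Rightarrow> real \<Rightarrow> real \<Rightarrow> ennreal"
  where "heat_kernel a t y = (\<integral>\<^sup>+s. ennreal (exp (- ((s * y) powr - a)) / s\<^sup>2) * indicator {1..t} s \<partial>lborel)"

lemma heat_integral_Fubini: "heat_integral a t = (\<integral>\<^sup>+y. heat_kernel a t y \<partial>m)"
proof -
  interpret pair_sigma_finite lborel m ..
  have "heat_integral a t = (\<integral>\<^sup>+s. (\<integral>\<^sup>+y. ennreal (exp (- ((s * y) powr - a)) / s\<^sup>2) * indicator {1..t} s \<partial>m) \<partial>lborel)"
    unfolding heat_integral_def heat_def
  proof (intro nn_integral_cong)
    fix s :: real
    have "(\<integral>\<^sup>+y. ennreal (exp (- ((s * y) powr - a)) / s\<^sup>2) * indicator {1..t} s \<partial>m)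
      = (\<integral>\<^sup>+y. (ennreal (1 / s\<^sup>2) * indicator {1..t} s) * ennreal (exp (- ((s * y) powr - a))) \<partial>m)"
      by (intro nn_integral_cong) (simp add: ennreal_mult[symmetric] mult_ac split: split_indicator)
    then show "ennreal (1 / s\<^sup>2) * (\<integral>\<^sup>+y. ennreal (exp (- ((s * y) powr - a))) \<partial>m) * indicator {1..t} s
      = (\<integral>\<^sup>+y. ennreal (exp (- ((s * y) powr - a)) / s\<^sup>2) * indicator {1..t} s \<partial>m)"
      by (simp add: nn_integral_cmult mult_ac)
  qed
  also have "\<dots> = (\<integral>\<^sup>+y. heat_kernel a t y \<partial>m)"
    unfolding heat_kernel_def by (rule Fubini'[symmetric]) measurable
  finally show ?thesis .
qed

text \<open>The substitution \<open>v = s * y\<close>. When \<open>y\<close> is small and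
  \<open>t * y\<close> is large, \<open>{y..t * y}\<close> nearly fills (0,oo) and the kernel is
  close to \<open>y\<close> times the full integral of the profile.\<close>

lemma heat_kernel_eq:
  assumes "0 < y"
  shows "heat_kernel a t y = ennreal y * (\<integral>\<^sup>+v. ennreal (heat_profile a v) * indicator {y..t * y} v \<partial>lborel)"
proof -
  have "(\<integral>\<^sup>+v. ennreal (heat_profile a v) * indicator {y..t * y} v \<partial>lborel)
     = ennreal y * (\<integral>\<^sup>+s. ennreal (heat_profile a (y * s)) * indicator {y..t * y} (y * s) \<partial>lborel)"
    using assms by (subst nn_integral_real_affine[where c = y and t = 0]) auto
  then have "ennreal y * (\<integral>\<^sup>+v. ennreal (heat_profile a v) * indicator {y..t * y} v \<partial>lborel)
     = (\<integral>\<^sup>+s. ennreal (y * y) * (ennreal (heat_profile a (y * s)) * indicator {y..t * y} (y * s)) \<partial>lborel)"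
    using assms by (simp add: nn_integral_cmult ennreal_mult mult.assoc)
  also have "\<dots> = heat_kernel a t y"
    unfolding heat_kernel_def
  proof (intro nn_integral_cong)
    fix s :: real
    have "indicator {y..t * y} (y * s) = (indicator {1..t} s :: ennreal)"
      using assms by (auto simp: indicator_def mult.commute)
    moreover have "y * y * heat_profile a (y * s) = exp (- ((s * y) powr - a)) / s\<^sup>2"
      using assms by (simp add: heat_profile_def power2_eq_square mult_ac)
    ultimately show "ennreal (y * y) * (ennreal (heat_profile a (y * s)) * indicator {y..t * y} (y * s))
      = ennreal (exp (- ((s * y) powr - a)) / s\<^sup>2) * indicator {1..t} s"
      using assms by (simp add: ennreal_mult[symmetric] heat_profile_nonneg mult.assoc[symmetric])
  qed
  finally show ?thesis by simp
qed

text \<open>Split at \<open>y = 1 / (t powr (1 + \<epsilon>))\<close>. Above, the full integral of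
  the profile bounds the kernel. Below, \<open>t * y\<close> is still small, so the exponential is
  at most a multiple of \<open>y ^ 3\<close>; an interval of length at most \<open>1 / y\<close>
  leaves \<open>y ^ 2\<close>, whose integral does not depend on \<open>t\<close>.\<close>

lemma heat_integral_upper:
  assumes a: "0 < a" and \<epsilon>: "0 < \<epsilon>"
  obtains B where "0 \<le> B" "\<And>t. 1 < t \<Longrightarrow>
    heat_integral a t \<le> ennreal (1 / a * Gamma (1 / a) * cutoff_moment (t powr (1 + \<epsilon>)) + B)"
proof -
  define G where "G = 1 / a * Gamma (1 / a)"
  have G: "0 \<le> G" unfolding G_def using a by (auto intro!: mult_nonneg_nonneg Gamma_real_nonneg)
  \<comment> \<open>The exponent comes from the bound
    \<open>t * y \<le> y powr (\<epsilon> / (1 + \<epsilon>))\<close> below, raised to the power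
    \<open>- a\<close>.\<close>
  obtain c where c: "0 \<le> c" "\<And>y. 0 < y \<Longrightarrow> y \<le> 1 \<Longrightarrow> exp (- (y powr - (a * (\<epsilon> / (1 + \<epsilon>))))) \<le> c * y ^ 3"
    using exp_neg_powr_le_power[of "a * (\<epsilon> / (1 + \<epsilon>))"] a \<epsilon> by auto
  define B where "B = c * (\<integral>y. y powr (1 + 1) \<partial>m)"
  have B: "0 \<le> B" unfolding B_def using c by simp
  have "heat_integral a t \<le> ennreal (G * cutoff_moment (t powr (1 + \<epsilon>)) + B)" if t: "1 < t" for t
  proof -
    let ?T = "t powr (1 + \<epsilon>)"
    have k: "heat_kernel a t y \<le> ennreal G * (ennreal y * indicator {1 / ?T<..} y) + ennreal (c * y powr (1 + 1))"
      if y: "0 < y" "y \<le> K" for y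
    proof (cases "1 / ?T < y")
      case True
      have "heat_kernel a t y \<le> ennreal y * ennreal G"
        unfolding heat_kernel_eq[OF y(1)] G_def nn_integral_heat_profile[OF a, symmetric]
        using y by (intro mult_left_mono nn_integral_mono) (auto split: split_indicator)
      then show ?thesis using True by (simp add: mult.commute add_increasing2)
    next
      case False
      have T1: "1 < ?T" using t \<epsilon> by (simp add: gr_one_powr)
      have yT: "y \<le> 1 / ?T" using False by simp
      then have y1: "y \<le> 1" using T1 by (smt (verit) divide_le_eq_1)
      have ty: "t * y \<le> y powr (\<epsilon> / (1 + \<epsilon>))"
      proof -
        \<comment> \<open>The splitting condition says that
          \<open>t * y powr (1 / (1 + \<epsilon>))\<close> is at most 1; the remaining power of
          \<open>y\<close> is the bound.\<close>
        have "y powr (1 / (1 + \<epsilon>)) \<le> (1 / ?T) powr (1 / (1 + \<epsilon>))" using y yT \<epsilon> by (intro powr_mono2) auto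
        also have "\<dots> = 1 / t" using t \<epsilon> by (simp add: powr_divide powr_powr)
        finally have "t * y powr (1 / (1 + \<epsilon>)) \<le> 1" using t by (simp add: field_simps)
        then have "t * y powr (1 / (1 + \<epsilon>)) * y powr (\<epsilon> / (1 + \<epsilon>)) \<le> 1 * y powr (\<epsilon> / (1 + \<epsilon>))"
          by (intro mult_right_mono) auto
        moreover have "1 / (1 + \<epsilon>) + \<epsilon> / (1 + \<epsilon>) = 1" using \<epsilon> by (simp add: add_divide_distrib[symmetric])
        ultimately show ?thesis using y by (simp add: mult.assoc powr_add[symmetric])
      qed
      have tle: "t \<le> 1 / y"
      proof -
        have "t powr 1 \<le> ?T" using t \<epsilon> by (intro powr_mono) auto
        also have "?T \<le> 1 / y"
        proof -
          have "y * ?T \<le> 1" using yT T1 pos_le_divide_eq[of ?T y 1] by linarith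
          then show ?thesis using y by (simp only: pos_le_divide_eq mult.commute)
        qed
        finally show ?thesis using t by simp
      qed
      have "heat_kernel a t y \<le> (\<integral>\<^sup>+s. ennreal (c * y ^ 3) * indicator {1..t} s \<partial>lborel)"
        unfolding heat_kernel_def
      proof (intro nn_integral_mono)
        fix s :: real
        show "ennreal (exp (- ((s * y) powr - a)) / s\<^sup>2) * indicator {1..t} s \<le> ennreal (c * y ^ 3) * indicator {1..t} s"
        proof (cases "s \<in> {1..t}")
          case True
          have "s * y \<le> y powr (\<epsilon> / (1 + \<epsilon>))"
            using True y by (intro order_trans[OF mult_right_mono ty]) auto
          then have "(y powr (\<epsilon> / (1 + \<epsilon>))) powr - a \<le> (s * y) powr - a"
            using True y a by (intro powr_mono2') auto
          then have "exp (- ((s * y) powr - a)) \<le> exp (- (y powr - (a * (\<epsilon> / (1 + \<epsilon>)))))"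
            by (simp add: powr_powr mult.commute)
          also have "\<dots> \<le> c * y ^ 3" by (rule c(2)[OF y(1) y1])
          finally have "exp (- ((s * y) powr - a)) \<le> c * y ^ 3" .
          moreover have "exp (- ((s * y) powr - a)) / s\<^sup>2 \<le> exp (- ((s * y) powr - a)) / 1"
            using True by (intro divide_left_mono) (auto simp: one_le_power)
          ultimately show ?thesis using True by (auto intro!: ennreal_leI)
        qed simp
      qed
      also have "\<dots> = ennreal (c * y ^ 3 * (t - 1))"
        using t c y by (simp add: nn_integral_cmult_indicator ennreal_mult)
      also have "\<dots> \<le> ennreal (c * y ^ 3 * (1 / y))"
        using tle c y by (intro ennreal_leI mult_left_mono) auto
      also have "c * y ^ 3 * (1 / y) = c * y powr (1 + 1)"
        using y by (simp add: power3_eq_cube power2_eq_square)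
      finally show ?thesis using False by simp
    qed
    have "heat_integral a t \<le> (\<integral>\<^sup>+y. ennreal G * (ennreal y * indicator {1 / ?T<..} y) + ennreal (c * y powr (1 + 1)) \<partial>m)"
      unfolding heat_integral_Fubini by (intro nn_integral_mono_AE AE_mI k)
    also have "\<dots> = ennreal G * ennreal (cutoff_moment ?T) + ennreal B"
    proof (subst nn_integral_add)
      have "(\<integral>\<^sup>+y. ennreal G * (ennreal y * indicator {1 / ?T<..} y) \<partial>m) = ennreal G * ennreal (cutoff_moment ?T)"
        using t by (subst nn_integral_cmult) (auto simp: nn_integral_cutoff)
      moreover have "(\<integral>\<^sup>+y. ennreal (c * y powr (1 + 1)) \<partial>m) = ennreal B"
        unfolding B_def using c integrable_powr[of 1] by (subst nn_integral_eq_integral) auto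
      ultimately show "(\<integral>\<^sup>+y. ennreal G * (ennreal y * indicator {1 / ?T<..} y) \<partial>m) + (\<integral>\<^sup>+y. ennreal (c * y powr (1 + 1)) \<partial>m)
        = ennreal G * ennreal (cutoff_moment ?T) + ennreal B" by simp
    qed auto
    also have "\<dots> = ennreal (G * cutoff_moment ?T + B)"
      using G B cutoff_moment_nonneg by (simp add: ennreal_mult ennreal_plus)
    finally show ?thesis .
  qed
  then show thesis using that[of B] B by (simp add: G_def)
qed

text \<open>A window {\<eta>..R} carrying mass \<theta> of the profile lies inside
  \<open>{y..t * y}\<close> once \<open>y \<le> \<eta>\<close> and \<open>t * y \<ge> R\<close>. The
  second condition holds for \<open>y > 1 / (t powr (1 - \<epsilon>))\<close> as soon as
  \<open>t powr \<epsilon> \<ge> R\<close>; points \<open>y > \<eta>\<close> cost the constant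
  \<open>B\<close>.\<close>

lemma heat_integral_lower:
  assumes a: "0 < a" and \<epsilon>: "0 < \<epsilon>" "\<epsilon> < 1" and \<theta>: "\<theta> < 1 / a * Gamma (1 / a)" "0 \<le> \<theta>"
  obtains B where "0 \<le> B" "\<forall>\<^sub>F t in at_top.
    ennreal (\<theta> * cutoff_moment (t powr (1 - \<epsilon>))) \<le> heat_integral a t + ennreal B"
proof -
  obtain \<eta> R where \<eta>: "0 < \<eta>" "0 < R"
    "ennreal \<theta> \<le> (\<integral>\<^sup>+v. ennreal (heat_profile a v) * indicator {\<eta>..R} v \<partial>lborel)"
    using heat_profile_truncation[OF a \<theta>] .
  define B where "B = \<theta> * cutoff_moment (1 / \<eta>)"
  have B: "0 \<le> B" using \<theta> cutoff_moment_nonneg by (simp add: B_def)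
  have ev: "\<forall>\<^sub>F t in at_top. R \<le> t powr \<epsilon>" using \<epsilon> by real_asymp
  have "\<forall>\<^sub>F t in at_top. ennreal (\<theta> * cutoff_moment (t powr (1 - \<epsilon>))) \<le> heat_integral a t + ennreal B"
    using ev eventually_gt_at_top[of 1]
  proof eventually_elim
    case (elim t)
    let ?T = "t powr (1 - \<epsilon>)"
    have k: "ennreal \<theta> * (ennreal y * indicator {1 / ?T<..} y)
        \<le> heat_kernel a t y + ennreal \<theta> * (ennreal y * indicator {1 / (1 / \<eta>)<..} y)"
      if y: "0 < y" "y \<le> K" for y
    proof (cases "1 / ?T < y \<and> y \<le> \<eta>")
      case True
      have "R \<le> t * y"
      proof -
        have "t powr \<epsilon> = t powr 1 / ?T" by (subst powr_diff[symmetric]) simp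
        also have "\<dots> = t * (1 / ?T)" using elim by simp
        also have "\<dots> \<le> t * y" using True elim by (intro mult_left_mono) auto
        finally show ?thesis using elim by simp
      qed
      then have "{\<eta>..R} \<subseteq> {y..t * y}" using True by auto
      then have "ennreal \<theta> \<le> (\<integral>\<^sup>+v. ennreal (heat_profile a v) * indicator {y..t * y} v \<partial>lborel)"
        by (intro order_trans[OF \<eta>(3)] nn_integral_mono mult_left_mono) (auto split: split_indicator)
      then have "ennreal \<theta> * ennreal y \<le> heat_kernel a t y"
        unfolding heat_kernel_eq[OF y(1)] by (subst mult.commute) (intro mult_left_mono, auto)
      then show ?thesis using True by (auto simp: indicator_def intro: add_increasing2)
    next
      case False
      then show ?thesis by (auto simp: indicator_def)
    qed
    have hk[measurable]: "heat_kernel a t \<in> borel_measurable borel"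
      unfolding heat_kernel_def[abs_def] by measurable
    have "ennreal (\<theta> * cutoff_moment ?T) = (\<integral>\<^sup>+y. ennreal \<theta> * (ennreal y * indicator {1 / ?T<..} y) \<partial>m)"
      using elim \<theta> cutoff_moment_nonneg by (subst nn_integral_cmult) (auto simp: nn_integral_cutoff ennreal_mult)
    also have "\<dots> \<le> (\<integral>\<^sup>+y. heat_kernel a t y + ennreal \<theta> * (ennreal y * indicator {1 / (1 / \<eta>)<..} y) \<partial>m)"
      by (intro nn_integral_mono_AE AE_mI k)
    also have "\<dots> = heat_integral a t + ennreal \<theta> * ennreal (cutoff_moment (1 / \<eta>))"
      using \<eta> nn_integral_cutoff[of "1 / \<eta>"]
      by (subst nn_integral_add) (auto simp: heat_integral_Fubini nn_integral_cmult)
    also have "\<dots> = heat_integral a t + ennreal B"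
      using \<theta> cutoff_moment_nonneg by (simp add: B_def ennreal_mult)
    finally show ?case .
  qed
  then show thesis using that B by blast
qed

definition heat_mean :: "real \<Rightarrow> real \<Rightarrow> real"
  where "heat_mean a t = enn2real (heat_integral a t) / ln t"

lemma heat_integral_finite: "0 < a \<Longrightarrow> heat_integral a t < \<infinity>"
proof (cases "1 < t")
  case True
  assume "0 < a"
  then obtain B where "heat_integral a t \<le> ennreal (1 / a * Gamma (1 / a) * cutoff_moment (t powr (1 + 1)) + B)"
    using heat_integral_upper[of a 1] True by auto
  then show ?thesis by (rule order_le_less_trans) simp
next
  case False
  \<comment> \<open>For \<open>t \<le> 1\<close> the domain of integration is empty or the single
    point 1.\<close>
  have ae: "AE s in lborel. ennreal (1 / s\<^sup>2) * heat a s * indicator {1..t} s = 0"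
    using AE_lborel_singleton[of 1] by eventually_elim (use False in \<open>auto simp: indicator_def\<close>)
  then have "heat_integral a t = integral\<^sup>N lborel (\<lambda>s::real. 0)"
    unfolding heat_integral_def by (intro nn_integral_cong_AE ae)
  then show ?thesis by simp
qed

lemma heat_integral_mono: "s \<le> t \<Longrightarrow> heat_integral a s \<le> heat_integral a t"
  unfolding heat_integral_def by (intro nn_integral_mono mult_left_mono) (auto split: split_indicator)

lemma measurable_heat_mean: "0 < a \<Longrightarrow> heat_mean a \<in> borel_measurable borel"
proof -
  assume a: "0 < a"
  have "mono (\<lambda>t. enn2real (heat_integral a t))"
    using heat_integral_finite[OF a] by (auto simp: mono_def intro!: enn2real_mono heat_integral_mono)
  then have [measurable]: "(\<lambda>t. enn2real (heat_integral a t)) \<in> borel_measurable borel"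
    by (rule borel_measurable_mono)
  show ?thesis unfolding heat_mean_def[abs_def] by measurable
qed

end

context dixmier_law_mean
begin

lemma
  assumes a: "0 < a"
  shows tail_bounded_heat_mean: "tail_bounded (heat_mean a)"
    and mean_heat: "L (heat_mean a) = 1 / a * Gamma (1 / a) * L (\<lambda>t. cutoff_moment t / ln t)"
proof -
  let ?a = "L (\<lambda>t. cutoff_moment t / ln t)"
  define G where "G = 1 / a * Gamma (1 / a)"
  have G: "0 < G" unfolding G_def using a by (auto intro!: mult_pos_pos Gamma_real_pos)
  have upper: "\<exists>B. \<forall>\<^sub>F t in at_top. heat_mean a t \<le> G * (cutoff_moment (t powr (1 + \<epsilon>)) / ln t) + B / ln t"
    if "0 < \<epsilon>" for \<epsilon>
  proof -
    obtain B where B: "0 \<le> B" "\<And>t. 1 < t \<Longrightarrow> heat_integral a t \<le> ennreal (G * cutoff_moment (t powr (1 + \<epsilon>)) + B)"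
      using heat_integral_upper[OF a \<open>0 < \<epsilon>\<close>] unfolding G_def by metis
    have "\<forall>\<^sub>F t in at_top. heat_mean a t \<le> G * (cutoff_moment (t powr (1 + \<epsilon>)) / ln t) + B / ln t"
      using eventually_gt_at_top[of 1]
    proof eventually_elim
      case (elim t)
      have "enn2real (heat_integral a t) \<le> G * cutoff_moment (t powr (1 + \<epsilon>)) + B"
        using B(1) B(2)[OF elim] G cutoff_moment_nonneg by (intro enn2real_leI) auto
      then have "heat_mean a t \<le> (G * cutoff_moment (t powr (1 + \<epsilon>)) + B) / ln t"
        using elim unfolding heat_mean_def by (intro divide_right_mono) auto
      then show ?case by (simp add: add_divide_distrib)
    qed
    then show ?thesis ..
  qed
  have tbu: "tail_bounded (\<lambda>t. G * (cutoff_moment (t powr (1 + \<epsilon>)) / ln t) + B / ln t)" if "0 < \<epsilon>" for \<epsilon> B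
    using that by (intro tail_bounded_add tail_bounded_cmult tail_bounded_cutoff_powr tail_bounded_div_ln) auto
  show tb: "tail_bounded (heat_mean a)"
  proof -
    obtain B where B: "\<forall>\<^sub>F t in at_top. heat_mean a t \<le> G * (cutoff_moment (t powr (1 + 1)) / ln t) + B / ln t"
      using upper[of 1] by auto
    obtain D where D: "\<forall>\<^sub>F t in at_top. \<bar>G * (cutoff_moment (t powr (1 + 1)) / ln t) + B / ln t\<bar> \<le> D"
      using tbu[of 1 B] by (auto simp: tail_bounded_def)
    have "\<forall>\<^sub>F t in at_top. \<bar>heat_mean a t\<bar> \<le> D"
      using B D eventually_gt_at_top[of 1]
    proof eventually_elim
      case (elim t)
      then have "0 \<le> heat_mean a t" by (simp add: heat_mean_def)
      with elim show ?case by linarith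
    qed
    then show ?thesis by (rule tail_boundedI[OF measurable_heat_mean[OF a]])
  qed
  have le: "L (heat_mean a) \<le> G * ((1 + \<epsilon>) * ?a)" if \<epsilon>: "0 < \<epsilon>" for \<epsilon>
  proof -
    obtain B where B: "\<forall>\<^sub>F t in at_top. heat_mean a t \<le> G * (cutoff_moment (t powr (1 + \<epsilon>)) / ln t) + B / ln t"
      using upper[OF \<epsilon>] by auto
    have t1: "tail_bounded (\<lambda>t. cutoff_moment (t powr (1 + \<epsilon>)) / ln t)"
      using \<epsilon> by (intro tail_bounded_cutoff_powr) auto
    have "L (heat_mean a) \<le> L (\<lambda>t. G * (cutoff_moment (t powr (1 + \<epsilon>)) / ln t) + B / ln t)"
      by (rule mono[OF tb tbu[OF \<epsilon>] B])
    also have "\<dots> = G * L (\<lambda>t. cutoff_moment (t powr (1 + \<epsilon>)) / ln t) + 0"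
      unfolding add[OF tail_bounded_cmult[OF t1] tail_bounded_div_ln] cmult[OF t1] mean_div_ln ..
    also have "\<dots> = G * ((1 + \<epsilon>) * ?a)" using \<epsilon> by (simp add: mean_cutoff_powr)
    finally show ?thesis .
  qed
  have ge: "G * (1 - \<epsilon>) * ((1 - \<epsilon>) * ?a) \<le> L (heat_mean a)" if \<epsilon>: "0 < \<epsilon>" "\<epsilon> < 1" for \<epsilon>
  proof -
    \<comment> \<open>The same \<epsilon> measures the loss in the profile and the loss in the
      exponent; both disappear in the limit.\<close>
    define \<theta> where "\<theta> = G * (1 - \<epsilon>)"
    have \<theta>: "\<theta> < 1 / a * Gamma (1 / a)" "0 \<le> \<theta>"
      using \<epsilon> G unfolding G_def[symmetric] by (auto simp: \<theta>_def)
    obtain B where B: "0 \<le> B"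
      "\<forall>\<^sub>F t in at_top. ennreal (\<theta> * cutoff_moment (t powr (1 - \<epsilon>))) \<le> heat_integral a t + ennreal B"
      by (rule heat_integral_lower[OF a \<epsilon> \<theta>])
    have ev: "\<forall>\<^sub>F t in at_top. \<theta> * (cutoff_moment (t powr (1 - \<epsilon>)) / ln t) + (- B) / ln t \<le> heat_mean a t"
      using B(2) eventually_gt_at_top[of 1]
    proof eventually_elim
      case (elim t)
      have "heat_integral a t + ennreal B = ennreal (enn2real (heat_integral a t) + B)"
        using heat_integral_finite[OF a, of t] B(1) by (simp add: ennreal_plus)
      then have "ennreal (\<theta> * cutoff_moment (t powr (1 - \<epsilon>))) \<le> ennreal (enn2real (heat_integral a t) + B)"
        using elim(1) by (simp only:)
      then have "\<theta> * cutoff_moment (t powr (1 - \<epsilon>)) \<le> enn2real (heat_integral a t) + B"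
        using B(1) by (subst (asm) ennreal_le_iff) auto
      then have "(\<theta> * cutoff_moment (t powr (1 - \<epsilon>)) - B) / ln t \<le> heat_mean a t"
        using elim(2) unfolding heat_mean_def by (intro divide_right_mono) auto
      then show ?case by (simp add: diff_divide_distrib)
    qed
    have t1: "tail_bounded (\<lambda>t. cutoff_moment (t powr (1 - \<epsilon>)) / ln t)"
      using \<epsilon> by (intro tail_bounded_cutoff_powr) auto
    have "\<theta> * ((1 - \<epsilon>) * ?a) = \<theta> * L (\<lambda>t. cutoff_moment (t powr (1 - \<epsilon>)) / ln t) + 0"
      using \<epsilon> by (simp add: mean_cutoff_powr)
    also have "\<dots> = L (\<lambda>t. \<theta> * (cutoff_moment (t powr (1 - \<epsilon>)) / ln t) + (- B) / ln t)"
      unfolding add[OF tail_bounded_cmult[OF t1] tail_bounded_div_ln] cmult[OF t1] mean_div_ln ..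
    also have "\<dots> \<le> L (heat_mean a)"
      by (rule mono[OF tail_bounded_add[OF tail_bounded_cmult[OF t1] tail_bounded_div_ln] tb ev])
    finally show ?thesis by (simp add: \<theta>_def)
  qed
  show "L (heat_mean a) = 1 / a * Gamma (1 / a) * ?a"
    unfolding G_def[symmetric]
  proof (rule antisym)
    show "L (heat_mean a) \<le> G * ?a"
    proof (rule tendsto_lowerbound)
      show "((\<lambda>\<epsilon>. G * ((1 + \<epsilon>) * ?a)) \<longlongrightarrow> G * ?a) (at_right 0)" by (auto intro!: tendsto_eq_intros)
      show "\<forall>\<^sub>F \<epsilon> in at_right 0. L (heat_mean a) \<le> G * ((1 + \<epsilon>) * ?a)"
        using eventually_at_right_less[of 0] by eventually_elim (rule le)
    qed simp
    show "G * ?a \<le> L (heat_mean a)"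
    proof (rule tendsto_upperbound)
      show "((\<lambda>\<epsilon>. G * (1 - \<epsilon>) * ((1 - \<epsilon>) * ?a)) \<longlongrightarrow> G * ?a) (at_right 0)" by (auto intro!: tendsto_eq_intros)
      have "\<forall>\<^sub>F \<epsilon> in at_right (0::real). \<epsilon> < 1" using eventually_at_right_real[of 0 1] by (auto elim!: eventually_mono)
      then show "\<forall>\<^sub>F \<epsilon> in at_right 0. G * (1 - \<epsilon>) * ((1 - \<epsilon>) * ?a) \<le> L (heat_mean a)"
        using eventually_at_right_less[of 0] by eventually_elim (rule ge)
    qed simp
  qed
qed

end

section \<open>Singular numbers\<close>

context dixmier_law
begin

text \<open>The decreasing rearrangement of the identity under the law; by
  \<open>singular_number_op_powr\<close> these are the singular numbers of
  \<open>op_powr T p\<close>.\<close>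

definition rearrangement :: "real \<Rightarrow> real"
  where "rearrangement s = Inf {x. 0 \<le> x \<and> emeasure m {x<..} \<le> ennreal s}"

lemma emeasure_tail_antimono: "x \<le> y \<Longrightarrow> emeasure m {y<..} \<le> emeasure m {x<..}"
  by (intro emeasure_mono) (auto simp: sets_m)

lemma emeasure_tail_K: "emeasure m {K<..} = 0"
proof -
  have "AE y in m. y \<notin> {K<..}" by (rule AE_mI) auto
  then show ?thesis by (subst AE_iff_measurable[symmetric, where P = "\<lambda>y. y \<notin> {K<..}"]) (auto simp: sets_m)
qed

text \<open>The tail function is right continuous, since \<open>{x<..}\<close> is the increasing
  union of the sets \<open>{x + 1 / (n + 1)<..}\<close>. So a tail above \<open>s\<close> at
  \<open>x\<close> stays above \<open>s\<close> slightly to the right, which gives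
  strictness.\<close>

lemma less_rearrangement_iff:
  assumes "0 \<le> x"
  shows "x < rearrangement s \<longleftrightarrow> ennreal s < emeasure m {x<..}"
proof
  let ?S = "{x. 0 \<le> x \<and> emeasure m {x<..} \<le> ennreal s}"
  have bdd: "bdd_below ?S" by (rule bdd_belowI[of _ 0]) auto
  assume *: "x < rearrangement s"
  show "ennreal s < emeasure m {x<..}"
  proof (rule ccontr)
    assume "\<not> ?thesis"
    then have "x \<in> ?S" using assms by simp
    from cInf_lower[OF this bdd] * show False by (simp add: rearrangement_def)
  qed
next
  let ?S = "{x. 0 \<le> x \<and> emeasure m {x<..} \<le> ennreal s}"
  have ne: "?S \<noteq> {}" using K emeasure_tail_K by (auto intro!: exI[of _ K])
  assume *: "ennreal s < emeasure m {x<..}"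
  have "(SUP n. emeasure m {x + 1 / real (Suc n)<..}) = emeasure m (\<Union>n. {x + 1 / real (Suc n)<..})"
  proof (rule SUP_emeasure_incseq)
    show "incseq (\<lambda>n. {x + 1 / real (Suc n)<..})"
    proof (rule incseq_SucI)
      fix n
      have "1 / real (Suc (Suc n)) \<le> 1 / real (Suc n)" by (intro divide_left_mono) auto
      then show "{x + 1 / real (Suc n)<..} \<subseteq> {x + 1 / real (Suc (Suc n))<..}"
        unfolding subset_iff greaterThan_iff by linarith
    qed
  qed (simp add: sets_m image_subset_iff)
  also have "(\<Union>n. {x + 1 / real (Suc n)<..}) = {x<..}"
  proof (intro equalityI subsetI)
    fix y assume "y \<in> {x<..}"
    then have "0 < y - x" by simp
    from reals_Archimedean[OF this] obtain n where "1 / real (Suc n) < y - x" by (auto simp: inverse_eq_divide)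
    then have "x + 1 / real (Suc n) < y" by linarith
    then show "y \<in> (\<Union>n. {x + 1 / real (Suc n)<..})" by blast
  next
    fix y assume "y \<in> (\<Union>n. {x + 1 / real (Suc n)<..})"
    then obtain n where "x + 1 / real (Suc n) < y" by auto
    moreover have "0 < 1 / real (Suc n)" by simp
    ultimately show "y \<in> {x<..}" unfolding greaterThan_iff by linarith
  qed
  finally have "ennreal s < (SUP n. emeasure m {x + 1 / real (Suc n)<..})" using * by simp
  then obtain n where n: "ennreal s < emeasure m {x + 1 / real (Suc n)<..}"
    by (subst (asm) less_SUP_iff) blast
  have "x + 1 / real (Suc n) \<le> Inf ?S"
  proof (rule cInf_greatest[OF ne])
    fix z assume z: "z \<in> ?S"
    show "x + 1 / real (Suc n) \<le> z"
    proof (rule ccontr)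
      assume "\<not> ?thesis"
      then have "emeasure m {x + 1 / real (Suc n)<..} \<le> emeasure m {z<..}"
        by (intro emeasure_tail_antimono) simp
      with z n show False by auto
    qed
  qed
  moreover have "0 < 1 / real (Suc n)" by simp
  ultimately show "x < rearrangement s" unfolding rearrangement_def by linarith
qed

lemma rearrangement_nonneg: "0 \<le> rearrangement s"
proof -
  have "{x. 0 \<le> x \<and> emeasure m {x<..} \<le> ennreal s} \<noteq> {}"
    using K emeasure_tail_K by (auto intro!: exI[of _ K])
  then show ?thesis unfolding rearrangement_def by (rule cInf_greatest) auto
qed

lemma measurable_emeasure_tail [measurable]: "(\<lambda>x. emeasure m {x<..}) \<in> borel_measurable borel"
proof -
  have "(\<lambda>x. \<integral>\<^sup>+y. (if x < y then 1 else 0) \<partial>m) \<in> borel_measurable borel"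
    by (rule borel_measurable_nn_integral) measurable
  also have "(\<lambda>x. \<integral>\<^sup>+y. (if x < y then 1 else 0) \<partial>m) = (\<lambda>x. emeasure m {x<..})"
  proof
    fix x
    have "(\<integral>\<^sup>+y. (if x < y then 1 else 0) \<partial>m) = (\<integral>\<^sup>+y. indicator {x<..} y \<partial>m)"
      by (intro nn_integral_cong) (auto simp: indicator_def)
    then show "(\<integral>\<^sup>+y. (if x < y then 1 else 0) \<partial>m) = emeasure m {x<..}" by (simp add: sets_m)
  qed
  finally show ?thesis .
qed

definition rearrangement_integral :: "real \<Rightarrow> ennreal"
  where "rearrangement_integral t = (\<integral>\<^sup>+s. ennreal (rearrangement s) * indicator {0..t} s \<partial>lborel)"

text \<open>Layer-cake form. A single \<open>if\<close> makes the joint measurability in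
  \<open>s\<close> and \<open>x\<close> visible, both for Fubini's theorem and for the measurability
  of \<open>rearrangement\<close>.\<close>

lemma rearrangement_layer:
  "ennreal (rearrangement s) * indicator {0..t} s =
    (\<integral>\<^sup>+x. (if 0 \<le> s \<and> s \<le> t \<and> 0 \<le> x \<and> ennreal s < emeasure m {x<..} then 1 else 0) \<partial>lborel)"
proof -
  have "(\<integral>\<^sup>+x. (if 0 \<le> s \<and> s \<le> t \<and> 0 \<le> x \<and> ennreal s < emeasure m {x<..} then 1 else 0) \<partial>lborel)
    = (\<integral>\<^sup>+x. indicator {0..t} s * indicator {0..<rearrangement s} x \<partial>lborel)"
    by (intro nn_integral_cong) (auto simp: indicator_def less_rearrangement_iff)
  also have "\<dots> = ennreal (rearrangement s) * indicator {0..t} s"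
    by (simp add: nn_integral_cmult rearrangement_nonneg mult.commute)
  finally show ?thesis ..
qed

text \<open>After exchanging the integrals, for each level \<open>x\<close> one measures the initial
  segment of [0,t] on which \<open>s\<close> stays below the tail at \<open>x\<close>.\<close>

lemma rearrangement_integral_eq:
  assumes "0 \<le> t"
  shows "rearrangement_integral t = (\<integral>\<^sup>+x. min (ennreal t) (emeasure m {x<..}) * indicator {0..} x \<partial>lborel)"
proof -
  have "rearrangement_integral t = (\<integral>\<^sup>+s. (\<integral>\<^sup>+x. (if 0 \<le> s \<and> s \<le> t \<and> 0 \<le> x \<and> ennreal s < emeasure m {x<..} then 1 else 0) \<partial>lborel) \<partial>lborel)"
    unfolding rearrangement_integral_def rearrangement_layer ..
  also have "\<dots> = (\<integral>\<^sup>+x. (\<integral>\<^sup>+s. (if 0 \<le> s \<and> s \<le> t \<and> 0 \<le> x \<and> ennreal s < emeasure m {x<..} then 1 else 0) \<partial>lborel) \<partial>lborel)"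
    by (rule lborel_pair.Fubini'[symmetric]) measurable
  also have "\<dots> = (\<integral>\<^sup>+x. min (ennreal t) (emeasure m {x<..}) * indicator {0..} x \<partial>lborel)"
  proof (intro nn_integral_cong)
    fix x :: real
    show "(\<integral>\<^sup>+s. (if 0 \<le> s \<and> s \<le> t \<and> 0 \<le> x \<and> ennreal s < emeasure m {x<..} then 1 else 0) \<partial>lborel)
        = min (ennreal t) (emeasure m {x<..}) * indicator {0..} x"
    proof (cases "0 \<le> x")
      case x: True
      show ?thesis
      proof (cases "ennreal t < emeasure m {x<..}")
        case True
        have "(\<integral>\<^sup>+s. (if 0 \<le> s \<and> s \<le> t \<and> 0 \<le> x \<and> ennreal s < emeasure m {x<..} then 1 else 0) \<partial>lborel)
            = (\<integral>\<^sup>+s. indicator {0..t} s \<partial>lborel)"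
          using x True by (intro nn_integral_cong) (auto simp: indicator_def intro: order_le_less_trans[OF ennreal_leI])
        also have "\<dots> = ennreal t" using assms by simp
        finally show ?thesis using x True by simp
      next
        case False
        then obtain r where r: "emeasure m {x<..} = ennreal r" "0 \<le> r" "r \<le> t"
          using assms by (cases "emeasure m {x<..}") (auto simp: not_less ennreal_le_iff top_unique)
        have "(\<integral>\<^sup>+s. (if 0 \<le> s \<and> s \<le> t \<and> 0 \<le> x \<and> ennreal s < emeasure m {x<..} then 1 else 0) \<partial>lborel)
            = (\<integral>\<^sup>+s. indicator {0..<r} s \<partial>lborel)"
          using x r by (intro nn_integral_cong) (auto simp: indicator_def ennreal_less_iff)
        also have "\<dots> = ennreal r" using r by simp
        finally show ?thesis using x r False by (simp add: min_absorb2 not_less)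
      qed
    qed simp
  qed
  finally show ?thesis .
qed

text \<open>Layer cake for \<open>y * indicator {b<..} y\<close>: below level \<open>b\<close> its
  superlevel sets all equal \<open>{b<..}\<close>, whence the maximum.\<close>

lemma cutoff_moment_layer:
  assumes "0 < b"
  shows "ennreal (cutoff_moment (1 / b)) = (\<integral>\<^sup>+x. emeasure m {max x b<..} * indicator {0..} x \<partial>lborel)"
proof -
  interpret pair_sigma_finite lborel m ..
  have "ennreal (cutoff_moment (1 / b)) = (\<integral>\<^sup>+y. ennreal y * indicator {b<..} y \<partial>m)"
    using nn_integral_cutoff[of "1 / b"] assms by simp
  also have "\<dots> = (\<integral>\<^sup>+y. (\<integral>\<^sup>+x. (if 0 \<le> x \<and> max x b < y then 1 else 0) \<partial>lborel) \<partial>m)"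
  proof (intro nn_integral_cong)
    fix y :: real
    have "(\<integral>\<^sup>+x. (if 0 \<le> x \<and> max x b < y then 1 else 0) \<partial>lborel)
        = (\<integral>\<^sup>+x. indicator {b<..} y * indicator {0..<y} x \<partial>lborel)"
      by (intro nn_integral_cong) (auto simp: indicator_def)
    also have "\<dots> = ennreal y * indicator {b<..} y"
      using assms by (cases "b < y") (auto simp: nn_integral_cmult)
    finally show "ennreal y * indicator {b<..} y = (\<integral>\<^sup>+x. (if 0 \<le> x \<and> max x b < y then 1 else 0) \<partial>lborel)" ..
  qed
  also have "\<dots> = (\<integral>\<^sup>+x. (\<integral>\<^sup>+y. (if 0 \<le> x \<and> max x b < y then 1 else 0) \<partial>m) \<partial>lborel)"
    by (rule Fubini') measurable
  also have "\<dots> = (\<integral>\<^sup>+x. emeasure m {max x b<..} * indicator {0..} x \<partial>lborel)"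
  proof (intro nn_integral_cong)
    fix x :: real
    have "(\<integral>\<^sup>+y. (if 0 \<le> x \<and> max x b < y then 1 else 0) \<partial>m)
        = (\<integral>\<^sup>+y. indicator {0..} x * indicator {max x b<..} y \<partial>m)"
      by (intro nn_integral_cong) (auto simp: indicator_def)
    then show "(\<integral>\<^sup>+y. (if 0 \<le> x \<and> max x b < y then 1 else 0) \<partial>m) = emeasure m {max x b<..} * indicator {0..} x"
      by (simp add: nn_integral_cmult sets_m mult.commute)
  qed
  finally show ?thesis .
qed

text \<open>Below level \<open>1 / t\<close> the minimum is replaced by \<open>t\<close>, which
  integrates to 1; above it by the tail, which integrates to at most
  \<open>cutoff_moment t\<close>.\<close>

lemma rearrangement_integral_upper:
  assumes "0 < t" shows "rearrangement_integral t \<le> ennreal (1 + cutoff_moment t)"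
proof -
  have "rearrangement_integral t \<le> (\<integral>\<^sup>+x. ennreal t * indicator {0..<1 / t} x + emeasure m {max x (1 / t)<..} * indicator {0..} x \<partial>lborel)"
    unfolding rearrangement_integral_eq[OF less_imp_le[OF assms]]
    by (intro nn_integral_mono) (auto simp: indicator_def max_def min.coboundedI2 min.coboundedI1 intro: add_increasing2)
  also have "\<dots> = ennreal t * ennreal (1 / t) + ennreal (cutoff_moment t)"
    using assms cutoff_moment_layer[of "1 / t"] by (subst nn_integral_add) (auto simp: nn_integral_cmult)
  also have "\<dots> = ennreal (1 + cutoff_moment t)"
    using ennreal_plus[of 1 "cutoff_moment t"] assms cutoff_moment_nonneg
    by (simp add: ennreal_mult[symmetric])
  finally show ?thesis .
qed

text \<open>If the tail at \<open>b\<close> is at most \<open>t\<close>, the minimum in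
  \<open>rearrangement_integral_eq\<close> cuts off nothing above level \<open>b\<close>.\<close>

lemma rearrangement_integral_lower:
  assumes "0 \<le> t" "0 < b" "emeasure m {b<..} \<le> ennreal t"
  shows "ennreal (cutoff_moment (1 / b)) \<le> rearrangement_integral t"
  unfolding rearrangement_integral_eq[OF assms(1)] cutoff_moment_layer[OF assms(2)]
proof (intro nn_integral_mono mult_right_mono)
  fix x :: real
  have "emeasure m {max x b<..} \<le> emeasure m {b<..}" "emeasure m {max x b<..} \<le> emeasure m {x<..}"
    by (intro emeasure_tail_antimono; simp)+
  then show "emeasure m {max x b<..} \<le> min (ennreal t) (emeasure m {x<..})" using assms(3) by auto
qed simp

lemma emeasure_tail_le:
  assumes "0 < b" shows "emeasure m {b<..} \<le> ennreal (cutoff_moment (1 / b) / b)"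
proof -
  have "emeasure m {b<..} = (\<integral>\<^sup>+y. indicator {b<..} y \<partial>m)" by (simp add: sets_m)
  also have "\<dots> \<le> (\<integral>\<^sup>+y. ennreal (1 / b) * (ennreal y * indicator {b<..} y) \<partial>m)"
    using assms by (intro nn_integral_mono) (auto simp: indicator_def ennreal_mult[symmetric] field_simps)
  also have "\<dots> = ennreal (1 / b) * ennreal (cutoff_moment (1 / b))"
    using assms nn_integral_cutoff[of "1 / b"] by (subst nn_integral_cmult) auto
  finally show ?thesis using assms cutoff_moment_nonneg by (simp add: ennreal_mult[symmetric] mult.commute)
qed

text \<open>Supplies the tail condition of \<open>rearrangement_integral_lower\<close> with
  \<open>1 / b = t powr (1 - \<epsilon>)\<close>. Chebyshev's inequality and the logarithmic bound
  on \<open>cutoff_moment\<close> give order \<open>t powr (1 - \<epsilon>) * ln t\<close>, which is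
  eventually below \<open>t\<close>.\<close>

lemma eventually_emeasure_tail_le:
  assumes \<epsilon>: "0 < \<epsilon>" "\<epsilon> < 1"
  shows "\<forall>\<^sub>F t in at_top. emeasure m {1 / (t powr (1 - \<epsilon>))<..} \<le> ennreal t"
proof -
  \<comment> \<open>The constant of \<open>cutoff_moment_le\<close>, together with
    \<open>ln (t powr (1 - \<epsilon>)) = (1 - \<epsilon>) * ln t\<close>.\<close>
  let ?D = "exp 1 * C * (1 - \<epsilon>)"
  have "((\<lambda>t::real. ln t * t powr - \<epsilon>) \<longlongrightarrow> 0) at_top" using \<epsilon> by real_asymp
  from tendsto_mult_right_zero[OF this, of ?D]
  have "\<forall>\<^sub>F t in at_top. ?D * (ln t * t powr - \<epsilon>) < 1" by (rule order_tendstoD) simp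
  moreover have "\<forall>\<^sub>F t in at_top. 1 < t powr (1 - \<epsilon>) \<and> 1 \<le> ln (t powr (1 - \<epsilon>)) \<and> 1 / ln (t powr (1 - \<epsilon>)) < e0"
  proof (rule eventually_compose_filterlim[OF eventually_small_log])
    show "filterlim (\<lambda>t::real. t powr (1 - \<epsilon>)) at_top at_top" using \<epsilon> by real_asymp
  qed
  ultimately show ?thesis using eventually_gt_at_top[of 1]
  proof eventually_elim
    case (elim t)
    let ?T = "t powr (1 - \<epsilon>)"
    have "emeasure m {1 / ?T<..} \<le> ennreal (cutoff_moment ?T * ?T)"
      using emeasure_tail_le[of "1 / ?T"] elim by simp
    also have "\<dots> \<le> ennreal t"
    proof (rule ennreal_leI)
      have "cutoff_moment ?T * ?T \<le> (exp 1 * C * ln ?T) * ?T"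
        using elim by (intro mult_right_mono cutoff_moment_le) auto
      also have "\<dots> = t * (?D * (ln t * t powr - \<epsilon>))"
      proof -
        have "ln ?T = (1 - \<epsilon>) * ln t" using elim by (subst ln_powr) auto
        moreover have "?T = t * t powr - \<epsilon>" using elim powr_add[of t 1 "- \<epsilon>"] by simp
        ultimately show ?thesis by (simp only: mult_ac)
      qed
      also have "\<dots> \<le> t * 1" using elim by (intro mult_left_mono) auto
      finally show "cutoff_moment ?T * ?T \<le> t" by simp
    qed
    finally show ?case .
  qed
qed

lemma rearrangement_integral_mono: "s \<le> t \<Longrightarrow> rearrangement_integral s \<le> rearrangement_integral t"
  unfolding rearrangement_integral_def by (intro nn_integral_mono mult_left_mono) (auto split: split_indicator)

lemma rearrangement_integral_finite: "rearrangement_integral t < \<infinity>"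
proof -
  have "rearrangement_integral t \<le> rearrangement_integral (max 1 t)" by (rule rearrangement_integral_mono) simp
  also have "\<dots> \<le> ennreal (1 + cutoff_moment (max 1 t))" by (rule rearrangement_integral_upper) simp
  also have "\<dots> < \<infinity>" by simp
  finally show ?thesis .
qed

lemma set_integral_rearrangement:
  "(LINT s:{0..t}|lborel. rearrangement s) = enn2real (rearrangement_integral t)"
proof -
  have meas: "(\<lambda>s. ennreal (rearrangement s) * indicator {0..t} s) \<in> borel_measurable lborel"
    unfolding rearrangement_layer by measurable
  have "(\<lambda>s. indicator {0..t} s *\<^sub>R rearrangement s) = (\<lambda>s. enn2real (ennreal (rearrangement s) * indicator {0..t} s))"
    by (rule ext) (auto simp: indicator_def rearrangement_nonneg)
  with meas have "(\<lambda>s. indicator {0..t} s *\<^sub>R rearrangement s) \<in> borel_measurable lborel" by simp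
  then have "(LINT s:{0..t}|lborel. rearrangement s) = enn2real (\<integral>\<^sup>+s. ennreal (indicator {0..t} s *\<^sub>R rearrangement s) \<partial>lborel)"
    unfolding set_lebesgue_integral_def by (intro integral_eq_nn_integral) (auto simp: rearrangement_nonneg)
  also have "(\<integral>\<^sup>+s. ennreal (indicator {0..t} s *\<^sub>R rearrangement s) \<partial>lborel) = rearrangement_integral t"
    unfolding rearrangement_integral_def by (intro nn_integral_cong) (auto simp: indicator_def)
  finally show ?thesis .
qed

definition dixmier_mean :: "real \<Rightarrow> real"
  where "dixmier_mean t = 1 / ln (1 + t) * (LINT s:{0..t}|lborel. rearrangement s)"

lemma measurable_dixmier_mean: "dixmier_mean \<in> borel_measurable borel"
proof -
  have "mono (\<lambda>t. enn2real (rearrangement_integral t))"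
    using rearrangement_integral_finite by (auto simp: mono_def intro!: enn2real_mono rearrangement_integral_mono)
  then have [measurable]: "(\<lambda>t. enn2real (rearrangement_integral t)) \<in> borel_measurable borel"
    by (rule borel_measurable_mono)
  show ?thesis unfolding dixmier_mean_def[abs_def] set_integral_rearrangement by measurable
qed

end

context dixmier_law_mean
begin

lemma
  shows tail_bounded_dixmier_mean: "tail_bounded dixmier_mean"
    and mean_dixmier: "L dixmier_mean = L (\<lambda>t. cutoff_moment t / ln t)"
proof -
  let ?a = "L (\<lambda>t. cutoff_moment t / ln t)"
  have upper: "\<forall>\<^sub>F t in at_top. dixmier_mean t \<le> cutoff_moment t / ln t + 1 / ln t"
    using eventually_gt_at_top[of 1]
  proof eventually_elim
    case (elim t)
    have "enn2real (rearrangement_integral t) \<le> 1 + cutoff_moment t"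
      using rearrangement_integral_upper[of t] elim cutoff_moment_nonneg by (intro enn2real_leI) auto
    then have "dixmier_mean t \<le> (1 + cutoff_moment t) / ln (1 + t)"
      using elim unfolding dixmier_mean_def set_integral_rearrangement by (simp add: divide_right_mono)
    also have "\<dots> \<le> (1 + cutoff_moment t) / ln t"
      using elim cutoff_moment_nonneg by (intro divide_left_mono) (auto intro: add_nonneg_nonneg)
    finally show ?case by (simp add: add_divide_distrib)
  qed
  have tbu: "tail_bounded (\<lambda>t. cutoff_moment t / ln t + 1 / ln t)"
    by (intro tail_bounded_add tail_bounded_cutoff tail_bounded_div_ln)
  show tb: "tail_bounded dixmier_mean"
  proof -
    obtain D where D: "\<forall>\<^sub>F t in at_top. \<bar>cutoff_moment t / ln t + 1 / ln t\<bar> \<le> D"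
      using tbu by (auto simp: tail_bounded_def)
    have "\<forall>\<^sub>F t in at_top. \<bar>dixmier_mean t\<bar> \<le> D"
      using upper D eventually_gt_at_top[of 1]
    proof eventually_elim
      case (elim t)
      then have "0 \<le> dixmier_mean t" by (simp add: dixmier_mean_def set_integral_rearrangement)
      with elim show ?case by linarith
    qed
    then show ?thesis by (rule tail_boundedI[OF measurable_dixmier_mean])
  qed
  have ge: "(1 - \<epsilon>) / (1 + \<epsilon>) * ?a \<le> L dixmier_mean" if \<epsilon>: "0 < \<epsilon>" "\<epsilon> < 1" for \<epsilon>
  proof -
    \<comment> \<open>\<open>dixmier_mean\<close> divides by \<open>ln (1 + t)\<close>; comparing
      with \<open>ln t\<close> costs a factor \<open>1 + \<epsilon>\<close>.\<close>
    have "\<forall>\<^sub>F t::real in at_top. ln (1 + t) \<le> (1 + \<epsilon>) * ln t" using \<epsilon> by real_asymp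
    then have ev: "\<forall>\<^sub>F t in at_top. 1 / (1 + \<epsilon>) * (cutoff_moment (t powr (1 - \<epsilon>)) / ln t) \<le> dixmier_mean t"
      using eventually_emeasure_tail_le[OF \<epsilon>] eventually_gt_at_top[of 1]
    proof eventually_elim
      case (elim t)
      let ?T = "t powr (1 - \<epsilon>)"
      have "ennreal (cutoff_moment ?T) \<le> rearrangement_integral t"
        using rearrangement_integral_lower[of t "1 / ?T"] elim by simp
      then have "ennreal (cutoff_moment ?T) \<le> ennreal (enn2real (rearrangement_integral t))"
        using rearrangement_integral_finite by simp
      then have le: "cutoff_moment ?T \<le> enn2real (rearrangement_integral t)" by (subst (asm) ennreal_le_iff) auto
      have "1 / (1 + \<epsilon>) * (cutoff_moment ?T / ln t) = cutoff_moment ?T / ((1 + \<epsilon>) * ln t)" by simp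
      also have "\<dots> \<le> cutoff_moment ?T / ln (1 + t)"
        using elim \<epsilon> cutoff_moment_nonneg by (intro divide_left_mono mult_pos_pos) auto
      also have "\<dots> \<le> enn2real (rearrangement_integral t) / ln (1 + t)"
        using le elim by (intro divide_right_mono) auto
      finally show ?case by (simp add: dixmier_mean_def set_integral_rearrangement)
    qed
    have t1: "tail_bounded (\<lambda>t. cutoff_moment (t powr (1 - \<epsilon>)) / ln t)"
      using \<epsilon> by (intro tail_bounded_cutoff_powr) auto
    have "(1 - \<epsilon>) / (1 + \<epsilon>) * ?a = L (\<lambda>t. 1 / (1 + \<epsilon>) * (cutoff_moment (t powr (1 - \<epsilon>)) / ln t))"
      unfolding cmult[OF t1] using \<epsilon> by (simp add: mean_cutoff_powr)
    also have "\<dots> \<le> L dixmier_mean" by (rule mono[OF tail_bounded_cmult[OF t1] tb ev])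
    finally show ?thesis .
  qed
  show "L dixmier_mean = ?a"
  proof (rule antisym)
    have "L dixmier_mean \<le> L (\<lambda>t. cutoff_moment t / ln t + 1 / ln t)" by (rule mono[OF tb tbu upper])
    then show "L dixmier_mean \<le> ?a" by (simp add: add[OF tail_bounded_cutoff tail_bounded_div_ln] mean_div_ln)
    show "?a \<le> L dixmier_mean"
    proof (rule tendsto_upperbound)
      show "((\<lambda>\<epsilon>. (1 - \<epsilon>) / (1 + \<epsilon>) * ?a) \<longlongrightarrow> ?a) (at_right 0)" by (auto intro!: tendsto_eq_intros)
      have "\<forall>\<^sub>F \<epsilon> in at_right (0::real). \<epsilon> < 1" using eventually_at_right_real[of 0 1] by (auto elim!: eventually_mono)
      then show "\<forall>\<^sub>F \<epsilon> in at_right 0. (1 - \<epsilon>) / (1 + \<epsilon>) * ?a \<le> L dixmier_mean"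
        using eventually_at_right_less[of 0] by eventually_elim (rule ge)
    qed simp
  qed
qed

end

section \<open>DPM states\<close>

lemma state_lim_cong:
  assumes "\<And>x. c \<le> x \<Longrightarrow> f x = g x"
  shows "state_lim S \<phi> f = state_lim S \<phi> g"
proof -
  have "(\<forall>\<^sub>F a in at_top. tail_fun a f \<in> Linf S \<and> \<phi> (tail_fun a f) = l) \<longleftrightarrow>
      (\<forall>\<^sub>F a in at_top. tail_fun a g \<in> Linf S \<and> \<phi> (tail_fun a g) = l)" for l
  proof (rule eventually_subst)
    show "\<forall>\<^sub>F a in at_top. (tail_fun a f \<in> Linf S \<and> \<phi> (tail_fun a f) = l) =
      (tail_fun a g \<in> Linf S \<and> \<phi> (tail_fun a g) = l)"
      using eventually_ge_at_top[of c]
    proof eventually_elim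
      case (elim a)
      then have "tail_fun a f = tail_fun a g" using assms by (auto simp: tail_fun_def)
      then show ?case by simp
    qed
  qed
  then show ?thesis by (simp add: state_lim_def)
qed

lemma Linf_of_realI:
  assumes "g \<in> borel_measurable borel" "\<And>x. x \<in> S \<Longrightarrow> \<bar>g x\<bar> \<le> B"
  shows "(\<lambda>x. complex_of_real (g x)) \<in> Linf S"
proof -
  have "(\<lambda>x. complex_of_real (g x)) \<in> borel_measurable lborel" using assms(1) by simp
  then have "(\<lambda>x. complex_of_real (g x)) \<in> borel_measurable (restrict_space lborel S)"
    by (rule measurable_restrict_space1)
  moreover have "AE x in restrict_space lborel S. norm (complex_of_real (g x)) \<le> B"
    by (rule AE_I2) (use assms(2) in \<open>auto simp: space_restrict_space\<close>)
  ultimately show ?thesis by (auto simp: Linf_def)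
qed

lemma tail_bounded_Linf:
  assumes "tail_bounded F"
  obtains c where "\<And>a S. c \<le> a \<Longrightarrow> tail_fun a (\<lambda>x. complex_of_real (F x)) \<in> Linf S"
proof -
  obtain B c where c: "\<And>t. c \<le> t \<Longrightarrow> \<bar>F t\<bar> \<le> B" and [measurable]: "F \<in> borel_measurable borel"
    using assms by (auto simp: tail_bounded_def eventually_at_top_linorder)
  have "tail_fun a (\<lambda>x. complex_of_real (F x)) \<in> Linf S" if "c \<le> a" for a S
  proof -
    have bd: "\<bar>F x\<bar> \<le> \<bar>B\<bar>" if "a \<le> x" for x using c[of x] \<open>c \<le> a\<close> that by linarith
    have "(\<lambda>x. complex_of_real (if a \<le> x then F x else 0)) \<in> Linf S"
      by (rule Linf_of_realI[where B = "\<bar>B\<bar>"], measurable) (use bd in auto)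
    also have "(\<lambda>x. complex_of_real (if a \<le> x then F x else 0)) = tail_fun a (\<lambda>x. complex_of_real (F x))"
      by (auto simp: tail_fun_def)
    finally show ?thesis .
  qed
  then show thesis by (rule that)
qed

locale DPM =
  fixes \<omega> :: "(real \<Rightarrow> complex) \<Rightarrow> complex"
  assumes DPM: "DPM_state \<omega>"
begin

lemma state: "Linf_state {0<..} \<omega>"
  using DPM by (simp add: DPM_state_def)

lemma state_lim_tail:
  assumes "tail_fun a f \<in> Linf {0<..}"
  shows "state_lim {0<..} \<omega> f = \<omega> (tail_fun a f)"
proof -
  have "state_lim {0<..} \<omega> f = state_lim {0<..} \<omega> (tail_fun a f)"
    by (rule state_lim_cong[of a]) (simp add: tail_fun_def)
  then show ?thesis by (simp add: state_lim_eq_DPM_state[OF DPM assms])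
qed

text \<open>The real part is taken for the sake of the type; \<open>state_lim_real\<close> shows
  that the value is real.\<close>

definition mean :: "(real \<Rightarrow> real) \<Rightarrow> real"
  where "mean F = Re (state_lim {0<..} \<omega> (\<lambda>t. complex_of_real (F t)))"

lemma real_valued:
  assumes "(\<lambda>t. complex_of_real (g t)) \<in> Linf {0<..}"
  shows "\<omega> (\<lambda>t. complex_of_real (g t)) \<in> \<real>"
proof -
  have l: "\<exists>l. \<omega> (\<lambda>t. complex_of_real (g t)) = complex_of_real l \<and>
      ess_liminf_at_top g \<le> ereal l \<and> ereal l \<le> ess_limsup_at_top g"
    using DPM[unfolded DPM_state_def, THEN conjunct2, THEN conjunct2, THEN conjunct1,
      THEN spec[of _ g], THEN mp, OF assms] .
  from l show ?thesis by (elim exE conjE, simp only: Reals_of_real)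
qed

lemma nonneg:
  assumes "(\<lambda>t. complex_of_real (g t)) \<in> Linf {0<..}" "\<And>t. 0 < t \<Longrightarrow> 0 \<le> g t"
  shows "0 \<le> Re (\<omega> (\<lambda>t. complex_of_real (g t)))"
proof -
  have "AE t in restrict_space lborel {0<..}. complex_of_real (g t) \<in> \<real>\<^sub>\<ge>\<^sub>0"
    by (rule AE_I2) (use assms(2) in \<open>auto simp: space_restrict_space complex_nonneg_Reals_iff\<close>)
  then have "\<omega> (\<lambda>t. complex_of_real (g t)) \<in> \<real>\<^sub>\<ge>\<^sub>0"
    by (rule state[unfolded Linf_state_def, THEN conjunct2, THEN conjunct2, THEN conjunct2, THEN conjunct1,
          THEN bspec, OF assms(1), THEN mp])
  then show ?thesis by (simp add: complex_nonneg_Reals_iff)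
qed

lemma state_lim_real:
  assumes "tail_bounded F"
  shows "state_lim {0<..} \<omega> (\<lambda>t. complex_of_real (F t)) = complex_of_real (mean F)"
proof -
  obtain c where c: "\<And>a S. c \<le> a \<Longrightarrow> tail_fun a (\<lambda>x. complex_of_real (F x)) \<in> Linf S"
    using tail_bounded_Linf[OF assms] by blast
  have eq: "tail_fun c (\<lambda>x. complex_of_real (F x)) = (\<lambda>x. complex_of_real (if c \<le> x then F x else 0))"
    by (auto simp: tail_fun_def)
  have "\<omega> (tail_fun c (\<lambda>x. complex_of_real (F x))) \<in> \<real>"
    using c[of c "{0<..}"] unfolding eq by (intro real_valued) simp
  then show ?thesis
    by (simp add: mean_def state_lim_tail[OF c[OF order_refl]])
qed

lemma mean_eq_tail:
  assumes "tail_bounded F"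
  obtains c where "\<And>a. c \<le> a \<Longrightarrow> tail_fun a (\<lambda>x. complex_of_real (F x)) \<in> Linf {0<..}"
    "\<And>a. c \<le> a \<Longrightarrow> \<omega> (tail_fun a (\<lambda>x. complex_of_real (F x))) = complex_of_real (mean F)"
proof -
  obtain c where c: "\<And>a S. c \<le> a \<Longrightarrow> tail_fun a (\<lambda>x. complex_of_real (F x)) \<in> Linf S"
    using tail_bounded_Linf[OF assms] by blast
  show thesis
  proof (rule that[of c])
    fix a assume "c \<le> a"
    from c[OF this] show "tail_fun a (\<lambda>x. complex_of_real (F x)) \<in> Linf {0<..}" .
    from state_lim_tail[OF this] show "\<omega> (tail_fun a (\<lambda>x. complex_of_real (F x))) = complex_of_real (mean F)"
      using state_lim_real[OF assms] by simp
  qed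
qed

sublocale power_mean mean
proof
  fix f g :: "real \<Rightarrow> real" and k a :: real
  assume f: "tail_bounded f"
  obtain cf where cf: "\<And>a. cf \<le> a \<Longrightarrow> tail_fun a (\<lambda>x. complex_of_real (f x)) \<in> Linf {0<..}"
    "\<And>a. cf \<le> a \<Longrightarrow> \<omega> (tail_fun a (\<lambda>x. complex_of_real (f x))) = complex_of_real (mean f)"
    using mean_eq_tail[OF f] by blast
  show "mean (\<lambda>t. k * f t) = k * mean f"
  proof -
    have eq: "tail_fun cf (\<lambda>x. complex_of_real (k * f x)) = (\<lambda>x. complex_of_real k * tail_fun cf (\<lambda>x. complex_of_real (f x)) x)"
      by (auto simp: tail_fun_def)
    have "tail_fun cf (\<lambda>x. complex_of_real (k * f x)) \<in> Linf {0<..}"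
      unfolding eq by (intro Linf_scale cf) simp
    from state_lim_tail[OF this] show ?thesis
      unfolding eq Linf_state_scale[OF state cf(1)[OF order_refl]] cf(2)[OF order_refl] by (simp add: mean_def)
  qed
  show "mean (\<lambda>t. f (t powr a)) = mean f" if a: "0 < a"
  proof -
    obtain B c where c: "\<And>t. c \<le> t \<Longrightarrow> \<bar>f t\<bar> \<le> B" and [measurable]: "f \<in> borel_measurable borel"
      using f by (auto simp: tail_bounded_def eventually_at_top_linorder)
    define b where "b = max 1 (max cf c)"
    have b: "cf \<le> b" "c \<le> b" "1 \<le> b" by (auto simp: b_def)
    \<comment> \<open>The invariance of \<omega> applies to elements of \<open>Linf\<close>, so the
      function is truncated late enough for both its bound and its membership to hold.\<close>
    define h where "h = tail_fun b (\<lambda>x. complex_of_real (f x))"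
    have h: "h \<in> Linf {0<..}" unfolding h_def by (rule cf) (simp add: b)
    have "\<omega> h = \<omega> (power_subst a h)"
      using DPM h a zero_less_one unfolding DPM_state_def by blast
    moreover have "power_subst a h \<in> Linf {0<..}"
    proof -
      have bd: "\<bar>f x\<bar> \<le> \<bar>B\<bar>" if "b \<le> x" for x using c[of x] b that by linarith
      have "(\<lambda>x. complex_of_real (if b \<le> x powr a then f (x powr a) else 0)) \<in> Linf {0<..}"
        by (rule Linf_of_realI[where B = "\<bar>B\<bar>"], measurable) (use bd in auto)
      also have "(\<lambda>x. complex_of_real (if b \<le> x powr a then f (x powr a) else 0)) = power_subst a h"
        by (auto simp: power_subst_def h_def tail_fun_def)
      finally show ?thesis .
    qed
    then have "\<omega> (power_subst a h) = state_lim {0<..} \<omega> (power_subst a h)"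
      by (rule state_lim_eq_DPM_state[OF DPM, symmetric])
    also have "\<dots> = state_lim {0<..} \<omega> (\<lambda>x. complex_of_real (f (x powr a)))"
    \<comment> \<open>After the substitution the truncation sits at \<open>b powr (1 / a)\<close>,
      and \<open>state_lim\<close> does not see it.\<close>
    proof (rule state_lim_cong[of "b powr (1 / a)"])
      fix x assume "b powr (1 / a) \<le> x"
      then have "(b powr (1 / a)) powr a \<le> x powr a" using a by (intro powr_mono2) auto
      then have "b \<le> x powr a" using a b by (simp add: powr_powr)
      then show "power_subst a h x = complex_of_real (f (x powr a))"
        by (simp add: power_subst_def h_def tail_fun_def)
    qed
    finally have "\<omega> h = state_lim {0<..} \<omega> (\<lambda>x. complex_of_real (f (x powr a)))" .
    then have "state_lim {0<..} \<omega> (\<lambda>x. complex_of_real (f (x powr a))) = complex_of_real (mean f)"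
      using cf(2)[OF b(1)] by (simp add: h_def)
    then show ?thesis by (simp add: mean_def[of "\<lambda>t. f (t powr a)"])
  qed
  assume g: "tail_bounded g"
  obtain cg where cg: "\<And>a. cg \<le> a \<Longrightarrow> tail_fun a (\<lambda>x. complex_of_real (g x)) \<in> Linf {0<..}"
    "\<And>a. cg \<le> a \<Longrightarrow> \<omega> (tail_fun a (\<lambda>x. complex_of_real (g x))) = complex_of_real (mean g)"
    using mean_eq_tail[OF g] by blast
  show "mean (\<lambda>t. f t + g t) = mean f + mean g"
  proof -
    define b where "b = max cf cg"
    have b: "cf \<le> b" "cg \<le> b" by (auto simp: b_def)
    have eq: "tail_fun b (\<lambda>x. complex_of_real (f x + g x)) =
        (\<lambda>x. tail_fun b (\<lambda>x. complex_of_real (f x)) x + tail_fun b (\<lambda>x. complex_of_real (g x)) x)"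
      by (auto simp: tail_fun_def)
    have "tail_fun b (\<lambda>x. complex_of_real (f x + g x)) \<in> Linf {0<..}"
      unfolding eq by (intro Linf_add cf cg b)
    from state_lim_tail[OF this] show ?thesis
      unfolding eq Linf_state_add[OF state cf(1)[OF b(1)] cg(1)[OF b(2)]] cf(2)[OF b(1)] cg(2)[OF b(2)]
      by (simp add: mean_def)
  qed
  show "mean f \<le> mean g" if "\<forall>\<^sub>F t in at_top. f t \<le> g t"
  proof -
    obtain c where c: "\<And>t. c \<le> t \<Longrightarrow> f t \<le> g t"
      using \<open>\<forall>\<^sub>F t in at_top. f t \<le> g t\<close> by (auto simp: eventually_at_top_linorder)
    define b where "b = max c (max cf cg)"
    have b: "cf \<le> b" "cg \<le> b" "c \<le> b" by (auto simp: b_def)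
    let ?F = "tail_fun b (\<lambda>x. complex_of_real (f x))" and ?G = "tail_fun b (\<lambda>x. complex_of_real (g x))"
    have eq: "(\<lambda>x. ?G x + complex_of_real (-1) * ?F x) = (\<lambda>x. complex_of_real (if b \<le> x then g x - f x else 0))"
      by (auto simp: tail_fun_def)
    note F = cf(1)[OF b(1)] and G = cg(1)[OF b(2)]
    have "(\<lambda>x. ?G x + complex_of_real (-1) * ?F x) \<in> Linf {0<..}"
      by (intro Linf_add Linf_scale F G)
    then have "0 \<le> Re (\<omega> (\<lambda>x. complex_of_real (if b \<le> x then g x - f x else 0)))"
      unfolding eq by (rule nonneg) (use b c in auto)
    also have "\<omega> (\<lambda>x. complex_of_real (if b \<le> x then g x - f x else 0)) = complex_of_real (mean g) + complex_of_real (-1) * complex_of_real (mean f)"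
      unfolding eq[symmetric] Linf_state_add[OF state G Linf_scale[OF F]] Linf_state_scale[OF state F] cf(2)[OF b(1)] cg(2)[OF b(2)] ..
    finally show ?thesis by simp
  qed
next
  fix k :: real
  have 1: "(\<lambda>_. 1) \<in> Linf {0<..}" using Linf_of_realI[of "\<lambda>_. 1" "{0<..}" 1] by simp
  have k: "(\<lambda>_. complex_of_real k) \<in> Linf {0<..}" by (rule Linf_of_realI[of _ _ "\<bar>k\<bar>"]) auto
  have "\<omega> (\<lambda>_. complex_of_real k * 1) = complex_of_real k * \<omega> (\<lambda>_. 1)"
    by (rule Linf_state_scale[OF state 1])
  moreover have "\<omega> (\<lambda>_. 1) = 1" using state by (simp add: Linf_state_def)
  ultimately show "mean (\<lambda>_. k) = k" using state_lim_eq_DPM_state[OF DPM k] by (simp add: mean_def)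
qed

lemma omega_lim_real:
  assumes "tail_bounded F"
  shows "omega_lim \<omega> (\<lambda>t. complex_of_real (F t)) = complex_of_real (mean F)"
proof -
  obtain c where c: "\<And>a S. c \<le> a \<Longrightarrow> tail_fun a (\<lambda>x. complex_of_real (F x)) \<in> Linf S"
    using tail_bounded_Linf[OF assms] by blast
  have "tail_fun (max 1 c) (\<lambda>x. complex_of_real (F x)) \<in> Linf {0<..}" by (rule c) simp
  then have "\<exists>a>0. tail_fun a (\<lambda>x. complex_of_real (F x)) \<in> Linf {0<..}"
    by (intro exI[of _ "max 1 c"]) auto
  then show ?thesis using state_lim_real[OF assms] by (simp add: omega_lim_def)
qed

text \<open>\<open>\<omega>'\<close> is known only on functions of the form
  \<open>log_iso_inv g\<close>. Truncating \<open>f\<close> at \<open>a\<close> is the transport of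
  truncating \<open>F\<close> at \<open>exp a\<close>, and \<open>exp a \<ge> a\<close> puts this
  beyond the thresholds of \<open>F\<close>.\<close>

lemma state_lim_transported:
  assumes \<omega>': "\<forall>g\<in>Linf {0<..}. \<omega>' (log_iso_inv g) = \<omega> g"
    and F: "tail_bounded F" and f: "\<And>r. 1 \<le> r \<Longrightarrow> f r = F (exp r)" and "f \<in> borel_measurable borel"
  shows "state_lim UNIV \<omega>' (\<lambda>r. complex_of_real (f r)) = complex_of_real (mean F)"
proof -
  obtain B c where c: "\<And>t. c \<le> t \<Longrightarrow> \<bar>F t\<bar> \<le> B"
    using F by (auto simp: tail_bounded_def eventually_at_top_linorder)
  obtain cF where cF: "\<And>a. cF \<le> a \<Longrightarrow> tail_fun a (\<lambda>x. complex_of_real (F x)) \<in> Linf {0<..}"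
    "\<And>a. cF \<le> a \<Longrightarrow> \<omega> (tail_fun a (\<lambda>x. complex_of_real (F x))) = complex_of_real (mean F)"
    using mean_eq_tail[OF F] by blast
  have ev: "\<forall>\<^sub>F a in at_top. tail_fun a (\<lambda>r. complex_of_real (f r)) \<in> Linf UNIV \<and>
      \<omega>' (tail_fun a (\<lambda>r. complex_of_real (f r))) = complex_of_real (mean F)"
    using eventually_ge_at_top[of 1] eventually_ge_at_top[of c] eventually_ge_at_top[of cF]
  proof eventually_elim
    case (elim a)
    have ea: "a \<le> exp a" using exp_ge_add_one_self[of a] by linarith
    have "tail_fun a (\<lambda>r. complex_of_real (f r)) = log_iso_inv (tail_fun (exp a) (\<lambda>x. complex_of_real (F x)))"
      using elim f by (auto simp: log_iso_inv_def tail_fun_def)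
    moreover have "tail_fun (exp a) (\<lambda>x. complex_of_real (F x)) \<in> Linf {0<..}"
      "\<omega> (tail_fun (exp a) (\<lambda>x. complex_of_real (F x))) = complex_of_real (mean F)"
      using cF[of "exp a"] ea elim by auto
    moreover have "tail_fun a (\<lambda>r. complex_of_real (f r)) \<in> Linf UNIV"
    proof -
      have "(\<lambda>r. complex_of_real (if a \<le> r then f r else 0)) \<in> Linf UNIV"
      proof (rule Linf_of_realI[where B = "\<bar>B\<bar>"])
        show "\<bar>if a \<le> r then f r else 0\<bar> \<le> \<bar>B\<bar>" for r
        proof (cases "a \<le> r")
          case True
          have "r \<le> exp r" using exp_ge_add_one_self[of r] by linarith
          then show ?thesis using True elim f[of r] c[of "exp r"] by auto
        qed simp
      qed (use assms(4) in measurable)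
      also have "(\<lambda>r. complex_of_real (if a \<le> r then f r else 0)) = tail_fun a (\<lambda>r. complex_of_real (f r))"
        by (auto simp: tail_fun_def)
      finally show ?thesis .
    qed
    ultimately show ?case using \<omega>' by simp
  qed
  show ?thesis unfolding state_lim_def
  proof (rule the_equality)
    show "\<forall>\<^sub>F a in at_top. tail_fun a (\<lambda>r. complex_of_real (f r)) \<in> Linf UNIV \<and>
      \<omega>' (tail_fun a (\<lambda>r. complex_of_real (f r))) = complex_of_real (mean F)" by (rule ev)
  next
    fix l assume "\<forall>\<^sub>F a in at_top. tail_fun a (\<lambda>r. complex_of_real (f r)) \<in> Linf UNIV \<and>
      \<omega>' (tail_fun a (\<lambda>r. complex_of_real (f r))) = l"
    with ev have "\<forall>\<^sub>F a in at_top :: real filter. l = complex_of_real (mean F)" by eventually_elim auto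
    then show "l = complex_of_real (mean F)" by simp
  qed
qed

end

section \<open>The logarithmic mean of the heat function\<close>

context dixmier_law
begin

lemma measurable_heat [measurable]: "heat a \<in> borel_measurable borel"
  unfolding heat_def[abs_def] by (rule borel_measurable_nn_integral) measurable

text \<open>Finiteness of \<open>heat_integral\<close> makes \<open>heat a s\<close> finite for
  almost every \<open>s\<close> in the range of integration, so \<open>enn2real\<close> loses
  nothing.\<close>

lemma has_integral_heat:
  assumes a: "0 < a"
  shows "integrable lborel (\<lambda>s. indicator {1..t} s * (1 / s * (1 / s * enn2real (heat a s))))"
    and "(\<integral>s. indicator {1..t} s * (1 / s * (1 / s * enn2real (heat a s))) \<partial>lborel) = enn2real (heat_integral a t)"
proof -
  let ?w = "\<lambda>s. indicator {1..t} s * (1 / s * (1 / s * enn2real (heat a s)))"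
  have "AE s in lborel. ennreal (1 / s\<^sup>2) * heat a s * indicator {1..t} s \<noteq> \<infinity>"
    by (rule nn_integral_PInf_AE) (use heat_integral_finite[OF a, of t] in \<open>auto simp: heat_integral_def\<close>)
  then have "AE s in lborel. ennreal (1 / s\<^sup>2) * heat a s * indicator {1..t} s = ennreal (?w s)"
  proof eventually_elim
    case (elim s)
    show ?case
    proof (cases "s \<in> {1..t}")
      case True
      have "heat a s \<noteq> \<infinity>"
      proof
        assume "heat a s = \<infinity>"
        then show False using elim True by (simp add: ennreal_mult_top)
      qed
      then have "heat a s = ennreal (enn2real (heat a s))" by (simp add: less_top)
      then have "ennreal (1 / s\<^sup>2) * heat a s = ennreal (1 / s\<^sup>2 * enn2real (heat a s))"
        by (metis ennreal_mult' enn2real_nonneg zero_le_divide_1_iff zero_le_power2 ennreal_mult)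
      then show ?thesis using True by (simp add: power2_eq_square)
    qed simp
  qed
  then have nn: "(\<integral>\<^sup>+s. ennreal (?w s) \<partial>lborel) = heat_integral a t"
    unfolding heat_integral_def by (intro nn_integral_cong_AE) (auto elim!: eventually_mono)
  have pos: "0 \<le> ?w s" for s by (auto simp: indicator_def)
  show "integrable lborel ?w"
    by (rule integrableI_nonneg) (use pos nn heat_integral_finite[OF a] in auto)
  show "integral\<^sup>L lborel ?w = enn2real (heat_integral a t)"
    unfolding nn[symmetric] by (rule integral_eq_nn_integral) (use pos in auto)
qed

lemma log_mean_heat:
  assumes a: "0 < a" and f: "\<And>s. 1 \<le> s \<Longrightarrow> f s = complex_of_real (1 / s * enn2real (heat a s))" and t: "1 < t"
  shows "log_mean f t = complex_of_real (heat_mean a t)"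
proof -
  have "(LBINT s=ereal 1..ereal t. (1 / s) *\<^sub>R f s) = (LBINT s:{1..t}. (1 / s) *\<^sub>R f s)"
    using t by (intro interval_integral_Icc) simp
  also have "\<dots> = (\<integral>s. complex_of_real (indicator {1..t} s * (1 / s * (1 / s * enn2real (heat a s)))) \<partial>lborel)"
    unfolding set_lebesgue_integral_def
    by (intro Bochner_Integration.integral_cong) (auto simp: f indicator_def scaleR_conv_of_real)
  also have "\<dots> = complex_of_real (enn2real (heat_integral a t))"
    by (simp only: integral_complex_of_real has_integral_heat(2)[OF a])
  finally show ?thesis by (simp add: log_mean_def heat_mean_def scaleR_conv_of_real)
qed

text \<open>Truncating at \<open>b\<close> removes the constant \<open>heat_integral a b\<close>
  from the numerator. For \<open>t \<le> b\<close>, including the oriented integrals with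
  \<open>t < 1\<close>, the truncated function vanishes on the whole range.\<close>

lemma log_mean_tail_heat:
  assumes a: "0 < a" and f: "\<And>s. 1 \<le> s \<Longrightarrow> f s = complex_of_real (1 / s * enn2real (heat a s))" and b: "1 < b" and t: "0 < t"
  shows "log_mean (tail_fun b f) t =
    complex_of_real (if b < t then heat_mean a t - enn2real (heat_integral a b) / ln t else 0)"
proof (cases "b < t")
  case True
  let ?w = "\<lambda>t s. indicator {1..t} s * (1 / s * (1 / s * enn2real (heat a s)))"
  have "(LBINT s=ereal 1..ereal t. (1 / s) *\<^sub>R tail_fun b f s) = (LBINT s:{1..t}. (1 / s) *\<^sub>R tail_fun b f s)"
    using True b by (intro interval_integral_Icc) simp
  also have "\<dots> = (\<integral>s. complex_of_real (indicator {1..t} s * (1 / s * (if b \<le> s then 1 / s * enn2real (heat a s) else 0))) \<partial>lborel)"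
    unfolding set_lebesgue_integral_def using b
    by (intro Bochner_Integration.integral_cong) (auto simp: f indicator_def scaleR_conv_of_real tail_fun_def)
  also have "\<dots> = complex_of_real (\<integral>s. indicator {1..t} s * (1 / s * (if b \<le> s then 1 / s * enn2real (heat a s) else 0)) \<partial>lborel)"
    by (rule integral_complex_of_real)
  also have "(\<integral>s. indicator {1..t} s * (1 / s * (if b \<le> s then 1 / s * enn2real (heat a s) else 0)) \<partial>lborel)
      = (\<integral>s. ?w t s - ?w b s \<partial>lborel)"
  proof (rule integral_cong_AE)
    \<comment> \<open>The two closed intervals overlap in \<open>b\<close>, where the truncated
      function is kept but the difference is 0.\<close>
    show "AE s in lborel. indicator {1..t} s * (1 / s * (if b \<le> s then 1 / s * enn2real (heat a s) else 0)) = ?w t s - ?w b s"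
      using AE_lborel_singleton[of b] by eventually_elim (use True in \<open>auto simp: indicator_def\<close>)
  qed measurable
  also have "\<dots> = enn2real (heat_integral a t) - enn2real (heat_integral a b)"
    using has_integral_heat[OF a] by (subst Bochner_Integration.integral_diff) auto
  finally show ?thesis using True
    by (simp add: log_mean_def heat_mean_def scaleR_conv_of_real diff_divide_distrib)
next
  case False
  have "(LBINT s=ereal 1..ereal t. (1 / s) *\<^sub>R tail_fun b f s) = 0"
  proof -
    have z: "indicator (einterval u v) s *\<^sub>R ((1 / s) *\<^sub>R tail_fun b f s) = 0"
      if "v \<le> ereal b" for u v s
    proof (cases "s \<in> einterval u v")
      case True
      then have "ereal s < v" by (simp add: einterval_def)
      also note that
      finally have "s < b" by simp
      then show ?thesis by (simp add: tail_fun_def)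
    qed simp
    have "ereal 1 \<le> ereal b" "ereal t \<le> ereal b" using b False by auto
    then show ?thesis
      by (simp only: interval_lebesgue_integral_def set_lebesgue_integral_def z integral_zero if_cancel minus_zero)
  qed
  then show ?thesis using False by (simp add: log_mean_def)
qed

end

locale dixmier_law_DPM = dixmier_law + DPM

sublocale dixmier_law_DPM \<subseteq> dixmier_law_mean m K e0 C mean ..

context dixmier_law_DPM
begin

text \<open>\<open>omega_lim\<close> has two branches. If the function is bounded near infinity,
  invariance of \<omega> under the logarithmic mean is used; otherwise that mean enters by
  definition. Both lead to the mean of \<open>heat_mean a\<close>, since the constant caused by
  truncation is divided by \<open>ln t\<close>.\<close>

lemma omega_lim_heat:
  assumes a: "0 < a" and f: "\<And>s. 1 \<le> s \<Longrightarrow> f s = complex_of_real (1 / s * enn2real (heat a s))"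
  shows "omega_lim \<omega> f = complex_of_real (mean (heat_mean a))"
proof (cases "\<exists>c>0. tail_fun c f \<in> Linf {0<..}")
  case True
  then obtain c where c: "tail_fun c f \<in> Linf {0<..}" by blast
  \<comment> \<open>\<open>b \<ge> 2\<close> keeps \<open>ln t\<close> away from 0 on the support of
    \<open>k\<close>.\<close>
  define b where "b = max c 2"
  have b: "1 < b" "c \<le> b" by (auto simp: b_def)
  have "tail_fun b f = tail_fun b (tail_fun c f)" using b by (auto simp: tail_fun_def)
  then have tb: "tail_fun b f \<in> Linf {0<..}" using tail_fun_Linf[OF c] by simp
  define k where "k t = (if b < t then heat_mean a t - enn2real (heat_integral a b) / ln t else 0)" for t
  have lm: "log_mean (tail_fun b f) t = complex_of_real (k t)" if "0 < t" for t
    unfolding k_def by (rule log_mean_tail_heat[OF a f b(1) that])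
  have [measurable]: "heat_mean a \<in> borel_measurable borel" by (rule measurable_heat_mean[OF a])
  have km[measurable]: "k \<in> borel_measurable borel" unfolding k_def[abs_def] by measurable
  let ?h = "\<lambda>t. heat_mean a t + (- enn2real (heat_integral a b)) / ln t"
  have th: "tail_bounded ?h"
    by (intro tail_bounded_add tail_bounded_heat_mean a tail_bounded_div_ln)
  obtain B t0 where B: "\<And>t. t0 \<le> t \<Longrightarrow> \<bar>?h t\<bar> \<le> B"
    using th by (auto simp: tail_bounded_def eventually_at_top_linorder)
  \<comment> \<open>\<open>Linf\<close> demands a bound for all \<open>t > 0\<close>: monotonicity
    of \<open>heat_integral\<close> gives it between \<open>b\<close> and \<open>t0\<close>, tail
    boundedness beyond.\<close>
  have kb: "\<bar>k t\<bar> \<le> \<bar>B\<bar> + enn2real (heat_integral a (max b t0)) / ln b" for t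
  proof (cases "b < t")
    case True
    show ?thesis
    proof (cases "t0 \<le> t")
      case True
      have "0 \<le> enn2real (heat_integral a (max b t0)) / ln b" using b by simp
      then show ?thesis using B[OF True] \<open>b < t\<close> by (simp add: k_def)
    next
      case False
      have l: "0 < ln b" "ln b \<le> ln t" using b \<open>b < t\<close> by auto
      have "enn2real (heat_integral a b) \<le> enn2real (heat_integral a t)"
        "enn2real (heat_integral a t) \<le> enn2real (heat_integral a (max b t0))"
        using heat_integral_finite[OF a] False \<open>b < t\<close>
        by (auto intro!: enn2real_mono heat_integral_mono)
      moreover have "k t = (enn2real (heat_integral a t) - enn2real (heat_integral a b)) / ln t"
        using \<open>b < t\<close> by (simp add: k_def heat_mean_def diff_divide_distrib)
      moreover have "(enn2real (heat_integral a t) - enn2real (heat_integral a b)) / ln t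
          \<le> enn2real (heat_integral a (max b t0)) / ln b"
        using l calculation(1,2) by (intro frac_le) (auto intro: order_trans[rotated])
      ultimately show ?thesis using l by (simp add: abs_of_nonneg)
    qed
  qed (use b in \<open>simp add: k_def\<close>)
  have kL: "(\<lambda>t. complex_of_real (k t)) \<in> Linf {0<..}"
    by (rule Linf_of_realI[OF km kb])
  have "\<omega> (tail_fun b f) = \<omega> (log_mean (tail_fun b f))" by (rule omega_lim_eq_DPM_state(2)[OF DPM tb])
  also have "\<dots> = \<omega> (\<lambda>t. complex_of_real (k t))"
  proof -
    \<comment> \<open>The formula for the mean is known for \<open>t > 0\<close>, so the two
      functions are compared as elements of \<open>Linf\<close>.\<close>
    have "log_mean (tail_fun b f) \<in> borel_measurable (restrict_space lborel {0<..})
      \<longleftrightarrow> (\<lambda>t. complex_of_real (k t)) \<in> borel_measurable (restrict_space lborel {0<..})"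
      by (rule measurable_cong) (auto simp: space_restrict_space lm)
    moreover have "AE t in restrict_space lborel {0<..}. log_mean (tail_fun b f) t = complex_of_real (k t)"
      by (rule AE_I2) (auto simp: space_restrict_space lm)
    moreover from this have "AE t in restrict_space lborel {0<..}.
        norm (log_mean (tail_fun b f) t) \<le> \<bar>B\<bar> + enn2real (heat_integral a (max b t0)) / ln b"
      by eventually_elim (simp add: kb)
    ultimately have "log_mean (tail_fun b f) \<in> Linf {0<..}" using kL by (auto simp: Linf_def)
    then show ?thesis
      using state[unfolded Linf_state_def, THEN conjunct1, THEN bspec, THEN bspec, OF _ kL, THEN mp]
        \<open>AE t in restrict_space lborel {0<..}. log_mean (tail_fun b f) t = complex_of_real (k t)\<close> by blast
  qed
  also have "\<dots> = state_lim {0<..} \<omega> (\<lambda>t. complex_of_real (k t))"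
    by (rule state_lim_eq_DPM_state[OF DPM kL, symmetric])
  also have "\<dots> = state_lim {0<..} \<omega> (\<lambda>t. complex_of_real (?h t))"
    by (rule state_lim_cong[of "b + 1"]) (auto simp: k_def)
  also have "\<dots> = complex_of_real (mean ?h)" by (rule state_lim_real[OF th])
  also have "mean ?h = mean (heat_mean a)"
    unfolding add[OF tail_bounded_heat_mean[OF a] tail_bounded_div_ln] mean_div_ln by simp
  finally show ?thesis
    using True state_lim_tail[OF tb] by (simp add: omega_lim_def)
next
  case False
  have "omega_lim \<omega> f = state_lim {0<..} \<omega> (log_mean f)"
    unfolding omega_lim_def by (rule if_not_P[OF False])
  also have "\<dots> = state_lim {0<..} \<omega> (\<lambda>t. complex_of_real (heat_mean a t))"
    by (rule state_lim_cong[of 2]) (use log_mean_heat[OF a f] in auto)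
  also have "\<dots> = complex_of_real (mean (heat_mean a))"
    by (rule state_lim_real[OF tail_bounded_heat_mean[OF a]])
  finally show ?thesis .
qed

end

section \<open>From the class of the operator to its law, and the theorem\<close>

lemma (in traced_positive_op) dixmier_law_power_law:
  assumes Z: "T \<in> Z_class N \<tau> p" and p: "1 \<le> p"
  obtains e0 C where "dixmier_law (power_law p) ((norm T + 1) powr p) e0 C"
proof -
  let ?f = "\<lambda>s. ennreal_powr (ennreal (s - p) * \<tau> (op_powr T s)) (1 / s)"
  have "Limsup (at_right p) ?f < \<infinity>" using Z by (simp add: Z_class_def)
  then obtain c where c: "Limsup (at_right p) ?f < c" "c < \<infinity>" using dense by blast
  from Limsup_lessD[OF c(1)] have "\<forall>\<^sub>F s in at_right p. ?f s < c" .
  then obtain s1 where s1: "p < s1" "\<And>s. p < s \<Longrightarrow> s < s1 \<Longrightarrow> ?f s < c"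
    by (auto simp: eventually_at_right[OF less_add_one[of p]] dest: less_trans)
  \<comment> \<open>The maximum with 1 makes \<open>c' powr s\<close> increase in \<open>s\<close>,
    so that one constant \<open>C\<close> serves for all \<open>s\<close> up to
    \<open>s1\<close>.\<close>
  define c' where "c' = max 1 (enn2real c)"
  define C where "C = c' powr s1"
  have bd: "ennreal (s - p) * \<tau> (op_powr T s) \<le> ennreal C" if s: "p < s" "s < s1" for s
  proof -
    let ?X = "ennreal (s - p) * \<tau> (op_powr T s)"
    have fin: "?X \<noteq> \<infinity>"
    proof
      assume "?X = \<infinity>"
      then have "?f s = \<infinity>" by (simp add: ennreal_powr_def)
      then show False using s1(2)[OF s] by simp
    qed
    then have "ennreal (enn2real ?X powr (1 / s)) < c" using s1(2)[OF s] by (simp add: ennreal_powr_def)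
    also have "c = ennreal (enn2real c)" using c(2) by simp
    finally have "enn2real ?X powr (1 / s) < enn2real c" by (subst (asm) ennreal_less_iff) auto
    then have "(enn2real ?X powr (1 / s)) powr s \<le> c' powr s"
      using s p by (intro powr_mono2) (auto simp: c'_def)
    then have "enn2real ?X \<le> c' powr s" using s p by (simp add: powr_powr)
    also have "\<dots> \<le> C" unfolding C_def using s by (intro powr_mono) (auto simp: c'_def)
    finally have "ennreal (enn2real ?X) \<le> ennreal C" by (rule ennreal_leI)
    then show ?thesis using fin by (simp add: less_top)
  qed
  \<comment> \<open>\<open>e = s / p - 1\<close> maps the range between \<open>p\<close> and
    \<open>s1\<close> onto the range below \<open>(s1 - p) / p\<close>.\<close>
  have "dixmier_law (power_law p) ((norm T + 1) powr p) ((s1 - p) / p) C"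
  proof
    show "sets (power_law p) = sets borel" by simp
    show "AE y in power_law p. 0 < y \<and> y \<le> (norm T + 1) powr p" using p by (intro AE_power_law) simp
    show "1 \<le> (norm T + 1) powr p" using p by (intro ge_one_powr_ge_zero) auto
    show "0 < (s1 - p) / p" using p s1 by simp
    show "0 \<le> C" by (simp add: C_def)
    fix e assume e: "0 < e" "e < (s1 - p) / p"
    have "\<tau> (op_powr T (p * (1 + e))) = (\<integral>\<^sup>+y. ennreal (y powr (1 + e)) \<partial>power_law p)"
      using p e by (subst trace_op_powr[of _ p]) (auto intro: add_pos_pos)
    moreover have "p < p * (1 + e)" "p * (1 + e) < s1" using p e by (auto simp: field_simps)
    ultimately have "ennreal (p * (1 + e) - p) * (\<integral>\<^sup>+y. ennreal (y powr (1 + e)) \<partial>power_law p) \<le> ennreal C"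
      using bd[of "p * (1 + e)"] by simp
    moreover have "ennreal e \<le> ennreal (p * (1 + e) - p)"
      using p e by (intro ennreal_leI) (simp add: distrib_left)
    ultimately show "ennreal e * (\<integral>\<^sup>+y. ennreal (y powr (1 + e)) \<partial>power_law p) \<le> ennreal C"
      by (meson mult_right_mono order_trans zero_le)
  qed
  then show thesis by (rule that)
qed

theorem theorem5p1:
  fixes N :: "('a::complex_hilbert \<Rightarrow>\<^sub>L 'a) set"
    and \<tau> :: "('a \<Rightarrow>\<^sub>L 'a) \<Rightarrow> ennreal"
    and T :: "'a \<Rightarrow>\<^sub>L 'a"
    and p q :: real
    and \<omega> \<omega>' :: "(real \<Rightarrow> complex) \<Rightarrow> complex"
  assumes "separable_space (euclidean :: 'a topology)"
    and "von_neumann_algebra N"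
    and "is_trace N \<tau>" and "faithful_trace N \<tau>" and "normal_trace N \<tau>" and "semifinite_trace N \<tau>"
    and "1 \<le> p"
    and "T \<in> Z_class N \<tau> p"
    and "DPM_state \<omega>"
    and "Linf_state UNIV \<omega>'"
    and "\<forall>g\<in>Linf {0<..}. \<omega>' (log_iso_inv g) = \<omega> g"
    and "0 < q"
  shows "omega_lim \<omega> (\<lambda>x. complex_of_real (1 / x * enn2real (\<tau> (heat_op T q (x powr (- q / p))))))
           = complex_of_real (1 / q * Gamma (p / q)) *
             state_lim UNIV \<omega>' (\<lambda>r. complex_of_real (1 / r * zeta_fun \<tau> T (p + 1 / r))) \<and>
         complex_of_real (1 / q * Gamma (p / q)) *
             state_lim UNIV \<omega>' (\<lambda>r. complex_of_real (1 / r * zeta_fun \<tau> T (p + 1 / r)))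
           = complex_of_real (p / q * Gamma (p / q)) * dixmier_value \<tau> \<omega> (op_powr T p)"
proof -
  interpret traced_positive_op N \<tau> T
    by unfold_locales (use assms in \<open>auto simp: Z_class_def\<close>)
  have p: "0 < p" using assms(7) by simp
  obtain e0 C where "dixmier_law (power_law p) ((norm T + 1) powr p) e0 C"
    using dixmier_law_power_law[OF assms(8,7)] .
  then interpret dixmier_law "power_law p" "(norm T + 1) powr p" e0 C .
  interpret DPM \<omega> by unfold_locales (rule assms(9))
  interpret dixmier_law_DPM "power_law p" "(norm T + 1) powr p" e0 C \<omega> ..
  \<comment> \<open>All three functionals turn out to be multiples of this number.\<close>
  define d where "d = mean (\<lambda>t. cutoff_moment t / ln t)"
  have heat: "omega_lim \<omega> (\<lambda>x. complex_of_real (1 / x * enn2real (\<tau> (heat_op T q (x powr (- q / p))))))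
      = complex_of_real (p / q * Gamma (p / q) * d)"
  proof -
    \<comment> \<open>With \<open>a = q / p\<close> the two powers in the exponent combine to
      \<open>(x * y) powr - a\<close>, and \<open>1 / a * Gamma (1 / a)\<close> is the constant of
      the theorem.\<close>
    have "\<tau> (heat_op T q (x powr (- q / p))) = heat (q / p) x" if "1 \<le> x" for x
      unfolding heat_def using p assms(12) that
      by (subst trace_heat_op[OF p]) (auto intro!: nn_integral_cong_AE AE_mI simp: powr_mult)
    then have "omega_lim \<omega> (\<lambda>x. complex_of_real (1 / x * enn2real (\<tau> (heat_op T q (x powr (- q / p))))))
        = complex_of_real (mean (heat_mean (q / p)))"
      using p assms(12) by (intro omega_lim_heat) auto
    then show ?thesis using mean_heat[of "q / p"] p assms(12) by (simp add: d_def)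
  qed
  have zeta: "state_lim UNIV \<omega>' (\<lambda>r. complex_of_real (1 / r * zeta_fun \<tau> T (p + 1 / r))) = complex_of_real (p * d)"
  proof -
    \<comment> \<open>\<open>op_powr T (p + 1 / r)\<close> has exponent
      \<open>1 + 1 / (p * r)\<close> on the law, which is that of \<open>zeta_mean\<close> at
      \<open>exp (p * r)\<close>, that is at \<open>t powr p\<close> for \<open>t = exp r\<close>.
      The factor \<open>p\<close> restores \<open>1 / r\<close>, and power invariance removes the
      substitution.\<close>
    let ?F = "\<lambda>t. p * zeta_mean (t powr p)"
    have tF: "tail_bounded ?F"
      by (intro tail_bounded_cmult tail_bounded_powr tail_bounded_zeta_mean p)
    have "1 / r * zeta_fun \<tau> T (p + 1 / r) = ?F (exp r)" if r: "1 \<le> r" for r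
    proof -
      have e: "(p + 1 / r) / p = 1 + 1 / (p * r)" using p r by (simp add: field_simps)
      have "\<tau> (op_powr T (p + 1 / r)) = ennreal (\<integral>y. y powr (1 + 1 / (p * r)) \<partial>power_law p)"
        using p r integrable_powr[of "1 / (p * r)"]
        by (subst trace_op_powr[of _ p]) (auto simp: e add_pos_pos nn_integral_eq_integral)
      then have "zeta_fun \<tau> T (p + 1 / r) = (\<integral>y. y powr (1 + 1 / (p * r)) \<partial>power_law p)"
        by (simp add: zeta_fun_def)
      moreover have "ln (exp r powr p) = p * r" by (simp add: powr_def)
      ultimately show ?thesis using p r by (simp add: zeta_mean_def)
    qed
    then have "state_lim UNIV \<omega>' (\<lambda>r. complex_of_real (1 / r * zeta_fun \<tau> T (p + 1 / r)))
        = state_lim UNIV \<omega>' (\<lambda>r. complex_of_real (?F (exp r)))"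
      by (intro state_lim_cong[of 1]) simp
    also have "\<dots> = complex_of_real (mean ?F)"
    proof (rule state_lim_transported[OF assms(11) tF refl])
      have [measurable]: "?F \<in> borel_measurable borel" using tF by (simp add: tail_bounded_def)
      have "(\<lambda>r. ?F (exp r)) = ?F \<circ> exp" by auto
      then show "(\<lambda>r. ?F (exp r)) \<in> borel_measurable borel"
        using measurable_zeta_mean by measurable
    qed
    also have "mean ?F = p * d"
      using p by (simp add: cmult tail_bounded_powr tail_bounded_zeta_mean powr mean_zeta d_def)
    finally show ?thesis .
  qed
  have "dixmier_value \<tau> \<omega> (op_powr T p) = omega_lim \<omega> (\<lambda>t. complex_of_real (dixmier_mean t))"
    unfolding dixmier_value_def dixmier_mean_def rearrangement_def singular_number_op_powr[OF p] ..
  also have "\<dots> = complex_of_real d"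
    unfolding omega_lim_real[OF tail_bounded_dixmier_mean] mean_dixmier d_def ..
  finally have dix: "dixmier_value \<tau> \<omega> (op_powr T p) = complex_of_real d" .
  show ?thesis unfolding heat zeta dix by simp
qed

end
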